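(* Let $k\ge 1$ and let $\mathcal V$ be a $k$-fold monoidal category with products $\otimes_1,\dots,\otimes_k$, associators $\alpha^1,\dots,\alpha^k$, interchange transformations $\eta^{ij}$ ($1\le i<j\le k$) and unit $I$. Let $\mathcal V\text{-Cat}$ be the 2-category of small categories enriched over the monoidal category $(\mathcal V,\otimes_1,\alpha^1,I)$. Then $\mathcal V\text{-Cat}$, equipped with the unit $\mathcal V$-category $\mathcal I$, the products $\otimes^{(1)}_i$ ($1\le i\le k-1$), the associators $\alpha^{(1)i}$ ($1\le i\le k-1$) and the interchange transformations $\eta^{(1)i,j}$ ($1\le i<j\le k-1$) described in the context, is a $(k-1)$-fold monoidal 2-category.
   Context: **Monoidal category.** Here this means a category with a functor $\otimes$ of two variables, an object $I$ that is a strict two-sided unit for $\otimes$, and a natural associativity isomorphism $\alpha$ satisfying the pentagon axiom; no further axiom is imposed. **$n$-fold monoidal category.** It is a category $\mathcal V$ with $n$ functors $\otimes_1,\dots,\otimes_n:\mathcal V\times\mathcal V\to\mathcal V$; an object $I$ that is a strict two-sided unit for every $\otimes_i$; for each $i$ a natural isomorphism $\alpha^i_{UVW}:(U\otimes_i V)\otimes_i W\to U\otimes_i(V\otimes_i W)$ satisfying the usual pentagon axiom; and for each pair $1\le i<j\le n$ a natural transformation (not required to be invertible) $$\eta^{ij}_{ABCD}:(A\otimes_j B)\otimes_i(C\otimes_j D)\to(A\otimes_i C)\otimes_j(B\otimes_i D)$$ such that (writing $\eta=\eta^{ij}$ in (a)-(d)): (a) Internal unit condition: $\eta_{ABII}=\eta_{IIAB}=1_{A\otimes_j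 B}$. (b) External unit condition: $\eta_{AIBI}=\eta_{IAIB}=1_{A\otimes_i B}$. (c) Internal associativity: $$\eta_{U,V,W\otimes_iY,X\otimes_iZ}\circ(1_{U\otimes_jV}\otimes_i\eta_{WXYZ})\circ\alpha^i_{U\otimes_jV,\,W\otimes_jX,\,Y\otimes_jZ}=(\alpha^i_{UWY}\otimes_j\alpha^i_{VXZ})\circ\eta_{U\otimes_iW,V\otimes_iX,Y,Z}\circ(\eta_{UVWX}\otimes_i1_{Y\otimes_jZ}).$$ (d) External associativity: $$(1_{U\otimes_iX}\otimes_j\eta_{VWYZ})\circ\eta_{U,V\otimes_jW,X,Y\otimes_jZ}\circ(\alpha^j_{UVW}\otimes_i\alpha^j_{XYZ})=\alpha^j_{U\otimes_iX,\,V\otimes_iY,\,W\otimes_iZ}\circ(\eta_{UVXY}\otimes_j1_{W\otimes_iZ})\circ\eta_{U\otimes_jV,W,X\otimes_jY,Z}.$$ (e) Giant hexagon: for all $1\le i<j<l\le n$, $$(\eta^{ij}_{ABCD}\otimes_l\eta^{ij}_{A'B'C'D'})\circ\eta^{il}_{A\otimes_jB,A'\otimes_jB',C\otimes_jD,C'\otimes_jD'}\circ(\eta^{jl}_{AA'BB'}\otimes_i\eta^{jl}_{CC'DD'})$$ $$=\eta^{jl}_{A\otimes_iC,A'\otimes_iC',B\otimes_iD,B'\otimes_iD'}\circ(\eta^{il}_{AA'CC'}\otimes_j\eta^{il}_{BB'DD'})\circ\eta^{ij}_{A\otimes_lA',B\otimes_lB',C\otimes_lC',D\otimes_lD'}$$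 as morphisms from $((A\otimes_lA')\otimes_j(B\otimes_lB'))\otimes_i((C\otimes_lC')\otimes_j(D\otimes_lD'))$ to $((A\otimes_iC)\otimes_j(B\otimes_iD))\otimes_l((A'\otimes_iC')\otimes_j(B'\otimes_iD'))$. **$n$-fold monoidal 2-category.** This is the same notion one dimension up: a (strict) 2-category with a unit object, $n$ (strict) 2-functors $\otimes_i$ of two variables, 2-natural isomorphisms $\alpha^i_{UVW}:(U\otimes_i V)\otimes_i W\to U\otimes_i(V\otimes_i W)$ ($1\le i\le n$) and 2-natural transformations $\eta^{ij}_{ABCD}:(A\otimes_j B)\otimes_i(C\otimes_j D)\to(A\otimes_i C)\otimes_j(B\otimes_i D)$ ($1\le i<j\le n$), satisfying the pentagon, the unit conditions and (a)-(e) as equalities of 1-cells. A 2-natural transformation $\theta:F\to G$ assigns to each object $A$ a 1-cell $\theta_A:FA\to GA$ such that for every 2-cell $\sigma:f\Rightarrow g:A\to B$ the whiskered composites $\theta_B\,F\sigma$ and $G\sigma\,\theta_A$ are equal (including their source and target 1-cells). For $n=0$ there is only a 2-category with a chosen unit object. In $\mathcal V\text{-Cat}$, the unit conditions are read after the evident identifications $\{0\}\times|\mathcal A|=|\mathcal A|=|\mathcal A|\times\{0\}$, $(0,A)\leftrightarrow A\leftrightarrow(A,0)$: the $\mathcal V$-functors $\mathcal I\otimes^{(1)}_i\mathcal A\to\mathcal A$ and $\mathcal A\otimes^{(1)}_i\mathcal I\to\mathcal A$ given by these bijections on objects and by identity morphisms on hom-objects are isomorphisms, 2-natural in $\mathcal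 A$, and the unit conditions hold once source and target are identified along them. **The 2-category $\mathcal V\text{-Cat}$.** All enrichment is over $(\mathcal V,\otimes_1,\alpha^1,I)$. - A small $\mathcal V$-category $\mathcal A$ has a set of objects $|\mathcal A|$, hom-objects $\mathcal A(A,B)\in\mathcal V$, composition morphisms $M_{ABC}:\mathcal A(B,C)\otimes_1\mathcal A(A,B)\to\mathcal A(A,C)$ and identity elements $j_A:I\to\mathcal A(A,A)$, satisfying the usual associativity axiom (using $\alpha^1$) and unit axioms. - A $\mathcal V$-functor $T:\mathcal A\to\mathcal B$ is a function on objects with morphisms $T_{AB}:\mathcal A(A,B)\to\mathcal B(TA,TB)$ satisfying $T_{AC}\circ M=M\circ(T_{BC}\otimes_1T_{AB})$ and $T_{AA}\circ j_A=j_{TA}$. - A $\mathcal V$-natural transformation $\beta:T\to S:\mathcal A\to\mathcal B$ is a family $\beta_A:I\to\mathcal B(TA,SA)$ with $M\circ(\beta_B\otimes_1T_{AB})=M\circ(S_{AB}\otimes_1\beta_A)$ as morphisms $\mathcal A(A,B)\to\mathcal B(TA,SB)$, using $I\otimes_1\mathcal A(A,B)=\mathcal A(A,B)=\mathcal A(A,B)\otimes_1I$. - Vertical composition: $(\gamma\circ\beta)_A=M\circ(\gamma_A\otimes_1\beta_A)$, with identities $(\mathbf 1_Q)_B=j_{QB}$. Whiskering: $(Q\beta)_A=Q_{TA,SA}\circ\beta_A$ and $(\beta P)_D=\beta_{PD}$. Horizontal composition is determined by these. **The structure on $\mathcal V\text{-Cat}$.** - Unit: $\mathcal I$ has one object $0$,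 $\mathcal I(0,0)=I$, and $M_{000}=1=j_0$. - Products, for $1\le i\le k-1$: $|\mathcal A\otimes^{(1)}_i\mathcal B|=|\mathcal A|\times|\mathcal B|$ and $$(\mathcal A\otimes^{(1)}_i\mathcal B)((A,B),(A',B'))=\mathcal A(A,A')\otimes_{i+1}\mathcal B(B,B').$$ Composition is $M_{(A,B)(A',B')(A'',B'')}=(M_{AA'A''}\otimes_{i+1}M_{BB'B''})\circ\eta^{1,i+1}_{\mathcal A(A',A'')\,\mathcal B(B',B'')\,\mathcal A(A,A')\,\mathcal B(B,B')}$, and the identity elements are $j_{(A,B)}=j_A\otimes_{i+1}j_B:I=I\otimes_{i+1}I\to\mathcal A(A,A)\otimes_{i+1}\mathcal B(B,B)$. On $\mathcal V$-functors $\otimes^{(1)}_i$ is the product of object functions and the $\otimes_{i+1}$-product of hom-object morphisms; on $\mathcal V$-natural transformations it is $(\beta\otimes^{(1)}_i\gamma)_{(A,B)}=\beta_A\otimes_{i+1}\gamma_B$ (precomposed with $I=I\otimes_{i+1}I$). - Associators, for $1\le i\le k-1$: $\alpha^{(1)i}_{\mathcal A\mathcal B\mathcal C}:(\mathcal A\otimes^{(1)}_i\mathcal B)\otimes^{(1)}_i\mathcal C\to\mathcal A\otimes^{(1)}_i(\mathcal B\otimes^{(1)}_i\mathcal C)$ sends $((A,B),C)$ to $(A,(B,C))$, and its hom-object morphism from $((A,B),C)$ to $((A',B'),C')$ is $\alpha^{i+1}_{\mathcal A(A,A')\,\mathcal B(B,B')\,\mathcal C(C,C')}$. - Interchange, for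 $1\le i<j\le k-1$: $\eta^{(1)i,j}_{\mathcal A\mathcal B\mathcal C\mathcal D}:(\mathcal A\otimes^{(1)}_j\mathcal B)\otimes^{(1)}_i(\mathcal C\otimes^{(1)}_j\mathcal D)\to(\mathcal A\otimes^{(1)}_i\mathcal C)\otimes^{(1)}_j(\mathcal B\otimes^{(1)}_i\mathcal D)$ sends $((A,B),(C,D))$ to $((A,C),(B,D))$, and its hom-object morphism from $((A,B),(C,D))$ to $((A',B'),(C',D'))$ is $\eta^{i+1,j+1}_{\mathcal A(A,A')\,\mathcal B(B,B')\,\mathcal C(C,C')\,\mathcal D(D,D')}$. *)

theory Defs
  imports Main "HOL-Library.FuncSet"
begin

section \<open>Categories\<close>

record ('o, 'm) cat =
  Ob :: "'o set"
  Mor :: "'m set"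
  Src :: "'m \<Rightarrow> 'o"
  Trg :: "'m \<Rightarrow> 'o"
  Idt :: "'o \<Rightarrow> 'm"
  Cmp :: "'m \<Rightarrow> 'm \<Rightarrow> 'm"  \<comment> \<open>\<open>Cmp C g f\<close> is \<open>g\<close> after \<open>f\<close>\<close>

definition hom :: "('o, 'm, 'z) cat_scheme \<Rightarrow> 'o \<Rightarrow> 'o \<Rightarrow> 'm set" where
  "hom C a b = {f \<in> Mor C. Src C f = a \<and> Trg C f = b}"

locale category =
  fixes C :: "('o, 'm, 'z) cat_scheme"
  assumes Src_Ob: "f \<in> Mor C \<Longrightarrow> Src C f \<in> Ob C"
    and Trg_Ob: "f \<in> Mor C \<Longrightarrow> Trg C f \<in> Ob C"
    and Idt_hom: "a \<in> Ob C \<Longrightarrow> Idt C a \<in> hom C a a"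
    and Cmp_hom: "\<lbrakk>f \<in> hom C a b; g \<in> hom C b c\<rbrakk> \<Longrightarrow> Cmp C g f \<in> hom C a c"
    and Cmp_Idt_left: "f \<in> hom C a b \<Longrightarrow> Cmp C (Idt C b) f = f"
    and Cmp_Idt_right: "f \<in> hom C a b \<Longrightarrow> Cmp C f (Idt C a) = f"
    and Cmp_assoc: "\<lbrakk>f \<in> hom C a b; g \<in> hom C b c; h \<in> hom C c d\<rbrakk>
      \<Longrightarrow> Cmp C h (Cmp C g f) = Cmp C (Cmp C h g) f"

definition is_iso :: "('o, 'm, 'z) cat_scheme \<Rightarrow> 'm \<Rightarrow> bool" where
  "is_iso C f \<longleftrightarrow> f \<in> Mor C \<and>
    (\<exists>g \<in> hom C (Trg C f) (Src C f).
      Cmp C g f = Idt C (Src C f) \<and> Cmp C f g = Idt C (Trg C f))"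

definition prod_cat ::
  "('o, 'm, 'z) cat_scheme \<Rightarrow> ('p, 'n, 'y) cat_scheme \<Rightarrow> ('o \<times> 'p, 'm \<times> 'n) cat" where
  "prod_cat C D = \<lparr>Ob = Ob C \<times> Ob D, Mor = Mor C \<times> Mor D,
    Src = map_prod (Src C) (Src D), Trg = map_prod (Trg C) (Trg D),
    Idt = map_prod (Idt C) (Idt D),
    Cmp = (\<lambda>(g, g') (f, f'). (Cmp C g f, Cmp D g' f'))\<rparr>"

record ('o, 'm, 'p, 'n) fun1 =
  onO :: "'o \<Rightarrow> 'p"
  onM :: "'m \<Rightarrow> 'n"

definition is_functor ::
  "('o, 'm, 'z) cat_scheme \<Rightarrow> ('p, 'n, 'y) cat_scheme \<Rightarrow> ('o, 'm, 'p, 'n) fun1 \<Rightarrow> bool" where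
  "is_functor C D F \<longleftrightarrow>
    (\<forall>a \<in> Ob C. onO F a \<in> Ob D) \<and>
    (\<forall>f \<in> Mor C. onM F f \<in> hom D (onO F (Src C f)) (onO F (Trg C f))) \<and>
    (\<forall>a \<in> Ob C. onM F (Idt C a) = Idt D (onO F a)) \<and>
    (\<forall>f \<in> Mor C. \<forall>g \<in> Mor C. Trg C f = Src C g \<longrightarrow>
      onM F (Cmp C g f) = Cmp D (onM F g) (onM F f))"

definition is_nat_trans ::
  "('o, 'm, 'z) cat_scheme \<Rightarrow> ('p, 'n, 'y) cat_scheme \<Rightarrow>
    ('o, 'm, 'p, 'n) fun1 \<Rightarrow> ('o, 'm, 'p, 'n) fun1 \<Rightarrow> ('o \<Rightarrow> 'n) \<Rightarrow> bool" where
  "is_nat_trans C D F G \<theta> \<longleftrightarrow>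
    is_functor C D F \<and> is_functor C D G \<and>
    (\<forall>a \<in> Ob C. \<theta> a \<in> hom D (onO F a) (onO G a)) \<and>
    (\<forall>f \<in> Mor C. Cmp D (\<theta> (Trg C f)) (onM F f) = Cmp D (onM G f) (\<theta> (Src C f)))"


section \<open>Iterated monoidal categories\<close>

record ('o, 'm) tcat = "('o, 'm) cat" +
  tenO :: "nat \<Rightarrow> 'o \<Rightarrow> 'o \<Rightarrow> 'o"
  tenM :: "nat \<Rightarrow> 'm \<Rightarrow> 'm \<Rightarrow> 'm"
  Unt :: 'o
  asc :: "nat \<Rightarrow> 'o \<Rightarrow> 'o \<Rightarrow> 'o \<Rightarrow> 'm"
  eta :: "nat \<Rightarrow> nat \<Rightarrow> 'o \<Rightarrow> 'o \<Rightarrow> 'o \<Rightarrow> 'o \<Rightarrow> 'm"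

text \<open>Sources and targets of the associators and interchange transformations as functions of
  several variables; used for objects, morphisms and 2-cells alike.\<close>

definition paren_left :: "('x \<Rightarrow> 'x \<Rightarrow> 'x) \<Rightarrow> ('x \<times> 'x) \<times> 'x \<Rightarrow> 'x" where
  "paren_left T = (\<lambda>((a, b), c). T (T a b) c)"

definition paren_right :: "('x \<Rightarrow> 'x \<Rightarrow> 'x) \<Rightarrow> ('x \<times> 'x) \<times> 'x \<Rightarrow> 'x" where
  "paren_right T = (\<lambda>((a, b), c). T a (T b c))"

definition inter_src ::
  "('x \<Rightarrow> 'x \<Rightarrow> 'x) \<Rightarrow> ('x \<Rightarrow> 'x \<Rightarrow> 'x) \<Rightarrow> ('x \<times> 'x) \<times> ('x \<times> 'x) \<Rightarrow> 'x" where
  "inter_src Ti Tj = (\<lambda>((a, b), (c, d)). Ti (Tj a b) (Tj c d))"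

definition inter_trg ::
  "('x \<Rightarrow> 'x \<Rightarrow> 'x) \<Rightarrow> ('x \<Rightarrow> 'x \<Rightarrow> 'x) \<Rightarrow> ('x \<times> 'x) \<times> ('x \<times> 'x) \<Rightarrow> 'x" where
  "inter_trg Ti Tj = (\<lambda>((a, b), (c, d)). Tj (Ti a c) (Ti b d))"

locale tensor_notation =
  fixes C :: "('o, 'm, 'z) tcat_scheme"
begin

abbreviation tensor_obj (\<open>(_ \<otimes>\<^bsub>_\<^esub> _)\<close> [71, 0, 71] 70) where "A \<otimes>\<^bsub>i\<^esub> B \<equiv> tenO C i A B"
abbreviation tensor_mor (\<open>(_ \<odot>\<^bsub>_\<^esub> _)\<close> [71, 0, 71] 70) where "f \<odot>\<^bsub>i\<^esub> g \<equiv> tenM C i f g"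
abbreviation after (infixr \<open>\<cdot>\<close> 55) where "g \<cdot> f \<equiv> Cmp C g f"
abbreviation ident (\<open>\<one>\<close>) where "\<one> \<equiv> Idt C"
abbreviation un (\<open>\<I>\<close>) where "\<I> \<equiv> Unt C"
abbreviation alpha (\<open>\<alpha>\<close>) where "\<alpha> \<equiv> asc C"
abbreviation inter (\<open>\<eta>\<close>) where "\<eta> \<equiv> eta C"

end

text \<open>The axioms not involving the unit. They are shared with iterated monoidal 2-categories,
  where they are imposed on the underlying category of 1-cells.\<close>

locale iterated_coherence = tensor_notation C
  for n :: nat and C :: "('o, 'm, 'z) tcat_scheme" +
  assumes pentagon:
    "\<lbrakk>1 \<le> i; i \<le> n; U \<in> Ob C; V \<in> Ob C; W \<in> Ob C; X \<in> Ob C\<rbrakk> \<Longrightarrow>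
      \<alpha> i U V (W \<otimes>\<^bsub>i\<^esub> X) \<cdot> \<alpha> i (U \<otimes>\<^bsub>i\<^esub> V) W X =
      (\<one> U \<odot>\<^bsub>i\<^esub> \<alpha> i V W X) \<cdot> \<alpha> i U (V \<otimes>\<^bsub>i\<^esub> W) X \<cdot> (\<alpha> i U V W \<odot>\<^bsub>i\<^esub> \<one> X)"
    and internal_associativity:
    "\<lbrakk>1 \<le> i; i < j; j \<le> n;
      U \<in> Ob C; V \<in> Ob C; W \<in> Ob C; X \<in> Ob C; Y \<in> Ob C; Z \<in> Ob C\<rbrakk> \<Longrightarrow>
      \<eta> i j U V (W \<otimes>\<^bsub>i\<^esub> Y) (X \<otimes>\<^bsub>i\<^esub> Z) \<cdot> (\<one> (U \<otimes>\<^bsub>j\<^esub> V) \<odot>\<^bsub>i\<^esub> \<eta> i j W X Y Z)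
        \<cdot> \<alpha> i (U \<otimes>\<^bsub>j\<^esub> V) (W \<otimes>\<^bsub>j\<^esub> X) (Y \<otimes>\<^bsub>j\<^esub> Z) =
      (\<alpha> i U W Y \<odot>\<^bsub>j\<^esub> \<alpha> i V X Z) \<cdot> \<eta> i j (U \<otimes>\<^bsub>i\<^esub> W) (V \<otimes>\<^bsub>i\<^esub> X) Y Z
        \<cdot> (\<eta> i j U V W X \<odot>\<^bsub>i\<^esub> \<one> (Y \<otimes>\<^bsub>j\<^esub> Z))"
    and external_associativity:
    "\<lbrakk>1 \<le> i; i < j; j \<le> n;
      U \<in> Ob C; V \<in> Ob C; W \<in> Ob C; X \<in> Ob C; Y \<in> Ob C; Z \<in> Ob C\<rbrakk> \<Longrightarrow>
      (\<one> (U \<otimes>\<^bsub>i\<^esub> X) \<odot>\<^bsub>j\<^esub> \<eta> i j V W Y Z) \<cdot> \<eta> i j U (V \<otimes>\<^bsub>j\<^esub> W) X (Y \<otimes>\<^bsub>j\<^esub> Z)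
        \<cdot> (\<alpha> j U V W \<odot>\<^bsub>i\<^esub> \<alpha> j X Y Z) =
      \<alpha> j (U \<otimes>\<^bsub>i\<^esub> X) (V \<otimes>\<^bsub>i\<^esub> Y) (W \<otimes>\<^bsub>i\<^esub> Z) \<cdot> (\<eta> i j U V X Y \<odot>\<^bsub>j\<^esub> \<one> (W \<otimes>\<^bsub>i\<^esub> Z))
        \<cdot> \<eta> i j (U \<otimes>\<^bsub>j\<^esub> V) W (X \<otimes>\<^bsub>j\<^esub> Y) Z"
    and giant_hexagon:
    "\<lbrakk>1 \<le> i; i < j; j < l; l \<le> n;
      A \<in> Ob C; A' \<in> Ob C; B \<in> Ob C; B' \<in> Ob C; D \<in> Ob C; D' \<in> Ob C; E \<in> Ob C; E' \<in> Ob C\<rbrakk> \<Longrightarrow>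
      (\<eta> i j A B D E \<odot>\<^bsub>l\<^esub> \<eta> i j A' B' D' E')
        \<cdot> \<eta> i l (A \<otimes>\<^bsub>j\<^esub> B) (A' \<otimes>\<^bsub>j\<^esub> B') (D \<otimes>\<^bsub>j\<^esub> E) (D' \<otimes>\<^bsub>j\<^esub> E')
        \<cdot> (\<eta> j l A A' B B' \<odot>\<^bsub>i\<^esub> \<eta> j l D D' E E') =
      \<eta> j l (A \<otimes>\<^bsub>i\<^esub> D) (A' \<otimes>\<^bsub>i\<^esub> D') (B \<otimes>\<^bsub>i\<^esub> E) (B' \<otimes>\<^bsub>i\<^esub> E')
        \<cdot> (\<eta> i l A A' D D' \<odot>\<^bsub>j\<^esub> \<eta> i l B B' E E')
        \<cdot> \<eta> i j (A \<otimes>\<^bsub>l\<^esub> A') (B \<otimes>\<^bsub>l\<^esub> B') (D \<otimes>\<^bsub>l\<^esub> D') (E \<otimes>\<^bsub>l\<^esub> E')"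

text \<open>The unit is strict for every product, on objects and on morphisms. No relation between
  associators and the unit is imposed.\<close>

locale iterated_monoidal_category = category C + iterated_coherence n C
  for n :: nat and C :: "('o, 'm, 'z) tcat_scheme" +
  assumes tensor_functor: "\<lbrakk>1 \<le> i; i \<le> n\<rbrakk> \<Longrightarrow>
      is_functor (prod_cat C C) C \<lparr>onO = case_prod (tenO C i), onM = case_prod (tenM C i)\<rparr>"
    and unit_Ob: "\<I> \<in> Ob C"
    and unit_left_obj: "\<lbrakk>1 \<le> i; i \<le> n; a \<in> Ob C\<rbrakk> \<Longrightarrow> \<I> \<otimes>\<^bsub>i\<^esub> a = a"
    and unit_right_obj: "\<lbrakk>1 \<le> i; i \<le> n; a \<in> Ob C\<rbrakk> \<Longrightarrow> a \<otimes>\<^bsub>i\<^esub> \<I> = a"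
    and unit_left_mor: "\<lbrakk>1 \<le> i; i \<le> n; f \<in> Mor C\<rbrakk> \<Longrightarrow> \<one> \<I> \<odot>\<^bsub>i\<^esub> f = f"
    and unit_right_mor: "\<lbrakk>1 \<le> i; i \<le> n; f \<in> Mor C\<rbrakk> \<Longrightarrow> f \<odot>\<^bsub>i\<^esub> \<one> \<I> = f"
    and assoc_nat: "\<lbrakk>1 \<le> i; i \<le> n\<rbrakk> \<Longrightarrow>
      is_nat_trans (prod_cat (prod_cat C C) C) C
        \<lparr>onO = paren_left (tenO C i), onM = paren_left (tenM C i)\<rparr>
        \<lparr>onO = paren_right (tenO C i), onM = paren_right (tenM C i)\<rparr>
        (\<lambda>((a, b), c). asc C i a b c)"
    and assoc_iso: "\<lbrakk>1 \<le> i; i \<le> n; a \<in> Ob C; b \<in> Ob C; c \<in> Ob C\<rbrakk> \<Longrightarrow>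
      is_iso C (asc C i a b c)"
    and inter_nat: "\<lbrakk>1 \<le> i; i < j; j \<le> n\<rbrakk> \<Longrightarrow>
      is_nat_trans (prod_cat (prod_cat C C) (prod_cat C C)) C
        \<lparr>onO = inter_src (tenO C i) (tenO C j), onM = inter_src (tenM C i) (tenM C j)\<rparr>
        \<lparr>onO = inter_trg (tenO C i) (tenO C j), onM = inter_trg (tenM C i) (tenM C j)\<rparr>
        (\<lambda>((a, b), (c, d)). eta C i j a b c d)"
    and internal_unit: "\<lbrakk>1 \<le> i; i < j; j \<le> n; a \<in> Ob C; b \<in> Ob C\<rbrakk> \<Longrightarrow>
      \<eta> i j a b \<I> \<I> = \<one> (a \<otimes>\<^bsub>j\<^esub> b) \<and> \<eta> i j \<I> \<I> a b = \<one> (a \<otimes>\<^bsub>j\<^esub> b)"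
    and external_unit: "\<lbrakk>1 \<le> i; i < j; j \<le> n; a \<in> Ob C; b \<in> Ob C\<rbrakk> \<Longrightarrow>
      \<eta> i j a \<I> b \<I> = \<one> (a \<otimes>\<^bsub>i\<^esub> b) \<and> \<eta> i j \<I> a \<I> b = \<one> (a \<otimes>\<^bsub>i\<^esub> b)"


section \<open>2-categories\<close>

record ('o, 'f, 't) twocat =
  Obj :: "'o set"
  Arr :: "'f set"
  Cel :: "'t set"
  src1 :: "'f \<Rightarrow> 'o"
  trg1 :: "'f \<Rightarrow> 'o"
  id1 :: "'o \<Rightarrow> 'f"
  cmp1 :: "'f \<Rightarrow> 'f \<Rightarrow> 'f"
  src2 :: "'t \<Rightarrow> 'f"
  trg2 :: "'t \<Rightarrow> 'f"
  id2 :: "'f \<Rightarrow> 't"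
  vcmp :: "'t \<Rightarrow> 't \<Rightarrow> 't"
  hcmp :: "'t \<Rightarrow> 't \<Rightarrow> 't"

definition cat1 :: "('o, 'f, 't, 'z) twocat_scheme \<Rightarrow> ('o, 'f) cat" where
  "cat1 K = \<lparr>Ob = Obj K, Mor = Arr K, Src = src1 K, Trg = trg1 K, Idt = id1 K, Cmp = cmp1 K\<rparr>"

definition vcat :: "('o, 'f, 't, 'z) twocat_scheme \<Rightarrow> ('f, 't) cat" where
  "vcat K = \<lparr>Ob = Arr K, Mor = Cel K, Src = src2 K, Trg = trg2 K, Idt = id2 K, Cmp = vcmp K\<rparr>"

definition hcat :: "('o, 'f, 't, 'z) twocat_scheme \<Rightarrow> ('o, 't) cat" where
  "hcat K = \<lparr>Ob = Obj K, Mor = Cel K, Src = (\<lambda>\<sigma>. src1 K (src2 K \<sigma>)), Trg = (\<lambda>\<sigma>. trg1 K (src2 K \<sigma>)),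
    Idt = (\<lambda>a. id2 K (id1 K a)), Cmp = hcmp K\<rparr>"

locale two_category =
  fixes K :: "('o, 'f, 't, 'z) twocat_scheme"
  assumes category_cat1: "category (cat1 K)"
    and category_vcat: "category (vcat K)"
    and category_hcat: "category (hcat K)"
    and globular: "\<sigma> \<in> Cel K \<Longrightarrow>
      src1 K (src2 K \<sigma>) = src1 K (trg2 K \<sigma>) \<and> trg1 K (src2 K \<sigma>) = trg1 K (trg2 K \<sigma>)"
    and hcmp_src_trg: "\<lbrakk>\<sigma> \<in> Cel K; \<tau> \<in> Cel K; trg1 K (src2 K \<sigma>) = src1 K (src2 K \<tau>)\<rbrakk> \<Longrightarrow>
      src2 K (hcmp K \<tau> \<sigma>) = cmp1 K (src2 K \<tau>) (src2 K \<sigma>) \<and>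
      trg2 K (hcmp K \<tau> \<sigma>) = cmp1 K (trg2 K \<tau>) (trg2 K \<sigma>)"
    and hcmp_id2: "\<lbrakk>f \<in> Arr K; g \<in> Arr K; trg1 K f = src1 K g\<rbrakk> \<Longrightarrow>
      hcmp K (id2 K g) (id2 K f) = id2 K (cmp1 K g f)"
    and interchange: "\<lbrakk>\<sigma> \<in> Cel K; \<sigma>' \<in> Cel K; \<tau> \<in> Cel K; \<tau>' \<in> Cel K;
        trg2 K \<sigma> = src2 K \<sigma>'; trg2 K \<tau> = src2 K \<tau>'; trg1 K (src2 K \<sigma>) = src1 K (src2 K \<tau>)\<rbrakk> \<Longrightarrow>
      hcmp K (vcmp K \<tau>' \<tau>) (vcmp K \<sigma>' \<sigma>) = vcmp K (hcmp K \<tau>' \<sigma>') (hcmp K \<tau> \<sigma>)"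

definition prod_twocat ::
  "('o, 'f, 't, 'z) twocat_scheme \<Rightarrow> ('p, 'g, 's, 'y) twocat_scheme \<Rightarrow>
    ('o \<times> 'p, 'f \<times> 'g, 't \<times> 's) twocat" where
  "prod_twocat K L = \<lparr>Obj = Obj K \<times> Obj L, Arr = Arr K \<times> Arr L, Cel = Cel K \<times> Cel L,
    src1 = map_prod (src1 K) (src1 L), trg1 = map_prod (trg1 K) (trg1 L),
    id1 = map_prod (id1 K) (id1 L),
    cmp1 = (\<lambda>(g, g') (f, f'). (cmp1 K g f, cmp1 L g' f')),
    src2 = map_prod (src2 K) (src2 L), trg2 = map_prod (trg2 K) (trg2 L),
    id2 = map_prod (id2 K) (id2 L),
    vcmp = (\<lambda>(\<tau>, \<tau>') (\<sigma>, \<sigma>'). (vcmp K \<tau> \<sigma>, vcmp L \<tau>' \<sigma>')),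
    hcmp = (\<lambda>(\<tau>, \<tau>') (\<sigma>, \<sigma>'). (hcmp K \<tau> \<sigma>, hcmp L \<tau>' \<sigma>'))\<rparr>"

record ('o, 'f, 't, 'p, 'g, 's) fun2 =
  on0 :: "'o \<Rightarrow> 'p"
  on1 :: "'f \<Rightarrow> 'g"
  on2 :: "'t \<Rightarrow> 's"

definition is_two_functor ::
  "('o, 'f, 't, 'z) twocat_scheme \<Rightarrow> ('p, 'g, 's, 'y) twocat_scheme \<Rightarrow>
    ('o, 'f, 't, 'p, 'g, 's) fun2 \<Rightarrow> bool" where
  "is_two_functor K L F \<longleftrightarrow>
    is_functor (cat1 K) (cat1 L) \<lparr>onO = on0 F, onM = on1 F\<rparr> \<and>
    is_functor (vcat K) (vcat L) \<lparr>onO = on1 F, onM = on2 F\<rparr> \<and>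
    is_functor (hcat K) (hcat L) \<lparr>onO = on0 F, onM = on2 F\<rparr>"

text \<open>Since a 2-cell determines its source and target 1-cells, the equation below contains
  ordinary naturality with respect to 1-cells.\<close>

definition is_two_nat ::
  "('o, 'f, 't, 'z) twocat_scheme \<Rightarrow> ('p, 'g, 's, 'y) twocat_scheme \<Rightarrow>
    ('o, 'f, 't, 'p, 'g, 's) fun2 \<Rightarrow> ('o, 'f, 't, 'p, 'g, 's) fun2 \<Rightarrow> ('o \<Rightarrow> 'g) \<Rightarrow> bool" where
  "is_two_nat K L F G \<theta> \<longleftrightarrow>
    is_two_functor K L F \<and> is_two_functor K L G \<and>
    (\<forall>a \<in> Obj K. \<theta> a \<in> hom (cat1 L) (on0 F a) (on0 G a)) \<and>
    (\<forall>\<sigma> \<in> Cel K.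
      hcmp L (id2 L (\<theta> (trg1 K (src2 K \<sigma>)))) (on2 F \<sigma>) =
      hcmp L (on2 G \<sigma>) (id2 L (\<theta> (src1 K (src2 K \<sigma>)))))"


section \<open>Iterated monoidal 2-categories\<close>

text \<open>The unit need not be literally strict: \<open>lun i a : I \<otimes>\<^sub>i a \<rightarrow> a\<close> and \<open>run i a : a \<otimes>\<^sub>i I \<rightarrow> a\<close> are
  the isomorphisms along which these objects are identified. With \<open>lun\<close> and \<open>run\<close> identities one
  gets the strict notion.\<close>

record ('o, 'f, 't) mon2cat = "('o, 'f, 't) twocat" +
  ten0 :: "nat \<Rightarrow> 'o \<Rightarrow> 'o \<Rightarrow> 'o"
  ten1 :: "nat \<Rightarrow> 'f \<Rightarrow> 'f \<Rightarrow> 'f"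
  ten2 :: "nat \<Rightarrow> 't \<Rightarrow> 't \<Rightarrow> 't"
  unt2 :: 'o
  lun :: "nat \<Rightarrow> 'o \<Rightarrow> 'f"
  run :: "nat \<Rightarrow> 'o \<Rightarrow> 'f"
  asc2 :: "nat \<Rightarrow> 'o \<Rightarrow> 'o \<Rightarrow> 'o \<Rightarrow> 'f"
  eta2 :: "nat \<Rightarrow> nat \<Rightarrow> 'o \<Rightarrow> 'o \<Rightarrow> 'o \<Rightarrow> 'o \<Rightarrow> 'f"

definition under1 :: "('o, 'f, 't, 'z) mon2cat_scheme \<Rightarrow> ('o, 'f) tcat" where
  "under1 K = \<lparr>Ob = Obj K, Mor = Arr K, Src = src1 K, Trg = trg1 K, Idt = id1 K, Cmp = cmp1 K,
    tenO = ten0 K, tenM = ten1 K, Unt = unt2 K, asc = asc2 K, eta = eta2 K\<rparr>"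

locale iterated_monoidal_two_category =
  two_category K + iterated_coherence n "under1 K"
  for n :: nat and K :: "('o, 'f, 't, 'z) mon2cat_scheme" +
  assumes tensor_two_functor: "\<lbrakk>1 \<le> i; i \<le> n\<rbrakk> \<Longrightarrow>
      is_two_functor (prod_twocat K K) K
        \<lparr>on0 = case_prod (ten0 K i), on1 = case_prod (ten1 K i), on2 = case_prod (ten2 K i)\<rparr>"
    and assoc_two_nat: "\<lbrakk>1 \<le> i; i \<le> n\<rbrakk> \<Longrightarrow>
      is_two_nat (prod_twocat (prod_twocat K K) K) K
        \<lparr>on0 = paren_left (ten0 K i), on1 = paren_left (ten1 K i), on2 = paren_left (ten2 K i)\<rparr>
        \<lparr>on0 = paren_right (ten0 K i), on1 = paren_right (ten1 K i), on2 = paren_right (ten2 K i)\<rparr>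
        (\<lambda>((a, b), c). asc2 K i a b c)"
    and assoc_iso: "\<lbrakk>1 \<le> i; i \<le> n; a \<in> Obj K; b \<in> Obj K; c \<in> Obj K\<rbrakk> \<Longrightarrow>
      is_iso (cat1 K) (asc2 K i a b c)"
    and inter_two_nat: "\<lbrakk>1 \<le> i; i < j; j \<le> n\<rbrakk> \<Longrightarrow>
      is_two_nat (prod_twocat (prod_twocat K K) (prod_twocat K K)) K
        \<lparr>on0 = inter_src (ten0 K i) (ten0 K j), on1 = inter_src (ten1 K i) (ten1 K j),
          on2 = inter_src (ten2 K i) (ten2 K j)\<rparr>
        \<lparr>on0 = inter_trg (ten0 K i) (ten0 K j), on1 = inter_trg (ten1 K i) (ten1 K j),
          on2 = inter_trg (ten2 K i) (ten2 K j)\<rparr>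
        (\<lambda>((a, b), (c, d)). eta2 K i j a b c d)"
    and unit_Obj: "unt2 K \<in> Obj K"
    and lun_two_nat: "\<lbrakk>1 \<le> i; i \<le> n\<rbrakk> \<Longrightarrow>
      is_two_nat K K
        \<lparr>on0 = ten0 K i (unt2 K), on1 = ten1 K i (id1 K (unt2 K)),
          on2 = ten2 K i (id2 K (id1 K (unt2 K)))\<rparr>
        \<lparr>on0 = (\<lambda>a. a), on1 = (\<lambda>f. f), on2 = (\<lambda>\<sigma>. \<sigma>)\<rparr> (lun K i)"
    and run_two_nat: "\<lbrakk>1 \<le> i; i \<le> n\<rbrakk> \<Longrightarrow>
      is_two_nat K K
        \<lparr>on0 = (\<lambda>a. ten0 K i a (unt2 K)), on1 = (\<lambda>f. ten1 K i f (id1 K (unt2 K))),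
          on2 = (\<lambda>\<sigma>. ten2 K i \<sigma> (id2 K (id1 K (unt2 K))))\<rparr>
        \<lparr>on0 = (\<lambda>a. a), on1 = (\<lambda>f. f), on2 = (\<lambda>\<sigma>. \<sigma>)\<rparr> (run K i)"
    and lun_iso: "\<lbrakk>1 \<le> i; i \<le> n; a \<in> Obj K\<rbrakk> \<Longrightarrow> is_iso (cat1 K) (lun K i a)"
    and run_iso: "\<lbrakk>1 \<le> i; i \<le> n; a \<in> Obj K\<rbrakk> \<Longrightarrow> is_iso (cat1 K) (run K i a)"
    \<comment> \<open>so that the identification of \<open>I \<otimes>\<^sub>i I\<close> with \<open>I\<close> is unambiguous\<close>
    and lun_run_unit: "\<lbrakk>1 \<le> i; i \<le> n\<rbrakk> \<Longrightarrow> lun K i (unt2 K) = run K i (unt2 K)"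
    \<comment> \<open>\<open>\<eta>\<^sub>a\<^sub>b\<^sub>I\<^sub>I = 1 = \<eta>\<^sub>I\<^sub>I\<^sub>a\<^sub>b\<close> after identifying source and target with \<open>a \<otimes>\<^sub>j b\<close>\<close>
    and internal_unit_right: "\<lbrakk>1 \<le> i; i < j; j \<le> n; a \<in> Obj K; b \<in> Obj K\<rbrakk> \<Longrightarrow>
      cmp1 K (ten1 K j (run K i a) (run K i b)) (eta2 K i j a b (unt2 K) (unt2 K)) =
      cmp1 K (run K i (ten0 K j a b)) (ten1 K i (id1 K (ten0 K j a b)) (lun K j (unt2 K)))"
    and internal_unit_left: "\<lbrakk>1 \<le> i; i < j; j \<le> n; a \<in> Obj K; b \<in> Obj K\<rbrakk> \<Longrightarrow>
      cmp1 K (ten1 K j (lun K i a) (lun K i b)) (eta2 K i j (unt2 K) (unt2 K) a b) =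
      cmp1 K (lun K i (ten0 K j a b)) (ten1 K i (lun K j (unt2 K)) (id1 K (ten0 K j a b)))"
    \<comment> \<open>\<open>\<eta>\<^sub>a\<^sub>I\<^sub>b\<^sub>I = 1 = \<eta>\<^sub>I\<^sub>a\<^sub>I\<^sub>b\<close> after identifying source and target with \<open>a \<otimes>\<^sub>i b\<close>\<close>
    and external_unit_right: "\<lbrakk>1 \<le> i; i < j; j \<le> n; a \<in> Obj K; b \<in> Obj K\<rbrakk> \<Longrightarrow>
      cmp1 K (run K j (ten0 K i a b))
        (cmp1 K (ten1 K j (id1 K (ten0 K i a b)) (lun K i (unt2 K)))
          (eta2 K i j a (unt2 K) b (unt2 K))) =
      ten1 K i (run K j a) (run K j b)"
    and external_unit_left: "\<lbrakk>1 \<le> i; i < j; j \<le> n; a \<in> Obj K; b \<in> Obj K\<rbrakk> \<Longrightarrow>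
      cmp1 K (lun K j (ten0 K i a b))
        (cmp1 K (ten1 K j (lun K i (unt2 K)) (id1 K (ten0 K i a b)))
          (eta2 K i j (unt2 K) a (unt2 K) b)) =
      ten1 K i (lun K j a) (lun K j b)"


section \<open>Enriched categories\<close>

text \<open>Families indexed by objects are extensional (undefined off the object set) and functors and
  transformations carry their source and target, so that HOL equality is the intended equality of
  enriched categories, functors and transformations.\<close>

record ('a, 'o, 'm) vcategory =
  VOb :: "'a set"
  VHom :: "'a \<Rightarrow> 'a \<Rightarrow> 'o"
  VCmp :: "'a \<Rightarrow> 'a \<Rightarrow> 'a \<Rightarrow> 'm"  \<comment> \<open>\<open>VCmp A a b c : A(b,c) \<otimes>\<^sub>1 A(a,b) \<rightarrow> A(a,c)\<close>\<close>
  VId :: "'a \<Rightarrow> 'm"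

record ('a, 'o, 'm) vfunctor =
  FDom :: "('a, 'o, 'm) vcategory"
  FCod :: "('a, 'o, 'm) vcategory"
  FOb :: "'a \<Rightarrow> 'a"
  FHom :: "'a \<Rightarrow> 'a \<Rightarrow> 'm"

record ('a, 'o, 'm) vtrans =
  NSrc :: "('a, 'o, 'm) vfunctor"
  NTrg :: "('a, 'o, 'm) vfunctor"
  NAt :: "'a \<Rightarrow> 'm"

text \<open>Object sets are sets of elements of \<open>'u nest\<close>, a universe over an arbitrary type \<open>'u\<close> of
  atoms that contains a point and is closed under ordered pairs. It plays the role of the universe
  of small sets.\<close>

datatype 'u nest = Pt | Atom 'u | NPair (nfst: "'u nest") (nsnd: "'u nest")

definition pairs :: "'u nest set \<Rightarrow> 'u nest set \<Rightarrow> 'u nest set" where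
  "pairs X Y = {NPair a b | a b. a \<in> X \<and> b \<in> Y}"

context
  fixes V :: "('o, 'm) tcat"
begin

private abbreviation Vcomp (infixr \<open>\<cdot>\<close> 55) where "g \<cdot> f \<equiv> Cmp V g f"
private abbreviation VtenO (\<open>(_ \<otimes>\<^bsub>_\<^esub> _)\<close> [71, 0, 71] 70) where "A \<otimes>\<^bsub>i\<^esub> B \<equiv> tenO V i A B"
private abbreviation VtenM (\<open>(_ \<odot>\<^bsub>_\<^esub> _)\<close> [71, 0, 71] 70) where "f \<odot>\<^bsub>i\<^esub> g \<equiv> tenM V i f g"
private abbreviation Vone (\<open>\<one>\<close>) where "\<one> \<equiv> Idt V"
private abbreviation VI (\<open>\<I>\<close>) where "\<I> \<equiv> Unt V"

definition V_category :: "('a, 'o, 'm) vcategory \<Rightarrow> bool" where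
  "V_category A \<longleftrightarrow>
    VHom A \<in> VOb A \<rightarrow>\<^sub>E VOb A \<rightarrow>\<^sub>E Ob V \<and>
    VCmp A \<in> (\<Pi>\<^sub>E a \<in> VOb A. \<Pi>\<^sub>E b \<in> VOb A. \<Pi>\<^sub>E c \<in> VOb A.
      hom V (VHom A b c \<otimes>\<^bsub>1\<^esub> VHom A a b) (VHom A a c)) \<and>
    VId A \<in> (\<Pi>\<^sub>E a \<in> VOb A. hom V \<I> (VHom A a a)) \<and>
    (\<forall>a \<in> VOb A. \<forall>b \<in> VOb A. \<forall>c \<in> VOb A. \<forall>d \<in> VOb A.
      VCmp A a b d \<cdot> (VCmp A b c d \<odot>\<^bsub>1\<^esub> \<one> (VHom A a b)) =
      VCmp A a c d \<cdot> (\<one> (VHom A c d) \<odot>\<^bsub>1\<^esub> VCmp A a b c)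
        \<cdot> asc V 1 (VHom A c d) (VHom A b c) (VHom A a b)) \<and>
    (\<forall>a \<in> VOb A. \<forall>b \<in> VOb A.
      VCmp A a b b \<cdot> (VId A b \<odot>\<^bsub>1\<^esub> \<one> (VHom A a b)) = \<one> (VHom A a b) \<and>
      VCmp A a a b \<cdot> (\<one> (VHom A a b) \<odot>\<^bsub>1\<^esub> VId A a) = \<one> (VHom A a b))"

definition V_functor :: "('a, 'o, 'm) vfunctor \<Rightarrow> bool" where
  "V_functor T \<longleftrightarrow> (let A = FDom T; B = FCod T in
    V_category A \<and> V_category B \<and>
    FOb T \<in> VOb A \<rightarrow>\<^sub>E VOb B \<and>
    FHom T \<in> (\<Pi>\<^sub>E a \<in> VOb A. \<Pi>\<^sub>E b \<in> VOb A.
      hom V (VHom A a b) (VHom B (FOb T a) (FOb T b))) \<and>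
    (\<forall>a \<in> VOb A. \<forall>b \<in> VOb A. \<forall>c \<in> VOb A.
      FHom T a c \<cdot> VCmp A a b c =
      VCmp B (FOb T a) (FOb T b) (FOb T c) \<cdot> (FHom T b c \<odot>\<^bsub>1\<^esub> FHom T a b)) \<and>
    (\<forall>a \<in> VOb A. FHom T a a \<cdot> VId A a = VId B (FOb T a)))"

definition V_trans :: "('a, 'o, 'm) vtrans \<Rightarrow> bool" where
  "V_trans \<beta> \<longleftrightarrow> (let T = NSrc \<beta>; S = NTrg \<beta>; A = FDom T; B = FCod T in
    V_functor T \<and> V_functor S \<and> FDom S = A \<and> FCod S = B \<and>
    NAt \<beta> \<in> (\<Pi>\<^sub>E a \<in> VOb A. hom V \<I> (VHom B (FOb T a) (FOb S a))) \<and>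
    (\<forall>a \<in> VOb A. \<forall>b \<in> VOb A.
      VCmp B (FOb T a) (FOb T b) (FOb S b) \<cdot> (NAt \<beta> b \<odot>\<^bsub>1\<^esub> FHom T a b) =
      VCmp B (FOb T a) (FOb S a) (FOb S b) \<cdot> (FHom S a b \<odot>\<^bsub>1\<^esub> NAt \<beta> a)))"

definition id_functor :: "('a, 'o, 'm) vcategory \<Rightarrow> ('a, 'o, 'm) vfunctor" where
  "id_functor A = \<lparr>FDom = A, FCod = A, FOb = (\<lambda>a \<in> VOb A. a),
    FHom = (\<lambda>a \<in> VOb A. \<lambda>b \<in> VOb A. \<one> (VHom A a b))\<rparr>"

definition comp_functor ::
  "('a, 'o, 'm) vfunctor \<Rightarrow> ('a, 'o, 'm) vfunctor \<Rightarrow> ('a, 'o, 'm) vfunctor" where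
  "comp_functor Q T = \<lparr>FDom = FDom T, FCod = FCod Q,
    FOb = (\<lambda>a \<in> VOb (FDom T). FOb Q (FOb T a)),
    FHom = (\<lambda>a \<in> VOb (FDom T). \<lambda>b \<in> VOb (FDom T).
      FHom Q (FOb T a) (FOb T b) \<cdot> FHom T a b)\<rparr>"

definition id_trans :: "('a, 'o, 'm) vfunctor \<Rightarrow> ('a, 'o, 'm) vtrans" where
  "id_trans Q = \<lparr>NSrc = Q, NTrg = Q, NAt = (\<lambda>b \<in> VOb (FDom Q). VId (FCod Q) (FOb Q b))\<rparr>"

definition vert_comp ::
  "('a, 'o, 'm) vtrans \<Rightarrow> ('a, 'o, 'm) vtrans \<Rightarrow> ('a, 'o, 'm) vtrans" where
  "vert_comp \<gamma> \<beta> = \<lparr>NSrc = NSrc \<beta>, NTrg = NTrg \<gamma>,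
    NAt = (\<lambda>a \<in> VOb (FDom (NSrc \<beta>)).
      VCmp (FCod (NSrc \<beta>)) (FOb (NSrc \<beta>) a) (FOb (NTrg \<beta>) a) (FOb (NTrg \<gamma>) a)
        \<cdot> (NAt \<gamma> a \<odot>\<^bsub>1\<^esub> NAt \<beta> a))\<rparr>"

definition whisker_left ::
  "('a, 'o, 'm) vfunctor \<Rightarrow> ('a, 'o, 'm) vtrans \<Rightarrow> ('a, 'o, 'm) vtrans" where
  "whisker_left Q \<beta> = \<lparr>NSrc = comp_functor Q (NSrc \<beta>), NTrg = comp_functor Q (NTrg \<beta>),
    NAt = (\<lambda>a \<in> VOb (FDom (NSrc \<beta>)). FHom Q (FOb (NSrc \<beta>) a) (FOb (NTrg \<beta>) a) \<cdot> NAt \<beta> a)\<rparr>"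

definition whisker_right ::
  "('a, 'o, 'm) vtrans \<Rightarrow> ('a, 'o, 'm) vfunctor \<Rightarrow> ('a, 'o, 'm) vtrans" where
  "whisker_right \<beta> P = \<lparr>NSrc = comp_functor (NSrc \<beta>) P, NTrg = comp_functor (NTrg \<beta>) P,
    NAt = (\<lambda>d \<in> VOb (FDom P). NAt \<beta> (FOb P d))\<rparr>"

definition horiz_comp ::
  "('a, 'o, 'm) vtrans \<Rightarrow> ('a, 'o, 'm) vtrans \<Rightarrow> ('a, 'o, 'm) vtrans" where
  "horiz_comp \<gamma> \<beta> = vert_comp (whisker_right \<gamma> (NTrg \<beta>)) (whisker_left (NSrc \<gamma>) \<beta>)"

subsection \<open>The iterated monoidal structure on enriched categories\<close>

definition unit_vcat :: "('u nest, 'o, 'm) vcategory" where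
  "unit_vcat = \<lparr>VOb = {Pt}, VHom = (\<lambda>a \<in> {Pt}. \<lambda>b \<in> {Pt}. \<I>),
    VCmp = (\<lambda>a \<in> {Pt}. \<lambda>b \<in> {Pt}. \<lambda>c \<in> {Pt}. \<one> \<I>), VId = (\<lambda>a \<in> {Pt}. \<one> \<I>)\<rparr>"

definition tensor_vcat :: "nat \<Rightarrow> ('u nest, 'o, 'm) vcategory \<Rightarrow> ('u nest, 'o, 'm) vcategory \<Rightarrow>
    ('u nest, 'o, 'm) vcategory" where
  "tensor_vcat i A B = (let X = pairs (VOb A) (VOb B) in
    \<lparr>VOb = X,
     VHom = (\<lambda>x \<in> X. \<lambda>y \<in> X. VHom A (nfst x) (nfst y) \<otimes>\<^bsub>i + 1\<^esub> VHom B (nsnd x) (nsnd y)),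
     VCmp = (\<lambda>x \<in> X. \<lambda>y \<in> X. \<lambda>z \<in> X.
       (VCmp A (nfst x) (nfst y) (nfst z) \<odot>\<^bsub>i + 1\<^esub> VCmp B (nsnd x) (nsnd y) (nsnd z))
       \<cdot> eta V 1 (i + 1) (VHom A (nfst y) (nfst z)) (VHom B (nsnd y) (nsnd z))
                        (VHom A (nfst x) (nfst y)) (VHom B (nsnd x) (nsnd y))),
     VId = (\<lambda>x \<in> X. VId A (nfst x) \<odot>\<^bsub>i + 1\<^esub> VId B (nsnd x))\<rparr>)"

definition tensor_vfun :: "nat \<Rightarrow> ('u nest, 'o, 'm) vfunctor \<Rightarrow> ('u nest, 'o, 'm) vfunctor \<Rightarrow>
    ('u nest, 'o, 'm) vfunctor" where
  "tensor_vfun i T S = (let X = pairs (VOb (FDom T)) (VOb (FDom S)) in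
    \<lparr>FDom = tensor_vcat i (FDom T) (FDom S), FCod = tensor_vcat i (FCod T) (FCod S),
     FOb = (\<lambda>x \<in> X. NPair (FOb T (nfst x)) (FOb S (nsnd x))),
     FHom = (\<lambda>x \<in> X. \<lambda>y \<in> X. FHom T (nfst x) (nfst y) \<odot>\<^bsub>i + 1\<^esub> FHom S (nsnd x) (nsnd y))\<rparr>)"

definition tensor_vtrans :: "nat \<Rightarrow> ('u nest, 'o, 'm) vtrans \<Rightarrow> ('u nest, 'o, 'm) vtrans \<Rightarrow>
    ('u nest, 'o, 'm) vtrans" where
  "tensor_vtrans i \<beta> \<gamma> =
    \<lparr>NSrc = tensor_vfun i (NSrc \<beta>) (NSrc \<gamma>), NTrg = tensor_vfun i (NTrg \<beta>) (NTrg \<gamma>),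
     NAt = (\<lambda>x \<in> pairs (VOb (FDom (NSrc \<beta>))) (VOb (FDom (NSrc \<gamma>))).
       NAt \<beta> (nfst x) \<odot>\<^bsub>i + 1\<^esub> NAt \<gamma> (nsnd x))\<rparr>"

definition assoc_vfun :: "nat \<Rightarrow> ('u nest, 'o, 'm) vcategory \<Rightarrow> ('u nest, 'o, 'm) vcategory \<Rightarrow>
    ('u nest, 'o, 'm) vcategory \<Rightarrow> ('u nest, 'o, 'm) vfunctor" where
  "assoc_vfun i A B C = (let X = pairs (pairs (VOb A) (VOb B)) (VOb C) in
    \<lparr>FDom = tensor_vcat i (tensor_vcat i A B) C,
     FCod = tensor_vcat i A (tensor_vcat i B C),
     FOb = (\<lambda>x \<in> X. NPair (nfst (nfst x)) (NPair (nsnd (nfst x)) (nsnd x))),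
     FHom = (\<lambda>x \<in> X. \<lambda>y \<in> X. asc V (i + 1)
       (VHom A (nfst (nfst x)) (nfst (nfst y)))
       (VHom B (nsnd (nfst x)) (nsnd (nfst y)))
       (VHom C (nsnd x) (nsnd y)))\<rparr>)"

definition inter_vfun :: "nat \<Rightarrow> nat \<Rightarrow> ('u nest, 'o, 'm) vcategory \<Rightarrow>
    ('u nest, 'o, 'm) vcategory \<Rightarrow> ('u nest, 'o, 'm) vcategory \<Rightarrow> ('u nest, 'o, 'm) vcategory \<Rightarrow>
    ('u nest, 'o, 'm) vfunctor" where
  "inter_vfun i j A B C D =
    (let X = pairs (pairs (VOb A) (VOb B)) (pairs (VOb C) (VOb D)) in
    \<lparr>FDom = tensor_vcat i (tensor_vcat j A B) (tensor_vcat j C D),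
     FCod = tensor_vcat j (tensor_vcat i A C) (tensor_vcat i B D),
     FOb = (\<lambda>x \<in> X. NPair (NPair (nfst (nfst x)) (nfst (nsnd x)))
                        (NPair (nsnd (nfst x)) (nsnd (nsnd x)))),
     FHom = (\<lambda>x \<in> X. \<lambda>y \<in> X. eta V (i + 1) (j + 1)
       (VHom A (nfst (nfst x)) (nfst (nfst y)))
       (VHom B (nsnd (nfst x)) (nsnd (nfst y)))
       (VHom C (nfst (nsnd x)) (nfst (nsnd y)))
       (VHom D (nsnd (nsnd x)) (nsnd (nsnd y))))\<rparr>)"

definition left_unit_vfun ::
  "nat \<Rightarrow> ('u nest, 'o, 'm) vcategory \<Rightarrow> ('u nest, 'o, 'm) vfunctor" where
  "left_unit_vfun i A = (let X = pairs {Pt} (VOb A) in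
    \<lparr>FDom = tensor_vcat i unit_vcat A, FCod = A, FOb = (\<lambda>x \<in> X. nsnd x),
     FHom = (\<lambda>x \<in> X. \<lambda>y \<in> X. \<one> (VHom A (nsnd x) (nsnd y)))\<rparr>)"

definition right_unit_vfun ::
  "nat \<Rightarrow> ('u nest, 'o, 'm) vcategory \<Rightarrow> ('u nest, 'o, 'm) vfunctor" where
  "right_unit_vfun i A = (let X = pairs (VOb A) {Pt} in
    \<lparr>FDom = tensor_vcat i A unit_vcat, FCod = A, FOb = (\<lambda>x \<in> X. nfst x),
     FHom = (\<lambda>x \<in> X. \<lambda>y \<in> X. \<one> (VHom A (nfst x) (nfst y)))\<rparr>)"

definition VCat :: "(('u nest, 'o, 'm) vcategory, ('u nest, 'o, 'm) vfunctor,
    ('u nest, 'o, 'm) vtrans) mon2cat" where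
  "VCat = \<lparr>
    Obj = {A. V_category A}, Arr = {T. V_functor T}, Cel = {\<beta>. V_trans \<beta>},
    src1 = FDom, trg1 = FCod, id1 = id_functor, cmp1 = comp_functor,
    src2 = NSrc, trg2 = NTrg, id2 = id_trans, vcmp = vert_comp, hcmp = horiz_comp,
    ten0 = tensor_vcat, ten1 = tensor_vfun, ten2 = tensor_vtrans,
    unt2 = unit_vcat, lun = left_unit_vfun, run = right_unit_vfun,
    asc2 = assoc_vfun, eta2 = inter_vfun\<rparr>"

end

end

theory Submission
  imports Defs
begin

text \<open>Every law of the structure on enriched categories is checked on hom-objects or on components
  \<open>\<I> \<rightarrow> A(a,b)\<close>, where it becomes an axiom of the base. Internal associativity of \<open>\<eta>\<^sup>1\<^sup>j\<close> makes the
  products of enriched categories associative, external associativity makes the associators enriched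
  functors, and the giant hexagon with first index 1 does the same for the interchange
  transformations. On components only the associators and interchangers at the unit occur; these are
  identities, the former because the pentagon makes \<open>\<alpha>\<^sub>I\<^sub>I\<^sub>I\<close> idempotent.\<close>

text \<open>The units are strict but the base has no triangle axiom, and this shapes the argument.
  Proving that a vertical composite of transformations is natural produces associators such as
  \<open>\<alpha> 1 \<I> \<I> X\<close>, about which the base says nothing for arbitrary X. They are
  only met with X a hom-object of an enriched category, and there the enriched axioms force them to
  be identities. Composition is handled through generalized elements X \<rightarrow> A(a,b). Moving
  structure morphisms past them by naturality leaves an associator or interchanger indexed by the
  domains of the elements alone. It disappears when enough of these domains are \<I>, and otherwise
  it is the one the enriched structure asks for. The first product is spent on the enrichment, so
  product i of enriched categories is product i + 1 of the base. The axioms on interchange are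
  therefore used twice: with first index 1 they make the new objects enriched categories and the new
  maps enriched functors, and with all indices raised by one they become the corresponding axioms of
  the 2-category.\<close>

declare One_nat_def [simp del]

section \<open>Typing and isomorphisms in a category\<close>

lemma homI: "\<lbrakk>f \<in> Mor C; Src C f = a; Trg C f = b\<rbrakk> \<Longrightarrow> f \<in> hom C a b"
  by (simp add: hom_def)

lemma homD:
  assumes "f \<in> hom C a b"
  shows "f \<in> Mor C" "Src C f = a" "Trg C f = b"
  using assms by (simp_all add: hom_def)

context category
begin

text \<open>Typing is phrased by equations for \<open>Src\<close> and \<open>Trg\<close> instead of
  membership in \<open>hom\<close>. The simplifier can then compute sources and targets of nested
  composites and discharge the side conditions of later rewrites.\<close>

lemma Idt_simps [simp]:
  assumes "a \<in> Ob C"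
  shows "Idt C a \<in> Mor C" "Src C (Idt C a) = a" "Trg C (Idt C a) = a"
  using Idt_hom[OF assms] by (simp_all add: hom_def)

lemma Cmp_simps [simp]:
  assumes "f \<in> Mor C" "g \<in> Mor C" "Src C g = Trg C f"
  shows "Cmp C g f \<in> Mor C" "Src C (Cmp C g f) = Src C f" "Trg C (Cmp C g f) = Trg C g"
  using Cmp_hom[of f "Src C f" "Trg C f" g "Trg C g"] assms by (simp_all add: hom_def)

lemma Cmp_Idt_left' [simp]: "\<lbrakk>f \<in> Mor C; Trg C f = b\<rbrakk> \<Longrightarrow> Cmp C (Idt C b) f = f"
  by (simp add: Cmp_Idt_left hom_def)

lemma Cmp_Idt_right' [simp]: "\<lbrakk>f \<in> Mor C; Src C f = a\<rbrakk> \<Longrightarrow> Cmp C f (Idt C a) = f"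
  by (simp add: Cmp_Idt_right hom_def)

text \<open>Oriented towards right-nested composites. The calculations below use it on both sides of
  an equation whenever a composite has to be rebracketed so that an axiom applies to an inner
  part.\<close>

lemma Cmp_assoc':
  assumes "f \<in> Mor C" "g \<in> Mor C" "h \<in> Mor C" "Src C g = Trg C f" "Src C h = Trg C g"
  shows "Cmp C (Cmp C h g) f = Cmp C h (Cmp C g f)"
  by (rule Cmp_assoc[symmetric]) (use assms in \<open>auto simp: hom_def\<close>)

declare Src_Ob [simp] Trg_Ob [simp]

lemma iso_cancel_left:
  assumes "is_iso C u" "f \<in> Mor C" "g \<in> Mor C" "Trg C f = Src C u" "Trg C g = Src C u"
    and "Cmp C u f = Cmp C u g"
  shows "f = g"
proof -
  obtain v where v: "v \<in> hom C (Trg C u) (Src C u)" "Cmp C v u = Idt C (Src C u)"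
    and u: "u \<in> Mor C"
    using assms(1) by (auto simp: is_iso_def)
  have "Cmp C (Cmp C v u) f = Cmp C (Cmp C v u) g"
    using assms u v(1) by (simp add: Cmp_assoc' homD)
  then show ?thesis
    using assms u v by simp
qed

text \<open>An isomorphism can be cancelled from u u = u 1.\<close>

lemma iso_idempotent:
  assumes "is_iso C u" "Src C u = Trg C u" "Cmp C u u = u"
  shows "u = Idt C (Src C u)"
proof (rule iso_cancel_left[OF assms(1)])
  have u: "u \<in> Mor C"
    using assms(1) by (simp add: is_iso_def)
  with assms show "Cmp C u u = Cmp C u (Idt C (Src C u))"
    by simp
  show "u \<in> Mor C" "Idt C (Src C u) \<in> Mor C" "Trg C (Idt C (Src C u)) = Src C u"
    using u by simp_all
  show "Trg C u = Src C u"
    using assms(2) by simp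
qed

end

section \<open>Typing, functoriality and naturality in the base\<close>

context iterated_monoidal_category
begin

declare unit_Ob [simp] unit_left_obj [simp] unit_right_obj [simp]
  unit_left_mor [simp] unit_right_mor [simp]

lemma tenO_Ob [simp]: "\<lbrakk>1 \<le> i; i \<le> n; a \<in> Ob C; b \<in> Ob C\<rbrakk> \<Longrightarrow> a \<otimes>\<^bsub>i\<^esub> b \<in> Ob C"
  using tensor_functor[of i] by (auto simp: is_functor_def prod_cat_def)

lemma tenM_simps [simp]:
  assumes "1 \<le> i" "i \<le> n" "f \<in> Mor C" "g \<in> Mor C"
  shows "f \<odot>\<^bsub>i\<^esub> g \<in> Mor C"
    and "Src C (f \<odot>\<^bsub>i\<^esub> g) = Src C f \<otimes>\<^bsub>i\<^esub> Src C g"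
    and "Trg C (f \<odot>\<^bsub>i\<^esub> g) = Trg C f \<otimes>\<^bsub>i\<^esub> Trg C g"
  using tensor_functor[of i] assms by (auto simp: is_functor_def prod_cat_def hom_def)

lemma tenM_Idt [simp]:
  "\<lbrakk>1 \<le> i; i \<le> n; a \<in> Ob C; b \<in> Ob C\<rbrakk> \<Longrightarrow> \<one> a \<odot>\<^bsub>i\<^esub> \<one> b = \<one> (a \<otimes>\<^bsub>i\<^esub> b)"
  using tensor_functor[of i] by (auto simp: is_functor_def prod_cat_def)

text \<open>Functoriality in the direction that fuses two products into one. The splitting direction
  is used only with an identity in one factor, where the decomposition is determined; this is the
  purpose of the two lemmas that follow.\<close>

lemma tenM_Cmp:
  assumes "1 \<le> i" "i \<le> n" "f \<in> Mor C" "g \<in> Mor C" "f' \<in> Mor C" "g' \<in> Mor C"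
    and "Trg C f = Src C g" "Trg C f' = Src C g'"
  shows "(g \<odot>\<^bsub>i\<^esub> g') \<cdot> (f \<odot>\<^bsub>i\<^esub> f') = (g \<cdot> f) \<odot>\<^bsub>i\<^esub> (g' \<cdot> f')"
proof -
  \<comment> \<open>The pairs stay single bound variables while the product category is unfolded;
    the case expressions compute once concrete pairs are inserted.\<close>
  have "\<forall>p \<in> Mor C \<times> Mor C. \<forall>q \<in> Mor C \<times> Mor C.
      Trg (prod_cat C C) p = Src (prod_cat C C) q \<longrightarrow>
      case_prod (tenM C i) (Cmp (prod_cat C C) q p) =
        case_prod (tenM C i) q \<cdot> case_prod (tenM C i) p"
    using tensor_functor[of i] assms(1,2) by (simp add: is_functor_def prod_cat_def)
  from this[rule_format, of "(f, f')" "(g, g')"] assms show ?thesis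
    by (simp add: prod_cat_def)
qed

lemma tenM_Cmp_Idt_right:
  "\<lbrakk>1 \<le> i; i \<le> n; f \<in> Mor C; g \<in> Mor C; Src C g = Trg C f; a \<in> Ob C\<rbrakk> \<Longrightarrow>
    (g \<cdot> f) \<odot>\<^bsub>i\<^esub> \<one> a = (g \<odot>\<^bsub>i\<^esub> \<one> a) \<cdot> (f \<odot>\<^bsub>i\<^esub> \<one> a)"
  by (simp add: tenM_Cmp)

lemma tenM_Cmp_Idt_left:
  "\<lbrakk>1 \<le> i; i \<le> n; f \<in> Mor C; g \<in> Mor C; Src C g = Trg C f; a \<in> Ob C\<rbrakk> \<Longrightarrow>
    \<one> a \<odot>\<^bsub>i\<^esub> (g \<cdot> f) = (\<one> a \<odot>\<^bsub>i\<^esub> g) \<cdot> (\<one> a \<odot>\<^bsub>i\<^esub> f)"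
  by (simp add: tenM_Cmp)

text \<open>Since \<I> is a strict unit also on morphisms, f equals both
  \<open>\<one> \<I> \<odot> f\<close> and \<open>f \<odot> \<one> \<I>\<close>, and bifunctoriality
  does the rest.\<close>

lemma unit_elements_Cmp:
  assumes "1 \<le> i" "i \<le> n" "f \<in> hom C a b" "u \<in> hom C \<I> c"
  shows "(u \<odot>\<^bsub>i\<^esub> \<one> b) \<cdot> f = u \<odot>\<^bsub>i\<^esub> f" "(\<one> b \<odot>\<^bsub>i\<^esub> u) \<cdot> f = f \<odot>\<^bsub>i\<^esub> u"
proof -
  have f: "f \<in> Mor C" "Src C f = a" "Trg C f = b" and u: "u \<in> Mor C" "Src C u = \<I>"
    using assms(3,4) by (simp_all add: hom_def)
  have "(u \<odot>\<^bsub>i\<^esub> \<one> b) \<cdot> (\<one> \<I> \<odot>\<^bsub>i\<^esub> f) = u \<odot>\<^bsub>i\<^esub> f" "(\<one> b \<odot>\<^bsub>i\<^esub> u) \<cdot> (f \<odot>\<^bsub>i\<^esub> \<one> \<I>) = f \<odot>\<^bsub>i\<^esub> u"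
    \<comment> \<open>The strict unit rules are switched off here, since they would erase
      \<open>\<one> \<I>\<close> before the two products are fused.\<close>
    using assms(1,2) f u Trg_Ob[of f] by (simp_all add: tenM_Cmp del: unit_left_mor unit_right_mor)
  then show "(u \<odot>\<^bsub>i\<^esub> \<one> b) \<cdot> f = u \<odot>\<^bsub>i\<^esub> f" "(\<one> b \<odot>\<^bsub>i\<^esub> u) \<cdot> f = f \<odot>\<^bsub>i\<^esub> u"
    using assms(1,2) f by simp_all
qed

lemma asc_simps [simp]:
  assumes "1 \<le> i" "i \<le> n" "a \<in> Ob C" "b \<in> Ob C" "c \<in> Ob C"
  shows "\<alpha> i a b c \<in> Mor C"
    and "Src C (\<alpha> i a b c) = (a \<otimes>\<^bsub>i\<^esub> b) \<otimes>\<^bsub>i\<^esub> c"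
    and "Trg C (\<alpha> i a b c) = a \<otimes>\<^bsub>i\<^esub> (b \<otimes>\<^bsub>i\<^esub> c)"
proof -
  have "\<forall>p \<in> (Ob C \<times> Ob C) \<times> Ob C. (\<lambda>((a, b), c). \<alpha> i a b c) p
      \<in> hom C (paren_left (tenO C i) p) (paren_right (tenO C i) p)"
    using assoc_nat[of i] assms(1,2) by (simp add: is_nat_trans_def prod_cat_def)
  from this[rule_format, of "((a, b), c)"] assms
  have "\<alpha> i a b c \<in> hom C ((a \<otimes>\<^bsub>i\<^esub> b) \<otimes>\<^bsub>i\<^esub> c) (a \<otimes>\<^bsub>i\<^esub> (b \<otimes>\<^bsub>i\<^esub> c))"
    by (simp add: paren_left_def paren_right_def)
  then show "\<alpha> i a b c \<in> Mor C"
    and "Src C (\<alpha> i a b c) = (a \<otimes>\<^bsub>i\<^esub> b) \<otimes>\<^bsub>i\<^esub> c"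
    and "Trg C (\<alpha> i a b c) = a \<otimes>\<^bsub>i\<^esub> (b \<otimes>\<^bsub>i\<^esub> c)"
    by (simp_all add: hom_def)
qed

lemma asc_natural:
  assumes "1 \<le> i" "i \<le> n" "f \<in> hom C a a'" "g \<in> hom C b b'" "h \<in> hom C c c'"
  shows "\<alpha> i a' b' c' \<cdot> ((f \<odot>\<^bsub>i\<^esub> g) \<odot>\<^bsub>i\<^esub> h) = (f \<odot>\<^bsub>i\<^esub> (g \<odot>\<^bsub>i\<^esub> h)) \<cdot> \<alpha> i a b c"
proof -
  have "\<forall>p \<in> (Mor C \<times> Mor C) \<times> Mor C.
      (\<lambda>((a, b), c). \<alpha> i a b c) (Trg (prod_cat (prod_cat C C) C) p) \<cdot> paren_left (tenM C i) p =
      paren_right (tenM C i) p \<cdot> (\<lambda>((a, b), c). \<alpha> i a b c) (Src (prod_cat (prod_cat C C) C) p)"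
    using assoc_nat[of i] assms(1,2) by (simp add: is_nat_trans_def prod_cat_def)
  from this[rule_format, of "((f, g), h)"] assms(3-5) show ?thesis
    by (simp add: prod_cat_def paren_left_def paren_right_def hom_def)
qed

lemma eta_simps [simp]:
  assumes "1 \<le> i" "i < j" "j \<le> n" "a \<in> Ob C" "b \<in> Ob C" "c \<in> Ob C" "d \<in> Ob C"
  shows "\<eta> i j a b c d \<in> Mor C"
    and "Src C (\<eta> i j a b c d) = (a \<otimes>\<^bsub>j\<^esub> b) \<otimes>\<^bsub>i\<^esub> (c \<otimes>\<^bsub>j\<^esub> d)"
    and "Trg C (\<eta> i j a b c d) = (a \<otimes>\<^bsub>i\<^esub> c) \<otimes>\<^bsub>j\<^esub> (b \<otimes>\<^bsub>i\<^esub> d)"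
proof -
  have "\<forall>p \<in> (Ob C \<times> Ob C) \<times> (Ob C \<times> Ob C). (\<lambda>((a, b), (c, d)). \<eta> i j a b c d) p
      \<in> hom C (inter_src (tenO C i) (tenO C j) p) (inter_trg (tenO C i) (tenO C j) p)"
    using inter_nat[of i j] assms(1-3) by (simp add: is_nat_trans_def prod_cat_def)
  from this[rule_format, of "((a, b), (c, d))"] assms
  have "\<eta> i j a b c d \<in> hom C ((a \<otimes>\<^bsub>j\<^esub> b) \<otimes>\<^bsub>i\<^esub> (c \<otimes>\<^bsub>j\<^esub> d)) ((a \<otimes>\<^bsub>i\<^esub> c) \<otimes>\<^bsub>j\<^esub> (b \<otimes>\<^bsub>i\<^esub> d))"
    by (simp add: inter_src_def inter_trg_def)
  then show "\<eta> i j a b c d \<in> Mor C"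
    and "Src C (\<eta> i j a b c d) = (a \<otimes>\<^bsub>j\<^esub> b) \<otimes>\<^bsub>i\<^esub> (c \<otimes>\<^bsub>j\<^esub> d)"
    and "Trg C (\<eta> i j a b c d) = (a \<otimes>\<^bsub>i\<^esub> c) \<otimes>\<^bsub>j\<^esub> (b \<otimes>\<^bsub>i\<^esub> d)"
    by (simp_all add: hom_def)
qed

lemma eta_natural:
  assumes "1 \<le> i" "i < j" "j \<le> n"
    and "f \<in> hom C a a'" "g \<in> hom C b b'" "h \<in> hom C c c'" "l \<in> hom C d d'"
  shows "\<eta> i j a' b' c' d' \<cdot> ((f \<odot>\<^bsub>j\<^esub> g) \<odot>\<^bsub>i\<^esub> (h \<odot>\<^bsub>j\<^esub> l)) =
    ((f \<odot>\<^bsub>i\<^esub> h) \<odot>\<^bsub>j\<^esub> (g \<odot>\<^bsub>i\<^esub> l)) \<cdot> \<eta> i j a b c d"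
proof -
  let ?P = "prod_cat (prod_cat C C) (prod_cat C C)"
  have "\<forall>p \<in> (Mor C \<times> Mor C) \<times> (Mor C \<times> Mor C).
      (\<lambda>((a, b), (c, d)). \<eta> i j a b c d) (Trg ?P p) \<cdot> inter_src (tenM C i) (tenM C j) p =
      inter_trg (tenM C i) (tenM C j) p \<cdot> (\<lambda>((a, b), (c, d)). \<eta> i j a b c d) (Src ?P p)"
    using inter_nat[of i j] assms(1-3) by (simp add: is_nat_trans_def prod_cat_def)
  from this[rule_format, of "((f, g), (h, l))"] assms(4-7) show ?thesis
    by (simp add: prod_cat_def inter_src_def inter_trg_def hom_def)
qed

text \<open>Every product of copies of \<I> is \<I>, so at four units the pentagon reads a a = a a a
  for the associator a. Cancelling one factor leaves an idempotent isomorphism.\<close>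

lemma asc_unit [simp]:
  assumes "1 \<le> i" "i \<le> n"
  shows "\<alpha> i \<I> \<I> \<I> = \<one> \<I>"
proof -
  let ?a = "\<alpha> i \<I> \<I> \<I>"
  have a: "is_iso C ?a" "?a \<in> Mor C" "Src C ?a = \<I>" "Trg C ?a = \<I>"
    using assms assoc_iso by auto
  have "?a \<cdot> ?a = ?a \<cdot> (?a \<cdot> ?a)"
    using pentagon[of i \<I> \<I> \<I> \<I>] assms a by simp
  then have "?a = ?a \<cdot> ?a"
    by (rule iso_cancel_left[OF a(1), rotated -1]) (use a in simp_all)
  with iso_idempotent[OF a(1)] a show ?thesis
    by simp
qed

lemma eta_unit_simps [simp]:
  assumes "1 \<le> i" "i < j" "j \<le> n" "a \<in> Ob C" "b \<in> Ob C"
  shows "\<eta> i j a b \<I> \<I> = \<one> (a \<otimes>\<^bsub>j\<^esub> b)" "\<eta> i j \<I> \<I> a b = \<one> (a \<otimes>\<^bsub>j\<^esub> b)"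
    and "\<eta> i j a \<I> b \<I> = \<one> (a \<otimes>\<^bsub>i\<^esub> b)" "\<eta> i j \<I> a \<I> b = \<one> (a \<otimes>\<^bsub>i\<^esub> b)"
  using internal_unit[of i j a b] external_unit[of i j a b] assms by simp_all

text \<open>Naturality of \<eta> followed by functoriality of the second product. When h and h' are
  the compositions of two enriched categories, \<open>(h \<odot> h') \<cdot> \<eta>\<close> is the
  composition of their product, so this computes composites of pairs componentwise.\<close>

lemma eta_tenM_absorb:
  assumes "1 \<le> i" "i < j" "j \<le> n"
    and "f \<in> Mor C" "f' \<in> Mor C" "g \<in> Mor C" "g' \<in> Mor C" "h \<in> Mor C" "h' \<in> Mor C"
    and "Src C h = Trg C g \<otimes>\<^bsub>i\<^esub> Trg C f" "Src C h' = Trg C g' \<otimes>\<^bsub>i\<^esub> Trg C f'"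
  shows "((h \<odot>\<^bsub>j\<^esub> h') \<cdot> \<eta> i j (Trg C g) (Trg C g') (Trg C f) (Trg C f'))
      \<cdot> ((g \<odot>\<^bsub>j\<^esub> g') \<odot>\<^bsub>i\<^esub> (f \<odot>\<^bsub>j\<^esub> f')) =
    ((h \<cdot> (g \<odot>\<^bsub>i\<^esub> f)) \<odot>\<^bsub>j\<^esub> (h' \<cdot> (g' \<odot>\<^bsub>i\<^esub> f'))) \<cdot> \<eta> i j (Src C g) (Src C g') (Src C f) (Src C f')"
proof -
  have "((h \<odot>\<^bsub>j\<^esub> h') \<cdot> \<eta> i j (Trg C g) (Trg C g') (Trg C f) (Trg C f'))
      \<cdot> ((g \<odot>\<^bsub>j\<^esub> g') \<odot>\<^bsub>i\<^esub> (f \<odot>\<^bsub>j\<^esub> f')) =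
    (h \<odot>\<^bsub>j\<^esub> h') \<cdot> (\<eta> i j (Trg C g) (Trg C g') (Trg C f) (Trg C f')
      \<cdot> ((g \<odot>\<^bsub>j\<^esub> g') \<odot>\<^bsub>i\<^esub> (f \<odot>\<^bsub>j\<^esub> f')))"
    using assms by (simp add: Cmp_assoc')
  also have "\<eta> i j (Trg C g) (Trg C g') (Trg C f) (Trg C f') \<cdot> ((g \<odot>\<^bsub>j\<^esub> g') \<odot>\<^bsub>i\<^esub> (f \<odot>\<^bsub>j\<^esub> f')) =
    ((g \<odot>\<^bsub>i\<^esub> f) \<odot>\<^bsub>j\<^esub> (g' \<odot>\<^bsub>i\<^esub> f')) \<cdot> \<eta> i j (Src C g) (Src C g') (Src C f) (Src C f')"
    by (rule eta_natural) (use assms in \<open>simp_all add: hom_def\<close>)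
  also have "(h \<odot>\<^bsub>j\<^esub> h') \<cdot> \<dots> = ((h \<odot>\<^bsub>j\<^esub> h') \<cdot> ((g \<odot>\<^bsub>i\<^esub> f) \<odot>\<^bsub>j\<^esub> (g' \<odot>\<^bsub>i\<^esub> f')))
      \<cdot> \<eta> i j (Src C g) (Src C g') (Src C f) (Src C f')"
    using assms by (simp add: Cmp_assoc')
  finally show ?thesis
    using assms by (simp add: tenM_Cmp)
qed

end

section \<open>Points of product object sets\<close>

lemma NPair_in_pairs [simp]: "NPair a b \<in> pairs X Y \<longleftrightarrow> a \<in> X \<and> b \<in> Y"
  by (simp add: pairs_def)

text \<open>Together with the elimination rule below, this replaces points of a product by explicit
  pairs, so that \<open>nfst\<close> and \<open>nsnd\<close> compute.\<close>

lemma ball_pairs [simp]: "(\<forall>x \<in> pairs X Y. P x) \<longleftrightarrow> (\<forall>a \<in> X. \<forall>b \<in> Y. P (NPair a b))"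
  by (auto simp: pairs_def)

lemma pairsE [elim!]:
  assumes "x \<in> pairs X Y"
  obtains a b where "x = NPair a b" "a \<in> X" "b \<in> Y"
  using assms by (auto simp: pairs_def)

text \<open>The bound makes the product with index 1 available for the enrichment. Products of
  enriched categories then exist for 1 \<le> i < n, that is, for the base indices i + 1 from 2 to
  n.\<close>

locale enrichment_base = iterated_monoidal_category n V
  for n :: nat and V :: "('o, 'm) tcat" +
  assumes n_pos: "1 \<le> n"
begin

abbreviation V_tensor_obj (\<open>(_ \<otimes>\<^bsub>_\<^esub> _)\<close> [71, 0, 71] 70) where "a \<otimes>\<^bsub>i\<^esub> b \<equiv> tenO V i a b"
abbreviation V_tensor_mor (\<open>(_ \<odot>\<^bsub>_\<^esub> _)\<close> [71, 0, 71] 70) where "f \<odot>\<^bsub>i\<^esub> g \<equiv> tenM V i f g"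
abbreviation V_after (infixr \<open>\<cdot>\<close> 55) where "g \<cdot> f \<equiv> Cmp V g f"
abbreviation V_ident (\<open>\<one>\<close>) where "\<one> \<equiv> Idt V"
abbreviation V_unit (\<open>\<I>\<close>) where "\<I> \<equiv> Unt V"
abbreviation V_alpha (\<open>\<alpha>\<close>) where "\<alpha> \<equiv> asc V"
abbreviation V_inter (\<open>\<eta>\<close>) where "\<eta> \<equiv> eta V"

declare n_pos [simp]

section \<open>Calculus of enriched categories, functors and transformations\<close>

lemma V_category_VHom: "\<lbrakk>V_category V A; a \<in> VOb A; b \<in> VOb A\<rbrakk> \<Longrightarrow> VHom A a b \<in> Ob V"
  by (auto simp: V_category_def)

lemma V_category_VCmp:
  assumes "V_category V A" "a \<in> VOb A" "b \<in> VOb A" "c \<in> VOb A"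
  shows "VCmp A a b c \<in> Mor V"
    and "Src V (VCmp A a b c) = VHom A b c \<otimes>\<^bsub>1\<^esub> VHom A a b"
    and "Trg V (VCmp A a b c) = VHom A a c"
proof -
  have "VCmp A a b c \<in> hom V (VHom A b c \<otimes>\<^bsub>1\<^esub> VHom A a b) (VHom A a c)"
    using assms by (auto simp: V_category_def PiE_iff)
  then show "VCmp A a b c \<in> Mor V"
    and "Src V (VCmp A a b c) = VHom A b c \<otimes>\<^bsub>1\<^esub> VHom A a b"
    and "Trg V (VCmp A a b c) = VHom A a c"
    by (simp_all add: hom_def)
qed

lemma V_category_VId:
  assumes "V_category V A" "a \<in> VOb A"
  shows "VId A a \<in> Mor V" "Src V (VId A a) = \<I>" "Trg V (VId A a) = VHom A a a"
proof -
  have "VId A a \<in> hom V \<I> (VHom A a a)"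
    using assms by (auto simp: V_category_def PiE_iff)
  then show "VId A a \<in> Mor V" "Src V (VId A a) = \<I>" "Trg V (VId A a) = VHom A a a"
    by (simp_all add: hom_def)
qed

lemma V_category_unit:
  assumes "V_category V A" "a \<in> VOb A" "b \<in> VOb A"
  shows "VCmp A a b b \<cdot> (VId A b \<odot>\<^bsub>1\<^esub> \<one> (VHom A a b)) = \<one> (VHom A a b)"
    and "VCmp A a a b \<cdot> (\<one> (VHom A a b) \<odot>\<^bsub>1\<^esub> VId A a) = \<one> (VHom A a b)"
  using assms by (simp_all add: V_category_def)

lemma V_category_assoc:
  assumes "V_category V A" "a \<in> VOb A" "b \<in> VOb A" "c \<in> VOb A" "d \<in> VOb A"
  shows "VCmp A a b d \<cdot> (VCmp A b c d \<odot>\<^bsub>1\<^esub> \<one> (VHom A a b)) =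
    VCmp A a c d \<cdot> (\<one> (VHom A c d) \<odot>\<^bsub>1\<^esub> VCmp A a b c)
      \<cdot> \<alpha> 1 (VHom A c d) (VHom A b c) (VHom A a b)"
  using assms by (simp add: V_category_def)

lemma V_functor_category: "V_functor V T \<Longrightarrow> V_category V (FDom T) \<and> V_category V (FCod T)"
  by (simp add: V_functor_def Let_def)

lemma V_functor_PiE:
  assumes "V_functor V T"
  shows "FOb T \<in> VOb (FDom T) \<rightarrow>\<^sub>E VOb (FCod T)"
    and "FHom T \<in> (\<Pi>\<^sub>E a \<in> VOb (FDom T). \<Pi>\<^sub>E b \<in> VOb (FDom T).
      hom V (VHom (FDom T) a b) (VHom (FCod T) (FOb T a) (FOb T b)))"
  using assms by (simp_all add: V_functor_def Let_def)

text \<open>The codomain is a variable with an equation because goals often name it by another term,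
  such as the common codomain of the two functors of a transformation.\<close>

lemma V_functor_FOb: "\<lbrakk>V_functor V T; a \<in> VOb (FDom T); FCod T = B\<rbrakk> \<Longrightarrow> FOb T a \<in> VOb B"
  using V_functor_PiE(1)[of T] by auto

lemma V_functor_FHom:
  assumes "V_functor V T" "a \<in> VOb (FDom T)" "b \<in> VOb (FDom T)"
  shows "FHom T a b \<in> Mor V" "Src V (FHom T a b) = VHom (FDom T) a b"
    and "Trg V (FHom T a b) = VHom (FCod T) (FOb T a) (FOb T b)"
proof -
  have "FHom T a b \<in> hom V (VHom (FDom T) a b) (VHom (FCod T) (FOb T a) (FOb T b))"
    using V_functor_PiE(2)[OF assms(1)] assms(2,3) by (auto simp: PiE_iff)
  then show "FHom T a b \<in> Mor V" "Src V (FHom T a b) = VHom (FDom T) a b"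
    and "Trg V (FHom T a b) = VHom (FCod T) (FOb T a) (FOb T b)"
    by (simp_all add: hom_def)
qed

lemma V_functor_VCmp:
  assumes "V_functor V T" "a \<in> VOb (FDom T)" "b \<in> VOb (FDom T)" "c \<in> VOb (FDom T)"
  shows "FHom T a c \<cdot> VCmp (FDom T) a b c =
    VCmp (FCod T) (FOb T a) (FOb T b) (FOb T c) \<cdot> (FHom T b c \<odot>\<^bsub>1\<^esub> FHom T a b)"
  using assms by (simp add: V_functor_def Let_def)

lemma V_functor_VId:
  "\<lbrakk>V_functor V T; a \<in> VOb (FDom T)\<rbrakk> \<Longrightarrow> FHom T a a \<cdot> VId (FDom T) a = VId (FCod T) (FOb T a)"
  by (simp add: V_functor_def Let_def)

lemma V_functorI:
  assumes "V_category V (FDom T)" "V_category V (FCod T)"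
    and "FOb T \<in> VOb (FDom T) \<rightarrow>\<^sub>E VOb (FCod T)"
    and "FHom T \<in> (\<Pi>\<^sub>E a \<in> VOb (FDom T). \<Pi>\<^sub>E b \<in> VOb (FDom T).
      hom V (VHom (FDom T) a b) (VHom (FCod T) (FOb T a) (FOb T b)))"
    and "\<And>a b c. \<lbrakk>a \<in> VOb (FDom T); b \<in> VOb (FDom T); c \<in> VOb (FDom T)\<rbrakk> \<Longrightarrow>
      FHom T a c \<cdot> VCmp (FDom T) a b c =
      VCmp (FCod T) (FOb T a) (FOb T b) (FOb T c) \<cdot> (FHom T b c \<odot>\<^bsub>1\<^esub> FHom T a b)"
    and "\<And>a. a \<in> VOb (FDom T) \<Longrightarrow> FHom T a a \<cdot> VId (FDom T) a = VId (FCod T) (FOb T a)"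
  shows "V_functor V T"
  using assms by (simp add: V_functor_def Let_def)

text \<open>Object functions and hom families are undefined off the object set, so agreement on that
  set already gives equality in the logic. All equations between 1-cells below are proved through
  this rule.\<close>

lemma V_functor_eqI:
  assumes "V_functor V S" "V_functor V T" "FDom S = FDom T" "FCod S = FCod T"
    and "\<And>a. a \<in> VOb (FDom T) \<Longrightarrow> FOb S a = FOb T a"
    and "\<And>a b. \<lbrakk>a \<in> VOb (FDom T); b \<in> VOb (FDom T)\<rbrakk> \<Longrightarrow> FHom S a b = FHom T a b"
  shows "S = T"
proof -
  note S = V_functor_PiE[OF assms(1), unfolded assms(3,4)]
  note T = V_functor_PiE[OF assms(2)]
  have FOb: "FOb S = FOb T"
    by (rule PiE_ext[OF S(1) T(1) assms(5)])
  \<comment> \<open>The type of the hom family depends on the object function; only after the object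
    functions are identified do both families lie in the same dependent product.\<close>
  note S2 = S(2)[unfolded FOb]
  have "FHom S = FHom T"
  proof (rule PiE_ext[OF S2 T(2)])
    fix a
    assume a: "a \<in> VOb (FDom T)"
    show "FHom S a = FHom T a"
      by (rule PiE_ext[OF PiE_mem[OF S2 a] PiE_mem[OF T(2) a] assms(6)[OF a]])
  qed
  with FOb assms(3,4) show ?thesis
    by (cases S; cases T) simp
qed

lemma V_trans_functor:
  assumes "V_trans V \<beta>"
  shows "V_functor V (NSrc \<beta>)" "V_functor V (NTrg \<beta>)"
    and "FDom (NTrg \<beta>) = FDom (NSrc \<beta>)" "FCod (NTrg \<beta>) = FCod (NSrc \<beta>)"
  using assms by (simp_all add: V_trans_def Let_def)

lemma V_trans_PiE:
  "V_trans V \<beta> \<Longrightarrow> NAt \<beta> \<in> (\<Pi>\<^sub>E a \<in> VOb (FDom (NSrc \<beta>)).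
    hom V \<I> (VHom (FCod (NSrc \<beta>)) (FOb (NSrc \<beta>) a) (FOb (NTrg \<beta>) a)))"
  by (simp add: V_trans_def Let_def)

lemma V_trans_NAt:
  assumes "V_trans V \<beta>" "a \<in> VOb (FDom (NSrc \<beta>))"
  shows "NAt \<beta> a \<in> Mor V" "Src V (NAt \<beta> a) = \<I>"
    and "Trg V (NAt \<beta> a) = VHom (FCod (NSrc \<beta>)) (FOb (NSrc \<beta>) a) (FOb (NTrg \<beta>) a)"
  using PiE_mem[OF V_trans_PiE[OF assms(1)] assms(2)] by (simp_all add: hom_def)

lemma V_trans_eqI:
  assumes "V_trans V \<beta>" "V_trans V \<gamma>" "NSrc \<beta> = NSrc \<gamma>" "NTrg \<beta> = NTrg \<gamma>"
    and "\<And>a. a \<in> VOb (FDom (NSrc \<gamma>)) \<Longrightarrow> NAt \<beta> a = NAt \<gamma> a"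
  shows "\<beta> = \<gamma>"
proof -
  have "NAt \<beta> = NAt \<gamma>"
    by (rule PiE_ext[OF V_trans_PiE[OF assms(1), unfolded assms(3,4)] V_trans_PiE[OF assms(2)] assms(5)])
  with assms(3,4) show ?thesis
    by (cases \<beta>; cases \<gamma>) simp
qed

text \<open>Composition of generalized elements \<open>g : Y \<rightarrow> A(b,c)\<close> and \<open>f : X \<rightarrow> A(a,b)\<close>.\<close>

definition elt_comp ::
  "('a, 'o, 'm) vcategory \<Rightarrow> 'a \<Rightarrow> 'a \<Rightarrow> 'a \<Rightarrow> 'm \<Rightarrow> 'm \<Rightarrow> 'm" where
  "elt_comp A a b c g f = VCmp A a b c \<cdot> (g \<odot>\<^bsub>1\<^esub> f)"

lemma V_trans_natural:
  assumes "V_trans V \<beta>" "a \<in> VOb (FDom (NSrc \<beta>))" "b \<in> VOb (FDom (NSrc \<beta>))"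
  shows "elt_comp (FCod (NSrc \<beta>)) (FOb (NSrc \<beta>) a) (FOb (NSrc \<beta>) b) (FOb (NTrg \<beta>) b)
      (NAt \<beta> b) (FHom (NSrc \<beta>) a b) =
    elt_comp (FCod (NSrc \<beta>)) (FOb (NSrc \<beta>) a) (FOb (NTrg \<beta>) a) (FOb (NTrg \<beta>) b)
      (FHom (NTrg \<beta>) a b) (NAt \<beta> a)"
  using assms by (simp add: V_trans_def Let_def elt_comp_def)

lemma V_transI:
  assumes "V_functor V (NSrc \<beta>)" "V_functor V (NTrg \<beta>)"
    and "FDom (NTrg \<beta>) = FDom (NSrc \<beta>)" "FCod (NTrg \<beta>) = FCod (NSrc \<beta>)"
    and "NAt \<beta> \<in> (\<Pi>\<^sub>E a \<in> VOb (FDom (NSrc \<beta>)).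
      hom V \<I> (VHom (FCod (NSrc \<beta>)) (FOb (NSrc \<beta>) a) (FOb (NTrg \<beta>) a)))"
    and "\<And>a b. \<lbrakk>a \<in> VOb (FDom (NSrc \<beta>)); b \<in> VOb (FDom (NSrc \<beta>))\<rbrakk> \<Longrightarrow>
      elt_comp (FCod (NSrc \<beta>)) (FOb (NSrc \<beta>) a) (FOb (NSrc \<beta>) b) (FOb (NTrg \<beta>) b)
        (NAt \<beta> b) (FHom (NSrc \<beta>) a b) =
      elt_comp (FCod (NSrc \<beta>)) (FOb (NSrc \<beta>) a) (FOb (NTrg \<beta>) a) (FOb (NTrg \<beta>) b)
        (FHom (NTrg \<beta>) a b) (NAt \<beta> a)"
  shows "V_trans V \<beta>"
  using assms by (simp add: V_trans_def Let_def elt_comp_def)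

declare V_category_VHom [simp] V_category_VCmp [simp] V_category_VId [simp]
  V_functor_category [simp] V_functor_FOb [simp] V_functor_FHom [simp]
  V_trans_functor [simp] V_trans_NAt [simp]

lemma elt_comp_simps [simp]:
  assumes "V_category V A" "a \<in> VOb A" "b \<in> VOb A" "c \<in> VOb A"
    and "f \<in> Mor V" "g \<in> Mor V" "Trg V f = VHom A a b" "Trg V g = VHom A b c"
  shows "elt_comp A a b c g f \<in> Mor V"
    and "Src V (elt_comp A a b c g f) = Src V g \<otimes>\<^bsub>1\<^esub> Src V f"
    and "Trg V (elt_comp A a b c g f) = VHom A a c"
  using assms by (simp_all add: elt_comp_def)

text \<open>Reparametrization: precomposing the two elements amounts to precomposing their composite
  with the product of the reparametrizations, by bifunctoriality of the first product.\<close>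

lemma elt_comp_Cmp:
  assumes "V_category V A" "a \<in> VOb A" "b \<in> VOb A" "c \<in> VOb A"
    and "f \<in> Mor V" "g \<in> Mor V" "Trg V f = VHom A a b" "Trg V g = VHom A b c"
    and "u \<in> Mor V" "v \<in> Mor V" "Trg V u = Src V g" "Trg V v = Src V f"
  shows "elt_comp A a b c (g \<cdot> u) (f \<cdot> v) = elt_comp A a b c g f \<cdot> (u \<odot>\<^bsub>1\<^esub> v)"
  using assms by (simp add: elt_comp_def Cmp_assoc' tenM_Cmp)

text \<open>The enriched axiom has its associator at three hom-objects; naturality of \<alpha>
  transports it to the domains of the three elements, where it can often be evaluated.\<close>

lemma elt_comp_assoc:
  assumes A: "V_category V A" "a \<in> VOb A" "b \<in> VOb A" "c \<in> VOb A" "d \<in> VOb A"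
    and f: "f \<in> Mor V" "Trg V f = VHom A a b"
    and g: "g \<in> Mor V" "Trg V g = VHom A b c"
    and h: "h \<in> Mor V" "Trg V h = VHom A c d"
  shows "elt_comp A a b d (elt_comp A b c d h g) f =
    elt_comp A a c d h (elt_comp A a b c g f) \<cdot> \<alpha> 1 (Src V h) (Src V g) (Src V f)"
proof -
  let ?P = "VHom A c d" and ?Q = "VHom A b c" and ?R = "VHom A a b"
  have "elt_comp A a b d (elt_comp A b c d h g) f =
      VCmp A a b d \<cdot> ((VCmp A b c d \<odot>\<^bsub>1\<^esub> \<one> ?R) \<cdot> ((h \<odot>\<^bsub>1\<^esub> g) \<odot>\<^bsub>1\<^esub> f))"
    using assms by (simp add: elt_comp_def tenM_Cmp)
  also have "\<dots> = (VCmp A a b d \<cdot> (VCmp A b c d \<odot>\<^bsub>1\<^esub> \<one> ?R)) \<cdot> ((h \<odot>\<^bsub>1\<^esub> g) \<odot>\<^bsub>1\<^esub> f)"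
    using assms by (simp add: Cmp_assoc')
  also have "\<dots> = VCmp A a c d \<cdot> (\<one> ?P \<odot>\<^bsub>1\<^esub> VCmp A a b c) \<cdot> \<alpha> 1 ?P ?Q ?R \<cdot> ((h \<odot>\<^bsub>1\<^esub> g) \<odot>\<^bsub>1\<^esub> f)"
    using assms by (subst V_category_assoc) (simp_all add: Cmp_assoc')
  also have "\<alpha> 1 ?P ?Q ?R \<cdot> ((h \<odot>\<^bsub>1\<^esub> g) \<odot>\<^bsub>1\<^esub> f) =
      (h \<odot>\<^bsub>1\<^esub> (g \<odot>\<^bsub>1\<^esub> f)) \<cdot> \<alpha> 1 (Src V h) (Src V g) (Src V f)"
    using assms by (intro asc_natural) (simp_all add: hom_def)
  also have "VCmp A a c d \<cdot> (\<one> ?P \<odot>\<^bsub>1\<^esub> VCmp A a b c) \<cdot> (h \<odot>\<^bsub>1\<^esub> (g \<odot>\<^bsub>1\<^esub> f))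
        \<cdot> \<alpha> 1 (Src V h) (Src V g) (Src V f) =
      (VCmp A a c d \<cdot> ((\<one> ?P \<odot>\<^bsub>1\<^esub> VCmp A a b c) \<cdot> (h \<odot>\<^bsub>1\<^esub> (g \<odot>\<^bsub>1\<^esub> f))))
        \<cdot> \<alpha> 1 (Src V h) (Src V g) (Src V f)"
    using assms by (simp add: Cmp_assoc')
  also have "\<dots> = elt_comp A a c d h (elt_comp A a b c g f) \<cdot> \<alpha> 1 (Src V h) (Src V g) (Src V f)"
    using assms by (simp add: elt_comp_def tenM_Cmp)
  finally show ?thesis .
qed

text \<open>The enriched unit axiom concerns the identity of the hom-object; strictness of \<I> lets
  an arbitrary f be factored through that identity.\<close>

lemma elt_comp_VId_left [simp]:
  assumes "V_category V A" "a \<in> VOb A" "b \<in> VOb A" "f \<in> Mor V" "Trg V f = VHom A a b"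
  shows "elt_comp A a b b (VId A b) f = f"
proof -
  have "VId A b \<odot>\<^bsub>1\<^esub> f = (VId A b \<odot>\<^bsub>1\<^esub> \<one> (VHom A a b)) \<cdot> f"
    using assms by (subst unit_elements_Cmp) (simp_all add: hom_def)
  then have "elt_comp A a b b (VId A b) f =
      (VCmp A a b b \<cdot> (VId A b \<odot>\<^bsub>1\<^esub> \<one> (VHom A a b))) \<cdot> f"
    using assms by (simp add: elt_comp_def Cmp_assoc')
  with assms show ?thesis
    by (simp add: V_category_unit)
qed

lemma elt_comp_VId_right [simp]:
  assumes "V_category V A" "a \<in> VOb A" "b \<in> VOb A" "f \<in> Mor V" "Trg V f = VHom A a b"
  shows "elt_comp A a a b f (VId A a) = f"
proof -
  have "f \<odot>\<^bsub>1\<^esub> VId A a = (\<one> (VHom A a b) \<odot>\<^bsub>1\<^esub> VId A a) \<cdot> f"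
    using assms by (subst unit_elements_Cmp) (simp_all add: hom_def)
  then have "elt_comp A a a b f (VId A a) =
      (VCmp A a a b \<cdot> (\<one> (VHom A a b) \<odot>\<^bsub>1\<^esub> VId A a)) \<cdot> f"
    using assms by (simp add: elt_comp_def Cmp_assoc')
  with assms show ?thesis
    by (simp add: V_category_unit)
qed

text \<open>The triangle axiom is not available in the base. On hom-objects, however, the unit and
  associativity axioms of the enriched category force the relevant associators to be identities:
  compose \<open>\<one>\<close> with two identity elements in both ways.\<close>

lemma asc_VHom [simp]:
  assumes [simp]: "V_category V A" "a \<in> VOb A" "b \<in> VOb A"
  shows "\<alpha> 1 \<I> \<I> (VHom A a b) = \<one> (VHom A a b)"
    and "\<alpha> 1 \<I> (VHom A a b) \<I> = \<one> (VHom A a b)"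
    and "\<alpha> 1 (VHom A a b) \<I> \<I> = \<one> (VHom A a b)"
proof -
  show "\<alpha> 1 \<I> \<I> (VHom A a b) = \<one> (VHom A a b)"
    using elt_comp_assoc[of A a b b b "\<one> (VHom A a b)" "VId A b" "VId A b"] by simp
  show "\<alpha> 1 \<I> (VHom A a b) \<I> = \<one> (VHom A a b)"
    using elt_comp_assoc[of A a a b b "VId A a" "\<one> (VHom A a b)" "VId A b"] by simp
  show "\<alpha> 1 (VHom A a b) \<I> \<I> = \<one> (VHom A a b)"
    using elt_comp_assoc[of A a a a b "VId A a" "VId A a" "\<one> (VHom A a b)"] by simp
qed

text \<open>All three domains are \<I>, so the remaining associator is
  \<open>asc_unit\<close>.\<close>

lemma elt_comp_assoc_elements:
  assumes "V_category V A" "a \<in> VOb A" "b \<in> VOb A" "c \<in> VOb A" "d \<in> VOb A"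
    and "f \<in> Mor V" "Trg V f = VHom A a b"
    and "g \<in> Mor V" "Trg V g = VHom A b c"
    and "h \<in> Mor V" "Trg V h = VHom A c d"
    and "Src V f = \<I>" "Src V g = \<I>" "Src V h = \<I>"
  shows "elt_comp A a b d (elt_comp A b c d h g) f = elt_comp A a c d h (elt_comp A a b c g f)"
  using assms by (subst elt_comp_assoc) simp_all

lemma V_functor_elt_comp:
  assumes "V_functor V T" "a \<in> VOb (FDom T)" "b \<in> VOb (FDom T)" "c \<in> VOb (FDom T)"
    and "f \<in> Mor V" "g \<in> Mor V" "Trg V f = VHom (FDom T) a b" "Trg V g = VHom (FDom T) b c"
  shows "FHom T a c \<cdot> elt_comp (FDom T) a b c g f =
    elt_comp (FCod T) (FOb T a) (FOb T b) (FOb T c) (FHom T b c \<cdot> g) (FHom T a b \<cdot> f)"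
proof -
  have "FHom T a c \<cdot> elt_comp (FDom T) a b c g f =
      (FHom T a c \<cdot> VCmp (FDom T) a b c) \<cdot> (g \<odot>\<^bsub>1\<^esub> f)"
    using assms by (simp add: elt_comp_def Cmp_assoc')
  with assms show ?thesis
    by (simp add: V_functor_VCmp elt_comp_def Cmp_assoc' tenM_Cmp)
qed

text \<open>Naturality evaluated at a generalized element f, obtained by precomposing with
  \<open>\<one> \<I> \<odot> f\<close> on one side and \<open>f \<odot> \<one> \<I>\<close> on the
  other, both of which are f. Right whiskering and the interchange law need it in this form.\<close>

lemma V_trans_natural_Cmp:
  assumes "V_trans V \<beta>" "a \<in> VOb (FDom (NSrc \<beta>))" "b \<in> VOb (FDom (NSrc \<beta>))"
    and "f \<in> Mor V" "Trg V f = VHom (FDom (NSrc \<beta>)) a b"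
  shows "elt_comp (FCod (NSrc \<beta>)) (FOb (NSrc \<beta>) a) (FOb (NSrc \<beta>) b) (FOb (NTrg \<beta>) b)
      (NAt \<beta> b) (FHom (NSrc \<beta>) a b \<cdot> f) =
    elt_comp (FCod (NSrc \<beta>)) (FOb (NSrc \<beta>) a) (FOb (NTrg \<beta>) a) (FOb (NTrg \<beta>) b)
      (FHom (NTrg \<beta>) a b \<cdot> f) (NAt \<beta> a)"
  using V_trans_natural[OF assms(1-3)] assms
    elt_comp_Cmp[of "FCod (NSrc \<beta>)" "FOb (NSrc \<beta>) a" "FOb (NSrc \<beta>) b" "FOb (NTrg \<beta>) b"
      "FHom (NSrc \<beta>) a b" "NAt \<beta> b" "\<one> \<I>" f]
    elt_comp_Cmp[of "FCod (NSrc \<beta>)" "FOb (NSrc \<beta>) a" "FOb (NTrg \<beta>) a" "FOb (NTrg \<beta>) b"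
      "NAt \<beta> a" "FHom (NTrg \<beta>) a b" f "\<one> \<I>"]
  by simp

section \<open>The 2-category of enriched categories\<close>

lemma id_functor_sel [simp]:
  "FDom (id_functor V A) = A" "FCod (id_functor V A) = A"
  "a \<in> VOb A \<Longrightarrow> FOb (id_functor V A) a = a"
  "\<lbrakk>a \<in> VOb A; b \<in> VOb A\<rbrakk> \<Longrightarrow> FHom (id_functor V A) a b = \<one> (VHom A a b)"
  by (simp_all add: id_functor_def)

lemma comp_functor_sel [simp]:
  "FDom (comp_functor V Q T) = FDom T" "FCod (comp_functor V Q T) = FCod Q"
  "a \<in> VOb (FDom T) \<Longrightarrow> FOb (comp_functor V Q T) a = FOb Q (FOb T a)"
  "\<lbrakk>a \<in> VOb (FDom T); b \<in> VOb (FDom T)\<rbrakk> \<Longrightarrow>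
    FHom (comp_functor V Q T) a b = FHom Q (FOb T a) (FOb T b) \<cdot> FHom T a b"
  by (simp_all add: comp_functor_def)

lemma V_functor_id [simp]: "V_category V A \<Longrightarrow> V_functor V (id_functor V A)"
  by (rule V_functorI) (simp_all add: id_functor_def homI)

lemma V_functor_comp [simp]:
  assumes "V_functor V Q" "V_functor V T" "FDom Q = FCod T"
  shows "V_functor V (comp_functor V Q T)"
proof (rule V_functorI)
  show "FOb (comp_functor V Q T) \<in> VOb (FDom (comp_functor V Q T)) \<rightarrow>\<^sub>E VOb (FCod (comp_functor V Q T))"
    using assms by (simp add: comp_functor_def)
  show "FHom (comp_functor V Q T) \<in> (\<Pi>\<^sub>E a \<in> VOb (FDom (comp_functor V Q T)).
      \<Pi>\<^sub>E b \<in> VOb (FDom (comp_functor V Q T)). hom V (VHom (FDom (comp_functor V Q T)) a b)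
      (VHom (FCod (comp_functor V Q T)) (FOb (comp_functor V Q T) a) (FOb (comp_functor V Q T) b)))"
    using assms by (simp add: comp_functor_def homI)
next
  fix a b c
  assume "a \<in> VOb (FDom (comp_functor V Q T))" "b \<in> VOb (FDom (comp_functor V Q T))"
    "c \<in> VOb (FDom (comp_functor V Q T))"
  then show "FHom (comp_functor V Q T) a c \<cdot> VCmp (FDom (comp_functor V Q T)) a b c =
      VCmp (FCod (comp_functor V Q T)) (FOb (comp_functor V Q T) a) (FOb (comp_functor V Q T) b)
        (FOb (comp_functor V Q T) c)
      \<cdot> (FHom (comp_functor V Q T) b c \<odot>\<^bsub>1\<^esub> FHom (comp_functor V Q T) a b)"
    using assms V_functor_elt_comp[of Q "FOb T a" "FOb T b" "FOb T c" "FHom T a b" "FHom T b c"]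
    by (simp add: Cmp_assoc' V_functor_VCmp elt_comp_def)
next
  fix a
  assume "a \<in> VOb (FDom (comp_functor V Q T))"
  then show "FHom (comp_functor V Q T) a a \<cdot> VId (FDom (comp_functor V Q T)) a =
      VId (FCod (comp_functor V Q T)) (FOb (comp_functor V Q T) a)"
    using assms V_functor_VId[of Q "FOb T a"] by (simp add: Cmp_assoc' V_functor_VId)
qed (use assms in simp_all)

lemma comp_functor_id [simp]:
  assumes "V_functor V T"
  shows "FCod T = B \<Longrightarrow> comp_functor V (id_functor V B) T = T"
    and "FDom T = A \<Longrightarrow> comp_functor V T (id_functor V A) = T"
  using assms by (auto intro!: V_functor_eqI)

lemma comp_functor_assoc:
  assumes "V_functor V R" "V_functor V Q" "V_functor V T" "FDom R = FCod Q" "FDom Q = FCod T"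
  shows "comp_functor V (comp_functor V R Q) T = comp_functor V R (comp_functor V Q T)"
  by (rule V_functor_eqI) (use assms in \<open>simp_all add: Cmp_assoc'\<close>)

lemma id_trans_sel [simp]:
  "NSrc (id_trans Q) = Q" "NTrg (id_trans Q) = Q"
  "b \<in> VOb (FDom Q) \<Longrightarrow> NAt (id_trans Q) b = VId (FCod Q) (FOb Q b)"
  by (simp_all add: id_trans_def)

lemma vert_comp_sel [simp]:
  "NSrc (vert_comp V \<gamma> \<beta>) = NSrc \<beta>" "NTrg (vert_comp V \<gamma> \<beta>) = NTrg \<gamma>"
  "a \<in> VOb (FDom (NSrc \<beta>)) \<Longrightarrow> NAt (vert_comp V \<gamma> \<beta>) a =
    elt_comp (FCod (NSrc \<beta>)) (FOb (NSrc \<beta>) a) (FOb (NTrg \<beta>) a) (FOb (NTrg \<gamma>) a) (NAt \<gamma> a) (NAt \<beta> a)"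
  by (simp_all add: vert_comp_def elt_comp_def)

lemma whisker_left_sel [simp]:
  "NSrc (whisker_left V Q \<beta>) = comp_functor V Q (NSrc \<beta>)"
  "NTrg (whisker_left V Q \<beta>) = comp_functor V Q (NTrg \<beta>)"
  "a \<in> VOb (FDom (NSrc \<beta>)) \<Longrightarrow>
    NAt (whisker_left V Q \<beta>) a = FHom Q (FOb (NSrc \<beta>) a) (FOb (NTrg \<beta>) a) \<cdot> NAt \<beta> a"
  by (simp_all add: whisker_left_def)

lemma whisker_right_sel [simp]:
  "NSrc (whisker_right V \<beta> P) = comp_functor V (NSrc \<beta>) P"
  "NTrg (whisker_right V \<beta> P) = comp_functor V (NTrg \<beta>) P"
  "d \<in> VOb (FDom P) \<Longrightarrow> NAt (whisker_right V \<beta> P) d = NAt \<beta> (FOb P d)"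
  by (simp_all add: whisker_right_def)

lemma V_trans_id [simp]: "V_functor V Q \<Longrightarrow> V_trans V (id_trans Q)"
  by (rule V_transI) (simp_all add: id_trans_def homI)

text \<open>The naturality squares of \<beta> and \<gamma> are pasted along their common functor.
  This takes three reassociations, whose associators have two units and one hom-object as arguments,
  with the hom-object in third, second and first place in turn. These are the three cases of
  \<open>asc_VHom\<close>.\<close>

lemma V_trans_vert_comp [simp]:
  assumes "V_trans V \<gamma>" "V_trans V \<beta>" "NTrg \<beta> = NSrc \<gamma>"
  shows "V_trans V (vert_comp V \<gamma> \<beta>)"
proof (rule V_transI)
  show dom: "FDom (NTrg (vert_comp V \<gamma> \<beta>)) = FDom (NSrc (vert_comp V \<gamma> \<beta>))"
    "FCod (NTrg (vert_comp V \<gamma> \<beta>)) = FCod (NSrc (vert_comp V \<gamma> \<beta>))"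
    using V_trans_functor(3,4)[OF assms(1)] V_trans_functor(3,4)[OF assms(2)] assms(3) by simp_all
  have g: "FDom (NSrc \<gamma>) = FDom (NSrc \<beta>)" "FCod (NSrc \<gamma>) = FCod (NSrc \<beta>)"
    using V_trans_functor(3,4)[OF assms(2)] assms(3) by simp_all
  note [simp] = assms g
  show "NAt (vert_comp V \<gamma> \<beta>) \<in> (\<Pi>\<^sub>E a \<in> VOb (FDom (NSrc (vert_comp V \<gamma> \<beta>))).
      hom V \<I> (VHom (FCod (NSrc (vert_comp V \<gamma> \<beta>))) (FOb (NSrc (vert_comp V \<gamma> \<beta>)) a)
        (FOb (NTrg (vert_comp V \<gamma> \<beta>)) a)))"
    by (simp add: vert_comp_def homI)
  fix a b
  assume "a \<in> VOb (FDom (NSrc (vert_comp V \<gamma> \<beta>)))" "b \<in> VOb (FDom (NSrc (vert_comp V \<gamma> \<beta>)))"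
  then have [simp]: "a \<in> VOb (FDom (NSrc \<beta>))" "b \<in> VOb (FDom (NSrc \<beta>))"
    by simp_all
  let ?T = "NSrc \<beta>" and ?S = "NSrc \<gamma>" and ?R = "NTrg \<gamma>"
  let ?B = "FCod (NSrc \<beta>)"
  let ?c = "elt_comp ?B"
  have "?c (FOb ?T a) (FOb ?T b) (FOb ?R b)
        (?c (FOb ?T b) (FOb ?S b) (FOb ?R b) (NAt \<gamma> b) (NAt \<beta> b)) (FHom ?T a b) =
      ?c (FOb ?T a) (FOb ?S b) (FOb ?R b) (NAt \<gamma> b)
        (?c (FOb ?T a) (FOb ?T b) (FOb ?S b) (NAt \<beta> b) (FHom ?T a b))"
    by (subst elt_comp_assoc) simp_all
  also have "\<dots> = ?c (FOb ?T a) (FOb ?S b) (FOb ?R b) (NAt \<gamma> b)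
        (?c (FOb ?T a) (FOb ?S a) (FOb ?S b) (FHom ?S a b) (NAt \<beta> a))"
    using V_trans_natural[of \<beta> a b] by simp
  also have "\<dots> = ?c (FOb ?T a) (FOb ?S a) (FOb ?R b)
        (?c (FOb ?S a) (FOb ?S b) (FOb ?R b) (NAt \<gamma> b) (FHom ?S a b)) (NAt \<beta> a)"
    by (subst elt_comp_assoc) simp_all
  also have "\<dots> = ?c (FOb ?T a) (FOb ?S a) (FOb ?R b)
        (?c (FOb ?S a) (FOb ?R a) (FOb ?R b) (FHom ?R a b) (NAt \<gamma> a)) (NAt \<beta> a)"
    using V_trans_natural[of \<gamma> a b] by simp
  also have "\<dots> = ?c (FOb ?T a) (FOb ?R a) (FOb ?R b) (FHom ?R a b)
        (?c (FOb ?T a) (FOb ?S a) (FOb ?R a) (NAt \<gamma> a) (NAt \<beta> a))"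
    by (subst elt_comp_assoc) simp_all
  finally show "elt_comp (FCod (NSrc (vert_comp V \<gamma> \<beta>))) (FOb (NSrc (vert_comp V \<gamma> \<beta>)) a)
        (FOb (NSrc (vert_comp V \<gamma> \<beta>)) b) (FOb (NTrg (vert_comp V \<gamma> \<beta>)) b)
        (NAt (vert_comp V \<gamma> \<beta>) b) (FHom (NSrc (vert_comp V \<gamma> \<beta>)) a b) =
      elt_comp (FCod (NSrc (vert_comp V \<gamma> \<beta>))) (FOb (NSrc (vert_comp V \<gamma> \<beta>)) a)
        (FOb (NTrg (vert_comp V \<gamma> \<beta>)) a) (FOb (NTrg (vert_comp V \<gamma> \<beta>)) b)
        (FHom (NTrg (vert_comp V \<gamma> \<beta>)) a b) (NAt (vert_comp V \<gamma> \<beta>) a)"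
    by simp
qed (use assms in simp_all)

text \<open>Apply Q to the naturality equation of \<beta>; Q preserves composites of
  elements.\<close>

lemma V_trans_whisker_left [simp]:
  assumes "V_functor V Q" "V_trans V \<beta>" "FDom Q = FCod (NSrc \<beta>)"
  shows "V_trans V (whisker_left V Q \<beta>)"
proof (rule V_transI)
  note [simp] = assms
  show "NAt (whisker_left V Q \<beta>) \<in> (\<Pi>\<^sub>E a \<in> VOb (FDom (NSrc (whisker_left V Q \<beta>))).
      hom V \<I> (VHom (FCod (NSrc (whisker_left V Q \<beta>))) (FOb (NSrc (whisker_left V Q \<beta>)) a)
        (FOb (NTrg (whisker_left V Q \<beta>)) a)))"
    by (simp add: whisker_left_def homI)
  fix a b
  assume "a \<in> VOb (FDom (NSrc (whisker_left V Q \<beta>)))" "b \<in> VOb (FDom (NSrc (whisker_left V Q \<beta>)))"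
  then have [simp]: "a \<in> VOb (FDom (NSrc \<beta>))" "b \<in> VOb (FDom (NSrc \<beta>))"
    by simp_all
  show "elt_comp (FCod (NSrc (whisker_left V Q \<beta>))) (FOb (NSrc (whisker_left V Q \<beta>)) a)
        (FOb (NSrc (whisker_left V Q \<beta>)) b) (FOb (NTrg (whisker_left V Q \<beta>)) b)
        (NAt (whisker_left V Q \<beta>) b) (FHom (NSrc (whisker_left V Q \<beta>)) a b) =
      elt_comp (FCod (NSrc (whisker_left V Q \<beta>))) (FOb (NSrc (whisker_left V Q \<beta>)) a)
        (FOb (NTrg (whisker_left V Q \<beta>)) a) (FOb (NTrg (whisker_left V Q \<beta>)) b)
        (FHom (NTrg (whisker_left V Q \<beta>)) a b) (NAt (whisker_left V Q \<beta>) a)"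
    using V_functor_elt_comp[of Q "FOb (NSrc \<beta>) a" "FOb (NSrc \<beta>) b" "FOb (NTrg \<beta>) b"
        "FHom (NSrc \<beta>) a b" "NAt \<beta> b"]
      V_functor_elt_comp[of Q "FOb (NSrc \<beta>) a" "FOb (NTrg \<beta>) a" "FOb (NTrg \<beta>) b"
        "NAt \<beta> a" "FHom (NTrg \<beta>) a b"]
      V_trans_natural[of \<beta> a b]
    by simp
qed (use assms in simp_all)

text \<open>Naturality of \<beta> evaluated at the elements given by the hom-morphisms of P.\<close>

lemma V_trans_whisker_right [simp]:
  assumes "V_functor V P" "V_trans V \<beta>" "FCod P = FDom (NSrc \<beta>)"
  shows "V_trans V (whisker_right V \<beta> P)"
proof (rule V_transI)
  note [simp] = assms
  show "NAt (whisker_right V \<beta> P) \<in> (\<Pi>\<^sub>E a \<in> VOb (FDom (NSrc (whisker_right V \<beta> P))).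
      hom V \<I> (VHom (FCod (NSrc (whisker_right V \<beta> P))) (FOb (NSrc (whisker_right V \<beta> P)) a)
        (FOb (NTrg (whisker_right V \<beta> P)) a)))"
    by (simp add: whisker_right_def homI)
  fix a b
  assume "a \<in> VOb (FDom (NSrc (whisker_right V \<beta> P)))" "b \<in> VOb (FDom (NSrc (whisker_right V \<beta> P)))"
  then have [simp]: "a \<in> VOb (FDom P)" "b \<in> VOb (FDom P)"
    by simp_all
  show "elt_comp (FCod (NSrc (whisker_right V \<beta> P))) (FOb (NSrc (whisker_right V \<beta> P)) a)
        (FOb (NSrc (whisker_right V \<beta> P)) b) (FOb (NTrg (whisker_right V \<beta> P)) b)
        (NAt (whisker_right V \<beta> P) b) (FHom (NSrc (whisker_right V \<beta> P)) a b) =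
      elt_comp (FCod (NSrc (whisker_right V \<beta> P))) (FOb (NSrc (whisker_right V \<beta> P)) a)
        (FOb (NTrg (whisker_right V \<beta> P)) a) (FOb (NTrg (whisker_right V \<beta> P)) b)
        (FHom (NTrg (whisker_right V \<beta> P)) a b) (NAt (whisker_right V \<beta> P) a)"
    using V_trans_natural_Cmp[of \<beta> "FOb P a" "FOb P b" "FHom P a b"] by simp
qed (use assms in simp_all)


lemma vert_comp_id [simp]:
  assumes "V_trans V \<beta>"
  shows "NTrg \<beta> = S \<Longrightarrow> vert_comp V (id_trans S) \<beta> = \<beta>"
    and "NSrc \<beta> = T \<Longrightarrow> vert_comp V \<beta> (id_trans T) = \<beta>"
  using assms by (auto intro!: V_trans_eqI)

lemma vert_comp_assoc:
  assumes "V_trans V \<beta>" "V_trans V \<gamma>" "V_trans V \<delta>" "NSrc \<gamma> = NTrg \<beta>" "NSrc \<delta> = NTrg \<gamma>"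
  shows "vert_comp V (vert_comp V \<delta> \<gamma>) \<beta> = vert_comp V \<delta> (vert_comp V \<gamma> \<beta>)"
proof (rule V_trans_eqI)
  note [simp] = assms V_trans_functor(3,4)[OF assms(1)] V_trans_functor(3,4)[OF assms(2), unfolded assms(4)]
    V_trans_functor(3,4)[OF assms(3), unfolded assms(5)]
  show "V_trans V (vert_comp V (vert_comp V \<delta> \<gamma>) \<beta>)" "V_trans V (vert_comp V \<delta> (vert_comp V \<gamma> \<beta>))"
    "NSrc (vert_comp V (vert_comp V \<delta> \<gamma>) \<beta>) = NSrc (vert_comp V \<delta> (vert_comp V \<gamma> \<beta>))"
    "NTrg (vert_comp V (vert_comp V \<delta> \<gamma>) \<beta>) = NTrg (vert_comp V \<delta> (vert_comp V \<gamma> \<beta>))"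
    by simp_all
  fix a
  assume "a \<in> VOb (FDom (NSrc (vert_comp V \<delta> (vert_comp V \<gamma> \<beta>))))"
  then show "NAt (vert_comp V (vert_comp V \<delta> \<gamma>) \<beta>) a = NAt (vert_comp V \<delta> (vert_comp V \<gamma> \<beta>)) a"
    by (simp add: elt_comp_assoc_elements)
qed

lemma horiz_comp_sel [simp]:
  "NSrc (horiz_comp V \<gamma> \<beta>) = comp_functor V (NSrc \<gamma>) (NSrc \<beta>)"
  "NTrg (horiz_comp V \<gamma> \<beta>) = comp_functor V (NTrg \<gamma>) (NTrg \<beta>)"
  "\<lbrakk>V_trans V \<beta>; a \<in> VOb (FDom (NSrc \<beta>))\<rbrakk> \<Longrightarrow> NAt (horiz_comp V \<gamma> \<beta>) a =
    elt_comp (FCod (NSrc \<gamma>)) (FOb (NSrc \<gamma>) (FOb (NSrc \<beta>) a)) (FOb (NSrc \<gamma>) (FOb (NTrg \<beta>) a))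
      (FOb (NTrg \<gamma>) (FOb (NTrg \<beta>) a)) (NAt \<gamma> (FOb (NTrg \<beta>) a))
      (FHom (NSrc \<gamma>) (FOb (NSrc \<beta>) a) (FOb (NTrg \<beta>) a) \<cdot> NAt \<beta> a)"
  by (simp_all add: horiz_comp_def)

lemma V_trans_horiz_comp [simp]:
  assumes "V_trans V \<gamma>" "V_trans V \<beta>" "FDom (NSrc \<gamma>) = FCod (NSrc \<beta>)"
  shows "V_trans V (horiz_comp V \<gamma> \<beta>)"
  using assms unfolding horiz_comp_def by (intro V_trans_vert_comp) simp_all

text \<open>Horizontal composition with an identity transformation reduces to whiskering. Later
  proofs switch off the general formula \<open>horiz_comp_sel(3)\<close> and compute with this rule
  and its mirror image.\<close>

lemma horiz_comp_id_left [simp]: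
  assumes "V_trans V \<beta>" "V_functor V Q" "FDom Q = FCod (NSrc \<beta>)"
    and "a \<in> VOb (FDom (NSrc \<beta>))"
  shows "NAt (horiz_comp V (id_trans Q) \<beta>) a = FHom Q (FOb (NSrc \<beta>) a) (FOb (NTrg \<beta>) a) \<cdot> NAt \<beta> a"
  using assms by simp

lemma horiz_comp_id_right [simp]:
  assumes "V_trans V \<beta>" "V_functor V P" "FDom (NSrc \<beta>) = FCod P" "a \<in> VOb (FDom P)"
  shows "NAt (horiz_comp V \<beta> (id_trans P)) a = NAt \<beta> (FOb P a)"
  using assms V_functor_VId[of "NSrc \<beta>" "FOb P a"] by simp

lemma horiz_comp_id_functor [simp]:
  assumes "V_trans V \<beta>"
  shows "FCod (NSrc \<beta>) = B \<Longrightarrow> horiz_comp V (id_trans (id_functor V B)) \<beta> = \<beta>"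
    and "FDom (NSrc \<beta>) = A \<Longrightarrow> horiz_comp V \<beta> (id_trans (id_functor V A)) = \<beta>"
  using assms by (auto intro!: V_trans_eqI simp del: horiz_comp_sel(3))

lemma horiz_comp_id_trans:
  assumes "V_functor V Q" "V_functor V T" "FCod T = FDom Q"
  shows "horiz_comp V (id_trans Q) (id_trans T) = id_trans (comp_functor V Q T)"
  by (rule V_trans_eqI) (use assms in \<open>simp_all add: V_functor_VId\<close>)

text \<open>The functor \<open>NSrc \<delta>\<close> distributes over the composite inside, and what
  remains is a reassociation of elements with domain \<I>.\<close>

lemma horiz_comp_assoc:
  assumes "V_trans V \<beta>" "V_trans V \<gamma>" "V_trans V \<delta>"
    and "FDom (NSrc \<gamma>) = FCod (NSrc \<beta>)" "FDom (NSrc \<delta>) = FCod (NSrc \<gamma>)"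
  shows "horiz_comp V (horiz_comp V \<delta> \<gamma>) \<beta> = horiz_comp V \<delta> (horiz_comp V \<gamma> \<beta>)"
proof (rule V_trans_eqI)
  note [simp] = assms
  show "V_trans V (horiz_comp V (horiz_comp V \<delta> \<gamma>) \<beta>)" "V_trans V (horiz_comp V \<delta> (horiz_comp V \<gamma> \<beta>))"
    "NSrc (horiz_comp V (horiz_comp V \<delta> \<gamma>) \<beta>) = NSrc (horiz_comp V \<delta> (horiz_comp V \<gamma> \<beta>))"
    "NTrg (horiz_comp V (horiz_comp V \<delta> \<gamma>) \<beta>) = NTrg (horiz_comp V \<delta> (horiz_comp V \<gamma> \<beta>))"
    by (simp_all add: comp_functor_assoc)
  fix a
  assume "a \<in> VOb (FDom (NSrc (horiz_comp V \<delta> (horiz_comp V \<gamma> \<beta>))))"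
  then have [simp]: "a \<in> VOb (FDom (NSrc \<beta>))"
    by simp
  let ?T = "NSrc \<beta>" and ?S = "NTrg \<beta>" and ?Q = "NSrc \<gamma>" and ?R = "NTrg \<gamma>" and ?P = "NSrc \<delta>"
  show "NAt (horiz_comp V (horiz_comp V \<delta> \<gamma>) \<beta>) a = NAt (horiz_comp V \<delta> (horiz_comp V \<gamma> \<beta>)) a"
    using V_functor_elt_comp[of ?P "FOb ?Q (FOb ?T a)" "FOb ?Q (FOb ?S a)" "FOb ?R (FOb ?S a)"
        "FHom ?Q (FOb ?T a) (FOb ?S a) \<cdot> NAt \<beta> a" "NAt \<gamma> (FOb ?S a)"]
    by (simp add: elt_comp_assoc_elements Cmp_assoc')
qed

text \<open>On components both sides are composites of four elements with domain \<I>. They differ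
  in the order of the two middle ones, which naturality of \<tau> exchanges.\<close>

lemma horiz_vert_interchange:
  assumes "V_trans V \<sigma>" "V_trans V \<sigma>'" "V_trans V \<tau>" "V_trans V \<tau>'"
    and "NTrg \<sigma> = NSrc \<sigma>'" "NTrg \<tau> = NSrc \<tau>'" "FDom (NSrc \<tau>) = FCod (NSrc \<sigma>)"
  shows "horiz_comp V (vert_comp V \<tau>' \<tau>) (vert_comp V \<sigma>' \<sigma>) =
    vert_comp V (horiz_comp V \<tau>' \<sigma>') (horiz_comp V \<tau> \<sigma>)"
proof (rule V_trans_eqI)
  note [simp] = assms V_trans_functor(3,4)[OF assms(1), unfolded assms(5)]
    V_trans_functor(3,4)[OF assms(3), unfolded assms(6)]
  show "V_trans V (horiz_comp V (vert_comp V \<tau>' \<tau>) (vert_comp V \<sigma>' \<sigma>))"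
    "V_trans V (vert_comp V (horiz_comp V \<tau>' \<sigma>') (horiz_comp V \<tau> \<sigma>))"
    "NSrc (horiz_comp V (vert_comp V \<tau>' \<tau>) (vert_comp V \<sigma>' \<sigma>)) =
      NSrc (vert_comp V (horiz_comp V \<tau>' \<sigma>') (horiz_comp V \<tau> \<sigma>))"
    "NTrg (horiz_comp V (vert_comp V \<tau>' \<tau>) (vert_comp V \<sigma>' \<sigma>)) =
      NTrg (vert_comp V (horiz_comp V \<tau>' \<sigma>') (horiz_comp V \<tau> \<sigma>))"
    by simp_all
  fix a
  assume "a \<in> VOb (FDom (NSrc (vert_comp V (horiz_comp V \<tau>' \<sigma>') (horiz_comp V \<tau> \<sigma>))))"
  then have [simp]: "a \<in> VOb (FDom (NSrc \<sigma>))"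
    by simp
  let ?x = "FOb (NSrc \<sigma>) a" and ?y = "FOb (NSrc \<sigma>') a" and ?z = "FOb (NTrg \<sigma>') a"
  let ?Q = "NSrc \<tau>" and ?R = "NSrc \<tau>'" and ?P = "NTrg \<tau>'"
  let ?c = "elt_comp (FCod ?Q)"
  have Q: "FHom ?Q ?x ?z \<cdot> elt_comp (FCod (NSrc \<sigma>)) ?x ?y ?z (NAt \<sigma>' a) (NAt \<sigma> a) =
      ?c (FOb ?Q ?x) (FOb ?Q ?y) (FOb ?Q ?z) (FHom ?Q ?y ?z \<cdot> NAt \<sigma>' a) (FHom ?Q ?x ?y \<cdot> NAt \<sigma> a)"
    using V_functor_elt_comp[of ?Q ?x ?y ?z "NAt \<sigma> a" "NAt \<sigma>' a"] by simp
  have "?c (FOb ?Q ?x) (FOb ?Q ?z) (FOb ?R ?z) (NAt \<tau> ?z)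
        (?c (FOb ?Q ?x) (FOb ?Q ?y) (FOb ?Q ?z) (FHom ?Q ?y ?z \<cdot> NAt \<sigma>' a) (FHom ?Q ?x ?y \<cdot> NAt \<sigma> a)) =
      ?c (FOb ?Q ?x) (FOb ?Q ?y) (FOb ?R ?z)
        (?c (FOb ?Q ?y) (FOb ?Q ?z) (FOb ?R ?z) (NAt \<tau> ?z) (FHom ?Q ?y ?z \<cdot> NAt \<sigma>' a))
        (FHom ?Q ?x ?y \<cdot> NAt \<sigma> a)"
    by (subst elt_comp_assoc_elements) simp_all
  \<comment> \<open>This is the exchange itself: the square of \<tau> evaluated at the component of
    \<sigma>'.\<close>
  also have "?c (FOb ?Q ?y) (FOb ?Q ?z) (FOb ?R ?z) (NAt \<tau> ?z) (FHom ?Q ?y ?z \<cdot> NAt \<sigma>' a) =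
      ?c (FOb ?Q ?y) (FOb ?R ?y) (FOb ?R ?z) (FHom ?R ?y ?z \<cdot> NAt \<sigma>' a) (NAt \<tau> ?y)"
    using V_trans_natural_Cmp[of \<tau> ?y ?z "NAt \<sigma>' a"] by simp
  finally have "?c (FOb ?Q ?x) (FOb ?Q ?z) (FOb ?R ?z) (NAt \<tau> ?z)
        (?c (FOb ?Q ?x) (FOb ?Q ?y) (FOb ?Q ?z) (FHom ?Q ?y ?z \<cdot> NAt \<sigma>' a) (FHom ?Q ?x ?y \<cdot> NAt \<sigma> a)) =
      ?c (FOb ?Q ?x) (FOb ?R ?y) (FOb ?R ?z) (FHom ?R ?y ?z \<cdot> NAt \<sigma>' a)
        (?c (FOb ?Q ?x) (FOb ?Q ?y) (FOb ?R ?y) (NAt \<tau> ?y) (FHom ?Q ?x ?y \<cdot> NAt \<sigma> a))"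
    by (simp add: elt_comp_assoc_elements)
  then show "NAt (horiz_comp V (vert_comp V \<tau>' \<tau>) (vert_comp V \<sigma>' \<sigma>)) a =
      NAt (vert_comp V (horiz_comp V \<tau>' \<sigma>') (horiz_comp V \<tau> \<sigma>)) a"
    by (simp add: elt_comp_assoc_elements Q)
qed

abbreviation VCAT :: "(('u nest, 'o, 'm) vcategory, ('u nest, 'o, 'm) vfunctor,
    ('u nest, 'o, 'm) vtrans) mon2cat" where
  "VCAT \<equiv> VCat V"

lemma category_cat1_VCat: "category (cat1 VCAT)"
proof (rule category.intro)
  fix f g h :: "('u nest, 'o, 'm) vfunctor" and a b c d
  assume "f \<in> hom (cat1 VCAT) a b" "g \<in> hom (cat1 VCAT) b c" "h \<in> hom (cat1 VCAT) c d"
  then show "Cmp (cat1 VCAT) h (Cmp (cat1 VCAT) g f) = Cmp (cat1 VCAT) (Cmp (cat1 VCAT) h g) f"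
    by (auto simp: cat1_def VCat_def hom_def comp_functor_assoc)
qed (auto simp: cat1_def VCat_def hom_def)

lemma category_vcat_VCat: "category (vcat VCAT)"
proof (rule category.intro)
  fix f g h :: "('u nest, 'o, 'm) vtrans" and a b c d
  assume "f \<in> hom (vcat VCAT) a b" "g \<in> hom (vcat VCAT) b c" "h \<in> hom (vcat VCAT) c d"
  then show "Cmp (vcat VCAT) h (Cmp (vcat VCAT) g f) = Cmp (vcat VCAT) (Cmp (vcat VCAT) h g) f"
    by (auto simp: vcat_def VCat_def hom_def vert_comp_assoc)
qed (auto simp: vcat_def VCat_def hom_def)

lemma category_hcat_VCat: "category (hcat VCAT)"
proof (rule category.intro)
  fix f g h :: "('u nest, 'o, 'm) vtrans" and a b c d
  assume "f \<in> hom (hcat VCAT) a b" "g \<in> hom (hcat VCAT) b c" "h \<in> hom (hcat VCAT) c d"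
  then show "Cmp (hcat VCAT) h (Cmp (hcat VCAT) g f) = Cmp (hcat VCAT) (Cmp (hcat VCAT) h g) f"
    by (auto simp: hcat_def VCat_def hom_def horiz_comp_assoc)
qed (auto simp: hcat_def VCat_def hom_def)

lemma two_category_VCat: "two_category VCAT"
proof (rule two_category.intro)
  fix \<sigma> \<sigma>' \<tau> \<tau>' :: "('u nest, 'o, 'm) vtrans"
  assume "\<sigma> \<in> Cel VCAT" "\<sigma>' \<in> Cel VCAT" "\<tau> \<in> Cel VCAT" "\<tau>' \<in> Cel VCAT"
    "trg2 VCAT \<sigma> = src2 VCAT \<sigma>'" "trg2 VCAT \<tau> = src2 VCAT \<tau>'"
    "trg1 VCAT (src2 VCAT \<sigma>) = src1 VCAT (src2 VCAT \<tau>)"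
  then show "hcmp VCAT (vcmp VCAT \<tau>' \<tau>) (vcmp VCAT \<sigma>' \<sigma>) =
      vcmp VCAT (hcmp VCAT \<tau>' \<sigma>') (hcmp VCAT \<tau> \<sigma>)"
    by (simp add: VCat_def horiz_vert_interchange)
qed (simp_all add: category_cat1_VCat category_vcat_VCat category_hcat_VCat,
    simp_all add: VCat_def horiz_comp_id_trans)

section \<open>Tensor products of enriched categories\<close>

lemma tensor_vcat_sel [simp]:
  "VOb (tensor_vcat V i A B) = pairs (VOb A) (VOb B)"
  "\<lbrakk>a \<in> VOb A; b \<in> VOb B; a' \<in> VOb A; b' \<in> VOb B\<rbrakk> \<Longrightarrow>
    VHom (tensor_vcat V i A B) (NPair a b) (NPair a' b') = VHom A a a' \<otimes>\<^bsub>i + 1\<^esub> VHom B b b'"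
  "\<lbrakk>a \<in> VOb A; b \<in> VOb B; a' \<in> VOb A; b' \<in> VOb B; a'' \<in> VOb A; b'' \<in> VOb B\<rbrakk> \<Longrightarrow>
    VCmp (tensor_vcat V i A B) (NPair a b) (NPair a' b') (NPair a'' b'') =
      (VCmp A a a' a'' \<odot>\<^bsub>i + 1\<^esub> VCmp B b b' b'')
      \<cdot> \<eta> 1 (i + 1) (VHom A a' a'') (VHom B b' b'') (VHom A a a') (VHom B b b')"
  "\<lbrakk>a \<in> VOb A; b \<in> VOb B\<rbrakk> \<Longrightarrow> VId (tensor_vcat V i A B) (NPair a b) = VId A a \<odot>\<^bsub>i + 1\<^esub> VId B b"
  by (simp_all add: tensor_vcat_def Let_def)

text \<open>Composition in a product is componentwise up to one interchanger at the four domains.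
  For unit laws and naturality one of the pairs g, g' and f, f' starts at \<I>, and the internal
  unit condition removes the interchanger.\<close>

lemma tensor_elt_comp:
  assumes "1 \<le> i" "i < n" "V_category V A" "V_category V B"
    and "a \<in> VOb A" "b \<in> VOb A" "c \<in> VOb A" "a' \<in> VOb B" "b' \<in> VOb B" "c' \<in> VOb B"
    and "f \<in> Mor V" "g \<in> Mor V" "f' \<in> Mor V" "g' \<in> Mor V"
    and "Trg V f = VHom A a b" "Trg V g = VHom A b c" "Trg V f' = VHom B a' b'" "Trg V g' = VHom B b' c'"
  shows "elt_comp (tensor_vcat V i A B) (NPair a a') (NPair b b') (NPair c c')
      (g \<odot>\<^bsub>i + 1\<^esub> g') (f \<odot>\<^bsub>i + 1\<^esub> f') =
    (elt_comp A a b c g f \<odot>\<^bsub>i + 1\<^esub> elt_comp B a' b' c' g' f')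
      \<cdot> \<eta> 1 (i + 1) (Src V g) (Src V g') (Src V f) (Src V f')"
  using eta_tenM_absorb[of 1 "i + 1" f f' g g' "VCmp A a b c" "VCmp B a' b' c'"] assms
  by (simp add: elt_comp_def)

lemma V_category_tensor_assoc:
  assumes "1 \<le> i" "i < n" "V_category V A" "V_category V B"
    and "a \<in> VOb A" "b \<in> VOb A" "c \<in> VOb A" "d \<in> VOb A"
    and "a' \<in> VOb B" "b' \<in> VOb B" "c' \<in> VOb B" "d' \<in> VOb B"
  defines "T \<equiv> tensor_vcat V i A B"
    and "w \<equiv> NPair a a'" and "x \<equiv> NPair b b'" and "y \<equiv> NPair c c'" and "z \<equiv> NPair d d'"
  shows "VCmp T w x z \<cdot> (VCmp T x y z \<odot>\<^bsub>1\<^esub> \<one> (VHom T w x)) =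
    VCmp T w y z \<cdot> (\<one> (VHom T y z) \<odot>\<^bsub>1\<^esub> VCmp T w x y) \<cdot> \<alpha> 1 (VHom T y z) (VHom T x y) (VHom T w x)"
proof -
  note [simp] = assms(3-12)
  \<comment> \<open>The axioms are used for the index pair 1, i + 1; the condition 1 < i + 1
    simplifies to 0 < i.\<close>
  have [simp]: "0 < i" "i + 1 \<le> n"
    using assms(1,2) by simp_all
  let ?j = "i + 1"
  let ?P = "VHom A c d" and ?P' = "VHom B c' d'" and ?Q = "VHom A b c" and ?Q' = "VHom B b' c'"
    and ?R = "VHom A a b" and ?R' = "VHom B a' b'"
  let ?\<alpha> = "\<alpha> 1 ?P ?Q ?R" and ?\<alpha>' = "\<alpha> 1 ?P' ?Q' ?R'"
  \<comment> \<open>The right-bracketed triple compositions in the two factors. They stay outermost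
    throughout, while the interchangers to their right are rearranged.\<close>
  let ?u = "VCmp A a c d \<cdot> (\<one> ?P \<odot>\<^bsub>1\<^esub> VCmp A a b c)"
    and ?u' = "VCmp B a' c' d' \<cdot> (\<one> ?P' \<odot>\<^bsub>1\<^esub> VCmp B a' b' c')"
  have u: "VCmp A a b d \<cdot> (VCmp A b c d \<odot>\<^bsub>1\<^esub> \<one> ?R) = ?u \<cdot> ?\<alpha>"
    "VCmp B a' b' d' \<cdot> (VCmp B b' c' d' \<odot>\<^bsub>1\<^esub> \<one> ?R') = ?u' \<cdot> ?\<alpha>'"
    using V_category_assoc[of A a b c d] V_category_assoc[of B a' b' c' d'] by (simp_all add: Cmp_assoc')
  have "VCmp T w x z \<cdot> (VCmp T x y z \<odot>\<^bsub>1\<^esub> \<one> (VHom T w x)) =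
      (VCmp T w x z \<cdot> ((VCmp A b c d \<odot>\<^bsub>?j\<^esub> VCmp B b' c' d') \<odot>\<^bsub>1\<^esub> (\<one> ?R \<odot>\<^bsub>?j\<^esub> \<one> ?R')))
      \<cdot> (\<eta> 1 ?j ?P ?P' ?Q ?Q' \<odot>\<^bsub>1\<^esub> \<one> (?R \<otimes>\<^bsub>?j\<^esub> ?R'))"
    by (simp add: T_def w_def x_def y_def z_def tenM_Cmp_Idt_right Cmp_assoc')
  \<comment> \<open>The inner compositions are absorbed into the outer one. Associativity in each
    factor then turns the left bracketing into the right one at the price of an associator.\<close>
  also have "VCmp T w x z \<cdot> ((VCmp A b c d \<odot>\<^bsub>?j\<^esub> VCmp B b' c' d') \<odot>\<^bsub>1\<^esub> (\<one> ?R \<odot>\<^bsub>?j\<^esub> \<one> ?R')) =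
      ((?u \<cdot> ?\<alpha>) \<odot>\<^bsub>?j\<^esub> (?u' \<cdot> ?\<alpha>')) \<cdot> \<eta> 1 ?j (?P \<otimes>\<^bsub>1\<^esub> ?Q) (?P' \<otimes>\<^bsub>1\<^esub> ?Q') ?R ?R'"
    using eta_tenM_absorb[of 1 ?j "\<one> ?R" "\<one> ?R'" "VCmp A b c d" "VCmp B b' c' d'"
        "VCmp A a b d" "VCmp B a' b' d'"]
    by (simp add: T_def w_def x_def y_def z_def u del: tenM_Idt)
  also have "(?u \<cdot> ?\<alpha>) \<odot>\<^bsub>?j\<^esub> (?u' \<cdot> ?\<alpha>') = (?u \<odot>\<^bsub>?j\<^esub> ?u') \<cdot> (?\<alpha> \<odot>\<^bsub>?j\<^esub> ?\<alpha>')"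
    by (simp add: tenM_Cmp)
  also have "(((?u \<odot>\<^bsub>?j\<^esub> ?u') \<cdot> (?\<alpha> \<odot>\<^bsub>?j\<^esub> ?\<alpha>')) \<cdot> \<eta> 1 ?j (?P \<otimes>\<^bsub>1\<^esub> ?Q) (?P' \<otimes>\<^bsub>1\<^esub> ?Q') ?R ?R')
      \<cdot> (\<eta> 1 ?j ?P ?P' ?Q ?Q' \<odot>\<^bsub>1\<^esub> \<one> (?R \<otimes>\<^bsub>?j\<^esub> ?R')) =
      (?u \<odot>\<^bsub>?j\<^esub> ?u') \<cdot> (?\<alpha> \<odot>\<^bsub>?j\<^esub> ?\<alpha>') \<cdot> \<eta> 1 ?j (?P \<otimes>\<^bsub>1\<^esub> ?Q) (?P' \<otimes>\<^bsub>1\<^esub> ?Q') ?R ?R'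
      \<cdot> (\<eta> 1 ?j ?P ?P' ?Q ?Q' \<odot>\<^bsub>1\<^esub> \<one> (?R \<otimes>\<^bsub>?j\<^esub> ?R'))"
    by (simp add: Cmp_assoc')
  \<comment> \<open>Internal associativity trades the product of the two associators for a single
    associator at the hom-objects of the product.\<close>
  also have "(?\<alpha> \<odot>\<^bsub>?j\<^esub> ?\<alpha>') \<cdot> \<eta> 1 ?j (?P \<otimes>\<^bsub>1\<^esub> ?Q) (?P' \<otimes>\<^bsub>1\<^esub> ?Q') ?R ?R'
      \<cdot> (\<eta> 1 ?j ?P ?P' ?Q ?Q' \<odot>\<^bsub>1\<^esub> \<one> (?R \<otimes>\<^bsub>?j\<^esub> ?R')) =
      \<eta> 1 ?j ?P ?P' (?Q \<otimes>\<^bsub>1\<^esub> ?R) (?Q' \<otimes>\<^bsub>1\<^esub> ?R')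
      \<cdot> (\<one> (?P \<otimes>\<^bsub>?j\<^esub> ?P') \<odot>\<^bsub>1\<^esub> \<eta> 1 ?j ?Q ?Q' ?R ?R')
      \<cdot> \<alpha> 1 (?P \<otimes>\<^bsub>?j\<^esub> ?P') (?Q \<otimes>\<^bsub>?j\<^esub> ?Q') (?R \<otimes>\<^bsub>?j\<^esub> ?R')"
    by (rule internal_associativity[symmetric]) simp_all
  also have "(?u \<odot>\<^bsub>?j\<^esub> ?u') \<cdot> \<eta> 1 ?j ?P ?P' (?Q \<otimes>\<^bsub>1\<^esub> ?R) (?Q' \<otimes>\<^bsub>1\<^esub> ?R')
      \<cdot> (\<one> (?P \<otimes>\<^bsub>?j\<^esub> ?P') \<odot>\<^bsub>1\<^esub> \<eta> 1 ?j ?Q ?Q' ?R ?R')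
      \<cdot> \<alpha> 1 (?P \<otimes>\<^bsub>?j\<^esub> ?P') (?Q \<otimes>\<^bsub>?j\<^esub> ?Q') (?R \<otimes>\<^bsub>?j\<^esub> ?R') =
      ((?u \<odot>\<^bsub>?j\<^esub> ?u') \<cdot> \<eta> 1 ?j ?P ?P' (?Q \<otimes>\<^bsub>1\<^esub> ?R) (?Q' \<otimes>\<^bsub>1\<^esub> ?R'))
      \<cdot> (\<one> (?P \<otimes>\<^bsub>?j\<^esub> ?P') \<odot>\<^bsub>1\<^esub> \<eta> 1 ?j ?Q ?Q' ?R ?R')
      \<cdot> \<alpha> 1 (?P \<otimes>\<^bsub>?j\<^esub> ?P') (?Q \<otimes>\<^bsub>?j\<^esub> ?Q') (?R \<otimes>\<^bsub>?j\<^esub> ?R')"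
    by (simp add: Cmp_assoc')
  \<comment> \<open>The absorption lemma read backwards, which makes the compositions of the product
    reappear.\<close>
  also have "(?u \<odot>\<^bsub>?j\<^esub> ?u') \<cdot> \<eta> 1 ?j ?P ?P' (?Q \<otimes>\<^bsub>1\<^esub> ?R) (?Q' \<otimes>\<^bsub>1\<^esub> ?R') =
      VCmp T w y z \<cdot> ((\<one> ?P \<odot>\<^bsub>?j\<^esub> \<one> ?P') \<odot>\<^bsub>1\<^esub> (VCmp A a b c \<odot>\<^bsub>?j\<^esub> VCmp B a' b' c'))"
    using eta_tenM_absorb[of 1 ?j "VCmp A a b c" "VCmp B a' b' c'" "\<one> ?P" "\<one> ?P'"
        "VCmp A a c d" "VCmp B a' c' d'"]
    by (simp add: T_def w_def x_def y_def z_def u del: tenM_Idt)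
  also have "(VCmp T w y z \<cdot> ((\<one> ?P \<odot>\<^bsub>?j\<^esub> \<one> ?P') \<odot>\<^bsub>1\<^esub> (VCmp A a b c \<odot>\<^bsub>?j\<^esub> VCmp B a' b' c')))
      \<cdot> (\<one> (?P \<otimes>\<^bsub>?j\<^esub> ?P') \<odot>\<^bsub>1\<^esub> \<eta> 1 ?j ?Q ?Q' ?R ?R')
      \<cdot> \<alpha> 1 (?P \<otimes>\<^bsub>?j\<^esub> ?P') (?Q \<otimes>\<^bsub>?j\<^esub> ?Q') (?R \<otimes>\<^bsub>?j\<^esub> ?R') =
      VCmp T w y z \<cdot> (\<one> (VHom T y z) \<odot>\<^bsub>1\<^esub> VCmp T w x y) \<cdot> \<alpha> 1 (VHom T y z) (VHom T x y) (VHom T w x)"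
    by (simp add: T_def w_def x_def y_def z_def tenM_Cmp_Idt_left Cmp_assoc')
  finally show ?thesis .
qed


lemma V_category_tensor [simp]:
  assumes "1 \<le> i" "i < n" "V_category V A" "V_category V B"
  shows "V_category V (tensor_vcat V i A B)"
proof -
  note A = assms(3,4)
  note [simp] = A
  have [simp]: "0 < i" "i + 1 \<le> n"
    using assms(1,2) by simp_all
  let ?T = "tensor_vcat V i A B"
  let ?X = "pairs (VOb A) (VOb B)"
  have "VHom ?T \<in> ?X \<rightarrow>\<^sub>E ?X \<rightarrow>\<^sub>E Ob V"
    by (simp add: tensor_vcat_def Let_def restrict_PiE_iff del: restrict_PiE)
  moreover have "VCmp ?T \<in> (\<Pi>\<^sub>E x \<in> ?X. \<Pi>\<^sub>E y \<in> ?X. \<Pi>\<^sub>E z \<in> ?X.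
      hom V (VHom ?T y z \<otimes>\<^bsub>1\<^esub> VHom ?T x y) (VHom ?T x z))"
    by (simp add: tensor_vcat_def Let_def homI restrict_PiE_iff del: restrict_PiE)
  moreover have "VId ?T \<in> (\<Pi>\<^sub>E x \<in> ?X. hom V \<I> (VHom ?T x x))"
    by (simp add: tensor_vcat_def Let_def homI restrict_PiE_iff del: restrict_PiE)
  moreover have "VCmp ?T x y y \<cdot> (VId ?T y \<odot>\<^bsub>1\<^esub> \<one> (VHom ?T x y)) = \<one> (VHom ?T x y) \<and>
      VCmp ?T x x y \<cdot> (\<one> (VHom ?T x y) \<odot>\<^bsub>1\<^esub> VId ?T x) = \<one> (VHom ?T x y)"
    if xy: "x \<in> ?X" "y \<in> ?X" for x y
  proof -
    obtain a a' b b' where x: "x = NPair a a'" and y: "y = NPair b b'"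
      and [simp]: "a \<in> VOb A" "a' \<in> VOb B" "b \<in> VOb A" "b' \<in> VOb B"
      using xy by auto
    \<comment> \<open>Splitting the identity presents both arguments of the composition as products
      of elements, as \<open>tensor_elt_comp\<close> requires.\<close>
    have "\<one> (VHom ?T x y) = \<one> (VHom A a b) \<odot>\<^bsub>i + 1\<^esub> \<one> (VHom B a' b')"
      by (simp add: x y)
    then show ?thesis
      using tensor_elt_comp[of i A B a b b a' b' b' "\<one> (VHom A a b)" "VId A b" "\<one> (VHom B a' b')" "VId B b'"]
        tensor_elt_comp[of i A B a a b a' a' b' "VId A a" "\<one> (VHom A a b)" "VId B a'" "\<one> (VHom B a' b')"]
        assms(1,2)
      \<comment> \<open>The composition of the product stays folded so that it matches the two
        instances above; those of the factors stay inside \<open>elt_comp\<close>, where the unit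
        laws apply.\<close>
      by (simp add: x y elt_comp_def[of ?T] del: tensor_vcat_sel(3))
  qed
  moreover have "VCmp ?T w x z \<cdot> (VCmp ?T x y z \<odot>\<^bsub>1\<^esub> \<one> (VHom ?T w x)) =
      VCmp ?T w y z \<cdot> (\<one> (VHom ?T y z) \<odot>\<^bsub>1\<^esub> VCmp ?T w x y)
        \<cdot> \<alpha> 1 (VHom ?T y z) (VHom ?T x y) (VHom ?T w x)"
    if "w \<in> ?X" "x \<in> ?X" "y \<in> ?X" "z \<in> ?X" for w x y z
    using that V_category_tensor_assoc[OF assms] by auto
  ultimately show ?thesis
    unfolding V_category_def tensor_vcat_sel(1) by (intro conjI ballI) simp_all
qed


lemma tensor_vfun_sel [simp]:
  "FDom (tensor_vfun V i T S) = tensor_vcat V i (FDom T) (FDom S)"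
  "FCod (tensor_vfun V i T S) = tensor_vcat V i (FCod T) (FCod S)"
  "\<lbrakk>a \<in> VOb (FDom T); b \<in> VOb (FDom S)\<rbrakk> \<Longrightarrow>
    FOb (tensor_vfun V i T S) (NPair a b) = NPair (FOb T a) (FOb S b)"
  "\<lbrakk>a \<in> VOb (FDom T); b \<in> VOb (FDom S); a' \<in> VOb (FDom T); b' \<in> VOb (FDom S)\<rbrakk> \<Longrightarrow>
    FHom (tensor_vfun V i T S) (NPair a b) (NPair a' b') = FHom T a a' \<odot>\<^bsub>i + 1\<^esub> FHom S b b'"
  by (simp_all add: tensor_vfun_def Let_def)

lemma V_functor_tensor [simp]:
  assumes "1 \<le> i" "i < n" "V_functor V T" "V_functor V S"
  shows "V_functor V (tensor_vfun V i T S)"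
proof (rule V_functorI)
  note [simp] = assms(3,4)
  have [simp]: "0 < i" "i + 1 \<le> n"
    using assms(1,2) by simp_all
  let ?F = "tensor_vfun V i T S"
  show "V_category V (FDom ?F)" "V_category V (FCod ?F)"
    using assms(1,2) by simp_all
  show "FOb ?F \<in> VOb (FDom ?F) \<rightarrow>\<^sub>E VOb (FCod ?F)"
    by (simp add: tensor_vfun_def Let_def restrict_PiE_iff del: restrict_PiE)
  show "FHom ?F \<in> (\<Pi>\<^sub>E a \<in> VOb (FDom ?F). \<Pi>\<^sub>E b \<in> VOb (FDom ?F).
      hom V (VHom (FDom ?F) a b) (VHom (FCod ?F) (FOb ?F a) (FOb ?F b)))"
    by (simp add: tensor_vfun_def Let_def homI restrict_PiE_iff del: restrict_PiE)
  fix x y z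
  assume "x \<in> VOb (FDom ?F)" "y \<in> VOb (FDom ?F)" "z \<in> VOb (FDom ?F)"
  then obtain a b c a' b' c' where x: "x = NPair a a'" "y = NPair b b'" "z = NPair c c'"
    and [simp]: "a \<in> VOb (FDom T)" "b \<in> VOb (FDom T)" "c \<in> VOb (FDom T)"
      "a' \<in> VOb (FDom S)" "b' \<in> VOb (FDom S)" "c' \<in> VOb (FDom S)"
    by auto
  have "FHom ?F x z \<cdot> VCmp (FDom ?F) x y z =
      ((FHom T a c \<odot>\<^bsub>i + 1\<^esub> FHom S a' c') \<cdot> (VCmp (FDom T) a b c \<odot>\<^bsub>i + 1\<^esub> VCmp (FDom S) a' b' c'))
        \<cdot> \<eta> 1 (i + 1) (VHom (FDom T) b c) (VHom (FDom S) b' c') (VHom (FDom T) a b) (VHom (FDom S) a' b')"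
    by (simp add: x Cmp_assoc')
  \<comment> \<open>Read from right to left, composing two products of hom-morphisms leaves the
    interchanger at their domains, which is the one in the composition of the source
    category.\<close>
  also have "\<dots> = elt_comp (FCod ?F) (FOb ?F x) (FOb ?F y) (FOb ?F z) (FHom ?F y z) (FHom ?F x y)"
    using assms(1,2) by (simp add: x tenM_Cmp V_functor_VCmp tensor_elt_comp elt_comp_def[of "FCod T"] elt_comp_def[of "FCod S"])
  finally show "FHom ?F x z \<cdot> VCmp (FDom ?F) x y z =
      VCmp (FCod ?F) (FOb ?F x) (FOb ?F y) (FOb ?F z) \<cdot> (FHom ?F y z \<odot>\<^bsub>1\<^esub> FHom ?F x y)"
    by (simp only: elt_comp_def)
next
  fix x
  assume "x \<in> VOb (FDom (tensor_vfun V i T S))"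
  with assms show "FHom (tensor_vfun V i T S) x x \<cdot> VId (FDom (tensor_vfun V i T S)) x =
      VId (FCod (tensor_vfun V i T S)) (FOb (tensor_vfun V i T S) x)"
    by (auto simp: tenM_Cmp V_functor_VId)
qed

lemma tensor_vfun_id [simp]:
  assumes "1 \<le> i" "i < n" "V_category V A" "V_category V B"
  shows "tensor_vfun V i (id_functor V A) (id_functor V B) = id_functor V (tensor_vcat V i A B)"
  by (rule V_functor_eqI) (use assms in auto)

lemma tensor_vfun_comp:
  assumes "1 \<le> i" "i < n" "V_functor V T" "V_functor V T'" "V_functor V Q" "V_functor V Q'"
    and "FCod T = FDom Q" "FCod T' = FDom Q'"
  shows "tensor_vfun V i (comp_functor V Q T) (comp_functor V Q' T') =
    comp_functor V (tensor_vfun V i Q Q') (tensor_vfun V i T T')"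
  by (rule V_functor_eqI) (use assms in \<open>auto simp: tenM_Cmp\<close>)

lemma tensor_vtrans_sel [simp]:
  "NSrc (tensor_vtrans V i \<beta> \<gamma>) = tensor_vfun V i (NSrc \<beta>) (NSrc \<gamma>)"
  "NTrg (tensor_vtrans V i \<beta> \<gamma>) = tensor_vfun V i (NTrg \<beta>) (NTrg \<gamma>)"
  "\<lbrakk>a \<in> VOb (FDom (NSrc \<beta>)); b \<in> VOb (FDom (NSrc \<gamma>))\<rbrakk> \<Longrightarrow>
    NAt (tensor_vtrans V i \<beta> \<gamma>) (NPair a b) = NAt \<beta> a \<odot>\<^bsub>i + 1\<^esub> NAt \<gamma> b"
  by (simp_all add: tensor_vtrans_def)

text \<open>The two composites in the naturality square carry the interchangers with arguments I, I,
  X, Y and X, Y, I, I. Both are identities by the internal unit condition, and the equation becomes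
  the product of the two given squares.\<close>

lemma V_trans_tensor [simp]:
  assumes "1 \<le> i" "i < n" "V_trans V \<beta>" "V_trans V \<gamma>"
  shows "V_trans V (tensor_vtrans V i \<beta> \<gamma>)"
proof (rule V_transI)
  note [simp] = assms(3,4)
  have [simp]: "0 < i" "i + 1 \<le> n"
    using assms(1,2) by simp_all
  let ?\<beta> = "tensor_vtrans V i \<beta> \<gamma>"
  show "NAt ?\<beta> \<in> (\<Pi>\<^sub>E a \<in> VOb (FDom (NSrc ?\<beta>)).
      hom V \<I> (VHom (FCod (NSrc ?\<beta>)) (FOb (NSrc ?\<beta>) a) (FOb (NTrg ?\<beta>) a)))"
    by (simp add: tensor_vtrans_def homI restrict_PiE_iff del: restrict_PiE)
  fix x y
  assume "x \<in> VOb (FDom (NSrc ?\<beta>))" "y \<in> VOb (FDom (NSrc ?\<beta>))"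
  with assms show "elt_comp (FCod (NSrc ?\<beta>)) (FOb (NSrc ?\<beta>) x) (FOb (NSrc ?\<beta>) y) (FOb (NTrg ?\<beta>) y)
        (NAt ?\<beta> y) (FHom (NSrc ?\<beta>) x y) =
      elt_comp (FCod (NSrc ?\<beta>)) (FOb (NSrc ?\<beta>) x) (FOb (NTrg ?\<beta>) x) (FOb (NTrg ?\<beta>) y)
        (FHom (NTrg ?\<beta>) x y) (NAt ?\<beta> x)"
    by (auto simp: tensor_elt_comp V_trans_natural)
qed (use assms in simp_all)

lemma tensor_vtrans_id [simp]:
  assumes "1 \<le> i" "i < n" "V_functor V T" "V_functor V S"
  shows "tensor_vtrans V i (id_trans T) (id_trans S) = id_trans (tensor_vfun V i T S)"
  by (rule V_trans_eqI) (use assms in auto)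

lemma tensor_vtrans_vert_comp:
  assumes "1 \<le> i" "i < n" "V_trans V \<sigma>" "V_trans V \<sigma>'" "V_trans V \<tau>" "V_trans V \<tau>'"
    and "NTrg \<sigma> = NSrc \<tau>" "NTrg \<sigma>' = NSrc \<tau>'"
  shows "tensor_vtrans V i (vert_comp V \<tau> \<sigma>) (vert_comp V \<tau>' \<sigma>') =
    vert_comp V (tensor_vtrans V i \<tau> \<tau>') (tensor_vtrans V i \<sigma> \<sigma>')"
proof (rule V_trans_eqI)
  note [simp] = assms(3-8) V_trans_functor(3,4)[OF assms(3), unfolded assms(7)]
    V_trans_functor(3,4)[OF assms(4), unfolded assms(8)]
  fix x
  assume "x \<in> VOb (FDom (NSrc (vert_comp V (tensor_vtrans V i \<tau> \<tau>') (tensor_vtrans V i \<sigma> \<sigma>'))))"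
  with assms(1,2) show "NAt (tensor_vtrans V i (vert_comp V \<tau> \<sigma>) (vert_comp V \<tau>' \<sigma>')) x =
      NAt (vert_comp V (tensor_vtrans V i \<tau> \<tau>') (tensor_vtrans V i \<sigma> \<sigma>')) x"
    by (auto simp: tensor_elt_comp)
qed (use assms in simp_all)

text \<open>Components are elements with domain \<I>, so the only interchanger left over is the one
  at four units.\<close>

lemma tensor_vtrans_horiz_comp:
  assumes "1 \<le> i" "i < n" "V_trans V \<sigma>" "V_trans V \<sigma>'" "V_trans V \<tau>" "V_trans V \<tau>'"
    and "FCod (NSrc \<sigma>) = FDom (NSrc \<tau>)" "FCod (NSrc \<sigma>') = FDom (NSrc \<tau>')"
  shows "tensor_vtrans V i (horiz_comp V \<tau> \<sigma>) (horiz_comp V \<tau>' \<sigma>') =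
    horiz_comp V (tensor_vtrans V i \<tau> \<tau>') (tensor_vtrans V i \<sigma> \<sigma>')"
  by (rule V_trans_eqI) (use assms in \<open>auto simp: tensor_elt_comp tenM_Cmp tensor_vfun_comp\<close>)

section \<open>Associators as enriched functors\<close>

lemma assoc_vfun_sel [simp]:
  "FDom (assoc_vfun V i A B C) = tensor_vcat V i (tensor_vcat V i A B) C"
  "FCod (assoc_vfun V i A B C) = tensor_vcat V i A (tensor_vcat V i B C)"
  "\<lbrakk>a \<in> VOb A; b \<in> VOb B; c \<in> VOb C\<rbrakk> \<Longrightarrow>
    FOb (assoc_vfun V i A B C) (NPair (NPair a b) c) = NPair a (NPair b c)"
  "\<lbrakk>a \<in> VOb A; b \<in> VOb B; c \<in> VOb C; a' \<in> VOb A; b' \<in> VOb B; c' \<in> VOb C\<rbrakk> \<Longrightarrow>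
    FHom (assoc_vfun V i A B C) (NPair (NPair a b) c) (NPair (NPair a' b') c') =
      \<alpha> (i + 1) (VHom A a a') (VHom B b b') (VHom C c c')"
  by (simp_all add: assoc_vfun_def Let_def)

lemma V_functor_assoc [simp]:
  assumes "1 \<le> i" "i < n" "V_category V A" "V_category V B" "V_category V C"
  shows "V_functor V (assoc_vfun V i A B C)"
proof (rule V_functorI)
  note [simp] = assms(3-5)
  have [simp]: "0 < i" "i + 1 \<le> n"
    using assms(1,2) by simp_all
  let ?F = "assoc_vfun V i A B C" and ?j = "i + 1"
  show "V_category V (FDom ?F)" "V_category V (FCod ?F)"
    using assms(1,2) by simp_all
  show "FOb ?F \<in> VOb (FDom ?F) \<rightarrow>\<^sub>E VOb (FCod ?F)"
    by (simp add: assoc_vfun_def Let_def restrict_PiE_iff del: restrict_PiE)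
  show "FHom ?F \<in> (\<Pi>\<^sub>E a \<in> VOb (FDom ?F). \<Pi>\<^sub>E b \<in> VOb (FDom ?F).
      hom V (VHom (FDom ?F) a b) (VHom (FCod ?F) (FOb ?F a) (FOb ?F b)))"
    by (simp add: assoc_vfun_def Let_def homI restrict_PiE_iff del: restrict_PiE)
  fix x y z
  assume "x \<in> VOb (FDom ?F)" "y \<in> VOb (FDom ?F)" "z \<in> VOb (FDom ?F)"
  then obtain a b c a' b' c' a'' b'' c''
    where x: "x = NPair (NPair a b) c" "y = NPair (NPair a' b') c'" "z = NPair (NPair a'' b'') c''"
    and [simp]: "a \<in> VOb A" "b \<in> VOb B" "c \<in> VOb C" "a' \<in> VOb A" "b' \<in> VOb B" "c' \<in> VOb C"
      "a'' \<in> VOb A" "b'' \<in> VOb B" "c'' \<in> VOb C"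
    by auto
  let ?P = "VHom A a' a''" and ?P' = "VHom B b' b''" and ?P'' = "VHom C c' c''"
  let ?Q = "VHom A a a'" and ?Q' = "VHom B b b'" and ?Q'' = "VHom C c c'"
  let ?M = "VCmp A a a' a''" and ?M' = "VCmp B b b' b''" and ?M'' = "VCmp C c c' c''"
  \<comment> \<open>The third factor receives an explicit identity, so that the three compositions
    can be separated from the inner interchanger and passed through \<alpha> by naturality.\<close>
  have "FHom ?F x z \<cdot> VCmp (FDom ?F) x y z =
      \<alpha> ?j (VHom A a a'') (VHom B b b'') (VHom C c c'')
      \<cdot> (((?M \<odot>\<^bsub>?j\<^esub> ?M') \<cdot> \<eta> 1 ?j ?P ?P' ?Q ?Q') \<odot>\<^bsub>?j\<^esub> (?M'' \<cdot> \<one> (?P'' \<otimes>\<^bsub>1\<^esub> ?Q'')))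
      \<cdot> \<eta> 1 ?j (?P \<otimes>\<^bsub>?j\<^esub> ?P') ?P'' (?Q \<otimes>\<^bsub>?j\<^esub> ?Q') ?Q''"
    by (simp add: x)
  also have "\<dots> = (\<alpha> ?j (VHom A a a'') (VHom B b b'') (VHom C c c'') \<cdot> ((?M \<odot>\<^bsub>?j\<^esub> ?M') \<odot>\<^bsub>?j\<^esub> ?M''))
      \<cdot> (\<eta> 1 ?j ?P ?P' ?Q ?Q' \<odot>\<^bsub>?j\<^esub> \<one> (?P'' \<otimes>\<^bsub>1\<^esub> ?Q''))
      \<cdot> \<eta> 1 ?j (?P \<otimes>\<^bsub>?j\<^esub> ?P') ?P'' (?Q \<otimes>\<^bsub>?j\<^esub> ?Q') ?Q''"
    by (subst tenM_Cmp[symmetric]) (simp_all add: Cmp_assoc')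
  also have "\<alpha> ?j (VHom A a a'') (VHom B b b'') (VHom C c c'') \<cdot> ((?M \<odot>\<^bsub>?j\<^esub> ?M') \<odot>\<^bsub>?j\<^esub> ?M'') =
      (?M \<odot>\<^bsub>?j\<^esub> (?M' \<odot>\<^bsub>?j\<^esub> ?M'')) \<cdot> \<alpha> ?j (?P \<otimes>\<^bsub>1\<^esub> ?Q) (?P' \<otimes>\<^bsub>1\<^esub> ?Q') (?P'' \<otimes>\<^bsub>1\<^esub> ?Q'')"
    by (rule asc_natural) (simp_all add: hom_def)
  also have "((?M \<odot>\<^bsub>?j\<^esub> (?M' \<odot>\<^bsub>?j\<^esub> ?M'')) \<cdot> \<alpha> ?j (?P \<otimes>\<^bsub>1\<^esub> ?Q) (?P' \<otimes>\<^bsub>1\<^esub> ?Q') (?P'' \<otimes>\<^bsub>1\<^esub> ?Q''))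
      \<cdot> (\<eta> 1 ?j ?P ?P' ?Q ?Q' \<odot>\<^bsub>?j\<^esub> \<one> (?P'' \<otimes>\<^bsub>1\<^esub> ?Q''))
      \<cdot> \<eta> 1 ?j (?P \<otimes>\<^bsub>?j\<^esub> ?P') ?P'' (?Q \<otimes>\<^bsub>?j\<^esub> ?Q') ?Q'' =
      (?M \<odot>\<^bsub>?j\<^esub> (?M' \<odot>\<^bsub>?j\<^esub> ?M'')) \<cdot> \<alpha> ?j (?P \<otimes>\<^bsub>1\<^esub> ?Q) (?P' \<otimes>\<^bsub>1\<^esub> ?Q') (?P'' \<otimes>\<^bsub>1\<^esub> ?Q'')
      \<cdot> (\<eta> 1 ?j ?P ?P' ?Q ?Q' \<odot>\<^bsub>?j\<^esub> \<one> (?P'' \<otimes>\<^bsub>1\<^esub> ?Q''))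
      \<cdot> \<eta> 1 ?j (?P \<otimes>\<^bsub>?j\<^esub> ?P') ?P'' (?Q \<otimes>\<^bsub>?j\<^esub> ?Q') ?Q''"
    by (simp add: Cmp_assoc')
  \<comment> \<open>External associativity for the index pair 1, i + 1 replaces the associator
    applied last by associators on the two hom-objects being composed.\<close>
  also have "\<alpha> ?j (?P \<otimes>\<^bsub>1\<^esub> ?Q) (?P' \<otimes>\<^bsub>1\<^esub> ?Q') (?P'' \<otimes>\<^bsub>1\<^esub> ?Q'')
      \<cdot> (\<eta> 1 ?j ?P ?P' ?Q ?Q' \<odot>\<^bsub>?j\<^esub> \<one> (?P'' \<otimes>\<^bsub>1\<^esub> ?Q''))
      \<cdot> \<eta> 1 ?j (?P \<otimes>\<^bsub>?j\<^esub> ?P') ?P'' (?Q \<otimes>\<^bsub>?j\<^esub> ?Q') ?Q'' =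
      (\<one> (?P \<otimes>\<^bsub>1\<^esub> ?Q) \<odot>\<^bsub>?j\<^esub> \<eta> 1 ?j ?P' ?P'' ?Q' ?Q'')
      \<cdot> \<eta> 1 ?j ?P (?P' \<otimes>\<^bsub>?j\<^esub> ?P'') ?Q (?Q' \<otimes>\<^bsub>?j\<^esub> ?Q'') \<cdot> (\<alpha> ?j ?P ?P' ?P'' \<odot>\<^bsub>1\<^esub> \<alpha> ?j ?Q ?Q' ?Q'')"
    by (rule external_associativity[symmetric]) simp_all
  also have "(?M \<odot>\<^bsub>?j\<^esub> (?M' \<odot>\<^bsub>?j\<^esub> ?M'')) \<cdot> (\<one> (?P \<otimes>\<^bsub>1\<^esub> ?Q) \<odot>\<^bsub>?j\<^esub> \<eta> 1 ?j ?P' ?P'' ?Q' ?Q'')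
      \<cdot> \<eta> 1 ?j ?P (?P' \<otimes>\<^bsub>?j\<^esub> ?P'') ?Q (?Q' \<otimes>\<^bsub>?j\<^esub> ?Q'') \<cdot> (\<alpha> ?j ?P ?P' ?P'' \<odot>\<^bsub>1\<^esub> \<alpha> ?j ?Q ?Q' ?Q'') =
      (((?M \<odot>\<^bsub>?j\<^esub> (?M' \<odot>\<^bsub>?j\<^esub> ?M'')) \<cdot> (\<one> (?P \<otimes>\<^bsub>1\<^esub> ?Q) \<odot>\<^bsub>?j\<^esub> \<eta> 1 ?j ?P' ?P'' ?Q' ?Q''))
      \<cdot> \<eta> 1 ?j ?P (?P' \<otimes>\<^bsub>?j\<^esub> ?P'') ?Q (?Q' \<otimes>\<^bsub>?j\<^esub> ?Q'')) \<cdot> (\<alpha> ?j ?P ?P' ?P'' \<odot>\<^bsub>1\<^esub> \<alpha> ?j ?Q ?Q' ?Q'')"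
    by (simp add: Cmp_assoc')
  also have "(?M \<odot>\<^bsub>?j\<^esub> (?M' \<odot>\<^bsub>?j\<^esub> ?M'')) \<cdot> (\<one> (?P \<otimes>\<^bsub>1\<^esub> ?Q) \<odot>\<^bsub>?j\<^esub> \<eta> 1 ?j ?P' ?P'' ?Q' ?Q'') =
      ?M \<odot>\<^bsub>?j\<^esub> ((?M' \<odot>\<^bsub>?j\<^esub> ?M'') \<cdot> \<eta> 1 ?j ?P' ?P'' ?Q' ?Q'')"
    by (simp add: tenM_Cmp)
  finally show "FHom ?F x z \<cdot> VCmp (FDom ?F) x y z =
      VCmp (FCod ?F) (FOb ?F x) (FOb ?F y) (FOb ?F z) \<cdot> (FHom ?F y z \<odot>\<^bsub>1\<^esub> FHom ?F x y)"
    by (simp add: x)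
next
  fix x
  assume "x \<in> VOb (FDom (assoc_vfun V i A B C))"
  then obtain a b c where x: "x = NPair (NPair a b) c" "a \<in> VOb A" "b \<in> VOb B" "c \<in> VOb C"
    by auto
  \<comment> \<open>Naturality at the identity elements leaves the associator at three units, which
    is an identity.\<close>
  have "\<alpha> (i + 1) (VHom A a a) (VHom B b b) (VHom C c c)
        \<cdot> ((VId A a \<odot>\<^bsub>i + 1\<^esub> VId B b) \<odot>\<^bsub>i + 1\<^esub> VId C c) =
      (VId A a \<odot>\<^bsub>i + 1\<^esub> (VId B b \<odot>\<^bsub>i + 1\<^esub> VId C c)) \<cdot> \<alpha> (i + 1) \<I> \<I> \<I>"
    by (rule asc_natural) (use assms x in \<open>simp_all add: hom_def\<close>)
  with assms x show "FHom (assoc_vfun V i A B C) x x \<cdot> VId (FDom (assoc_vfun V i A B C)) x =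
      VId (FCod (assoc_vfun V i A B C)) (FOb (assoc_vfun V i A B C) x)"
    by simp
qed

section \<open>Interchange transformations as enriched functors\<close>

lemma inter_vfun_sel [simp]:
  "FDom (inter_vfun V i j A B C D) = tensor_vcat V i (tensor_vcat V j A B) (tensor_vcat V j C D)"
  "FCod (inter_vfun V i j A B C D) = tensor_vcat V j (tensor_vcat V i A C) (tensor_vcat V i B D)"
  "\<lbrakk>a \<in> VOb A; b \<in> VOb B; c \<in> VOb C; d \<in> VOb D\<rbrakk> \<Longrightarrow>
    FOb (inter_vfun V i j A B C D) (NPair (NPair a b) (NPair c d)) = NPair (NPair a c) (NPair b d)"
  "\<lbrakk>a \<in> VOb A; b \<in> VOb B; c \<in> VOb C; d \<in> VOb D;
      a' \<in> VOb A; b' \<in> VOb B; c' \<in> VOb C; d' \<in> VOb D\<rbrakk> \<Longrightarrow>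
    FHom (inter_vfun V i j A B C D) (NPair (NPair a b) (NPair c d)) (NPair (NPair a' b') (NPair c' d')) =
      \<eta> (i + 1) (j + 1) (VHom A a a') (VHom B b b') (VHom C c c') (VHom D d d')"
  by (simp_all add: inter_vfun_def Let_def)

lemma V_functor_inter [simp]:
  assumes "1 \<le> i" "i < j" "j < n"
    and "V_category V A" "V_category V B" "V_category V C" "V_category V D"
  shows "V_functor V (inter_vfun V i j A B C D)"
proof (rule V_functorI)
  note [simp] = assms(4-7)
  have [simp]: "0 < i" "0 < j" "i < j" "i + 1 \<le> n" "j + 1 \<le> n" "i < n" "j < n" "1 \<le> i" "1 \<le> j"
    using assms(1-3) by simp_all
  let ?F = "inter_vfun V i j A B C D" and ?i = "i + 1" and ?j = "j + 1"
  show "V_category V (FDom ?F)" "V_category V (FCod ?F)"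
    by simp_all
  show "FOb ?F \<in> VOb (FDom ?F) \<rightarrow>\<^sub>E VOb (FCod ?F)"
    by (simp add: inter_vfun_def Let_def restrict_PiE_iff del: restrict_PiE)
  show "FHom ?F \<in> (\<Pi>\<^sub>E a \<in> VOb (FDom ?F). \<Pi>\<^sub>E b \<in> VOb (FDom ?F).
      hom V (VHom (FDom ?F) a b) (VHom (FCod ?F) (FOb ?F a) (FOb ?F b)))"
    by (simp add: inter_vfun_def Let_def homI restrict_PiE_iff del: restrict_PiE)
  fix x y z
  assume "x \<in> VOb (FDom ?F)" "y \<in> VOb (FDom ?F)" "z \<in> VOb (FDom ?F)"
  then obtain a b c d a' b' c' d' a'' b'' c'' d''
    where x: "x = NPair (NPair a b) (NPair c d)" "y = NPair (NPair a' b') (NPair c' d')"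
      "z = NPair (NPair a'' b'') (NPair c'' d'')"
    and [simp]: "a \<in> VOb A" "b \<in> VOb B" "c \<in> VOb C" "d \<in> VOb D"
      "a' \<in> VOb A" "b' \<in> VOb B" "c' \<in> VOb C" "d' \<in> VOb D"
      "a'' \<in> VOb A" "b'' \<in> VOb B" "c'' \<in> VOb C" "d'' \<in> VOb D"
    by auto
  let ?PA = "VHom A a' a''" and ?PB = "VHom B b' b''" and ?PC = "VHom C c' c''" and ?PD = "VHom D d' d''"
  let ?QA = "VHom A a a'" and ?QB = "VHom B b b'" and ?QC = "VHom C c c'" and ?QD = "VHom D d d'"
  let ?MA = "VCmp A a a' a''" and ?MB = "VCmp B b b' b''"
    and ?MC = "VCmp C c c' c''" and ?MD = "VCmp D d d' d''"
  let ?\<eta> = "\<eta> ?i ?j (VHom A a a'') (VHom B b b'') (VHom C c c'') (VHom D d d'')"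
  \<comment> \<open>\<open>?e\<close> and \<open>?e'\<close> are the interchangers in the
    composition of the source, \<open>?f\<close> and \<open>?f'\<close> those in the composition of
    the target. \<open>?m\<close> acts after the pairs of hom-objects are multiplied,
    \<open>?s\<close> on each of the two factors before.\<close>
  let ?e = "\<eta> 1 ?j ?PA ?PB ?QA ?QB \<odot>\<^bsub>?i\<^esub> \<eta> 1 ?j ?PC ?PD ?QC ?QD"
    and ?e' = "\<eta> 1 ?i (?PA \<otimes>\<^bsub>?j\<^esub> ?PB) (?PC \<otimes>\<^bsub>?j\<^esub> ?PD) (?QA \<otimes>\<^bsub>?j\<^esub> ?QB) (?QC \<otimes>\<^bsub>?j\<^esub> ?QD)"
  let ?f = "\<eta> 1 ?i ?PA ?PC ?QA ?QC \<odot>\<^bsub>?j\<^esub> \<eta> 1 ?i ?PB ?PD ?QB ?QD"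
    and ?f' = "\<eta> 1 ?j (?PA \<otimes>\<^bsub>?i\<^esub> ?PC) (?PB \<otimes>\<^bsub>?i\<^esub> ?PD) (?QA \<otimes>\<^bsub>?i\<^esub> ?QC) (?QB \<otimes>\<^bsub>?i\<^esub> ?QD)"
  let ?m = "\<eta> ?i ?j (?PA \<otimes>\<^bsub>1\<^esub> ?QA) (?PB \<otimes>\<^bsub>1\<^esub> ?QB) (?PC \<otimes>\<^bsub>1\<^esub> ?QC) (?PD \<otimes>\<^bsub>1\<^esub> ?QD)"
  let ?s = "\<eta> ?i ?j ?PA ?PB ?PC ?PD \<odot>\<^bsub>1\<^esub> \<eta> ?i ?j ?QA ?QB ?QC ?QD"
  have "FHom ?F x z \<cdot> VCmp (FDom ?F) x y z =
      ?\<eta> \<cdot> (((?MA \<odot>\<^bsub>?j\<^esub> ?MB) \<odot>\<^bsub>?i\<^esub> (?MC \<odot>\<^bsub>?j\<^esub> ?MD)) \<cdot> ?e) \<cdot> ?e'"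
    by (simp add: x tenM_Cmp)
  also have "\<dots> = (?\<eta> \<cdot> ((?MA \<odot>\<^bsub>?j\<^esub> ?MB) \<odot>\<^bsub>?i\<^esub> (?MC \<odot>\<^bsub>?j\<^esub> ?MD))) \<cdot> ?e \<cdot> ?e'"
    by (simp add: Cmp_assoc')
  also have "?\<eta> \<cdot> ((?MA \<odot>\<^bsub>?j\<^esub> ?MB) \<odot>\<^bsub>?i\<^esub> (?MC \<odot>\<^bsub>?j\<^esub> ?MD)) =
      ((?MA \<odot>\<^bsub>?i\<^esub> ?MC) \<odot>\<^bsub>?j\<^esub> (?MB \<odot>\<^bsub>?i\<^esub> ?MD)) \<cdot> ?m"
    by (rule eta_natural) (simp_all add: hom_def)
  also have "(((?MA \<odot>\<^bsub>?i\<^esub> ?MC) \<odot>\<^bsub>?j\<^esub> (?MB \<odot>\<^bsub>?i\<^esub> ?MD)) \<cdot> ?m) \<cdot> ?e \<cdot> ?e' =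
      ((?MA \<odot>\<^bsub>?i\<^esub> ?MC) \<odot>\<^bsub>?j\<^esub> (?MB \<odot>\<^bsub>?i\<^esub> ?MD)) \<cdot> ?m \<cdot> ?e \<cdot> ?e'"
    by (simp add: Cmp_assoc')
  \<comment> \<open>The giant hexagon for the indices 1 < i + 1 < j + 1.\<close>
  also have "?m \<cdot> ?e \<cdot> ?e' = ?f \<cdot> ?f' \<cdot> ?s"
    by (rule giant_hexagon[symmetric]) simp_all
  also have "((?MA \<odot>\<^bsub>?i\<^esub> ?MC) \<odot>\<^bsub>?j\<^esub> (?MB \<odot>\<^bsub>?i\<^esub> ?MD)) \<cdot> ?f \<cdot> ?f' \<cdot> ?s =
      ((((?MA \<odot>\<^bsub>?i\<^esub> ?MC) \<odot>\<^bsub>?j\<^esub> (?MB \<odot>\<^bsub>?i\<^esub> ?MD)) \<cdot> ?f) \<cdot> ?f') \<cdot> ?s"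
    by (simp add: Cmp_assoc')
  also have "((?MA \<odot>\<^bsub>?i\<^esub> ?MC) \<odot>\<^bsub>?j\<^esub> (?MB \<odot>\<^bsub>?i\<^esub> ?MD)) \<cdot> ?f =
      ((?MA \<odot>\<^bsub>?i\<^esub> ?MC) \<cdot> \<eta> 1 ?i ?PA ?PC ?QA ?QC) \<odot>\<^bsub>?j\<^esub> ((?MB \<odot>\<^bsub>?i\<^esub> ?MD) \<cdot> \<eta> 1 ?i ?PB ?PD ?QB ?QD)"
    by (simp add: tenM_Cmp)
  finally show "FHom ?F x z \<cdot> VCmp (FDom ?F) x y z =
      VCmp (FCod ?F) (FOb ?F x) (FOb ?F y) (FOb ?F z) \<cdot> (FHom ?F y z \<odot>\<^bsub>1\<^esub> FHom ?F x y)"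
    by (simp add: x)
next
  fix x
  assume "x \<in> VOb (FDom (inter_vfun V i j A B C D))"
  then obtain a b c d where x: "x = NPair (NPair a b) (NPair c d)"
    "a \<in> VOb A" "b \<in> VOb B" "c \<in> VOb C" "d \<in> VOb D"
    by auto
  \<comment> \<open>As for the associators, only the interchanger at four units survives.\<close>
  have "\<eta> (i + 1) (j + 1) (VHom A a a) (VHom B b b) (VHom C c c) (VHom D d d)
        \<cdot> ((VId A a \<odot>\<^bsub>j + 1\<^esub> VId B b) \<odot>\<^bsub>i + 1\<^esub> (VId C c \<odot>\<^bsub>j + 1\<^esub> VId D d)) =
      ((VId A a \<odot>\<^bsub>i + 1\<^esub> VId C c) \<odot>\<^bsub>j + 1\<^esub> (VId B b \<odot>\<^bsub>i + 1\<^esub> VId D d)) \<cdot> \<eta> (i + 1) (j + 1) \<I> \<I> \<I> \<I>"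
    by (rule eta_natural) (use assms x in \<open>simp_all add: hom_def\<close>)
  with assms x show "FHom (inter_vfun V i j A B C D) x x \<cdot> VId (FDom (inter_vfun V i j A B C D)) x =
      VId (FCod (inter_vfun V i j A B C D)) (FOb (inter_vfun V i j A B C D) x)"
    by simp
qed

section \<open>The unit category and the unit identifications\<close>

lemma unit_vcat_sel [simp]:
  "VOb (unit_vcat V) = {Pt}" "VHom (unit_vcat V) Pt Pt = \<I>"
  "VCmp (unit_vcat V) Pt Pt Pt = \<one> \<I>" "VId (unit_vcat V) Pt = \<one> \<I>"
  by (simp_all add: unit_vcat_def)

text \<open>Associativity of composition here says that the first associator at three units is an
  identity, which is \<open>asc_unit\<close>.\<close>

lemma V_category_unit_vcat [simp]: "V_category V (unit_vcat V)"
  by (simp add: V_category_def unit_vcat_def homI restrict_PiE_iff del: restrict_PiE)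

lemma left_unit_vfun_sel [simp]:
  "FDom (left_unit_vfun V i A) = tensor_vcat V i (unit_vcat V) A" "FCod (left_unit_vfun V i A) = A"
  "a \<in> VOb A \<Longrightarrow> FOb (left_unit_vfun V i A) (NPair Pt a) = a"
  "\<lbrakk>a \<in> VOb A; b \<in> VOb A\<rbrakk> \<Longrightarrow> FHom (left_unit_vfun V i A) (NPair Pt a) (NPair Pt b) = \<one> (VHom A a b)"
  by (simp_all add: left_unit_vfun_def Let_def)

lemma right_unit_vfun_sel [simp]:
  "FDom (right_unit_vfun V i A) = tensor_vcat V i A (unit_vcat V)" "FCod (right_unit_vfun V i A) = A"
  "a \<in> VOb A \<Longrightarrow> FOb (right_unit_vfun V i A) (NPair a Pt) = a"
  "\<lbrakk>a \<in> VOb A; b \<in> VOb A\<rbrakk> \<Longrightarrow> FHom (right_unit_vfun V i A) (NPair a Pt) (NPair b Pt) = \<one> (VHom A a b)"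
  by (simp_all add: right_unit_vfun_def Let_def)

text \<open>Composition in the product with the unit category involves the interchanger with
  arguments I, X, I, Y; by the external unit condition it is an identity, so identity hom-morphisms
  respect composition.\<close>

lemma V_functor_left_unit [simp]:
  assumes "1 \<le> i" "i < n" "V_category V A"
  shows "V_functor V (left_unit_vfun V i A)"
proof (rule V_functorI)
  have [simp]: "0 < i" "i + 1 \<le> n"
    using assms(1,2) by simp_all
  note [simp] = assms(3)
  let ?F = "left_unit_vfun V i A"
  show "FOb ?F \<in> VOb (FDom ?F) \<rightarrow>\<^sub>E VOb (FCod ?F)"
    by (simp add: left_unit_vfun_def Let_def restrict_PiE_iff del: restrict_PiE)
  show "FHom ?F \<in> (\<Pi>\<^sub>E a \<in> VOb (FDom ?F). \<Pi>\<^sub>E b \<in> VOb (FDom ?F).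
      hom V (VHom (FDom ?F) a b) (VHom (FCod ?F) (FOb ?F a) (FOb ?F b)))"
    by (simp add: left_unit_vfun_def Let_def homI restrict_PiE_iff del: restrict_PiE)
qed (use assms in auto)

lemma V_functor_right_unit [simp]:
  assumes "1 \<le> i" "i < n" "V_category V A"
  shows "V_functor V (right_unit_vfun V i A)"
proof (rule V_functorI)
  have [simp]: "0 < i" "i + 1 \<le> n"
    using assms(1,2) by simp_all
  note [simp] = assms(3)
  let ?F = "right_unit_vfun V i A"
  show "FOb ?F \<in> VOb (FDom ?F) \<rightarrow>\<^sub>E VOb (FCod ?F)"
    by (simp add: right_unit_vfun_def Let_def restrict_PiE_iff del: restrict_PiE)
  show "FHom ?F \<in> (\<Pi>\<^sub>E a \<in> VOb (FDom ?F). \<Pi>\<^sub>E b \<in> VOb (FDom ?F).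
      hom V (VHom (FDom ?F) a b) (VHom (FCod ?F) (FOb ?F a) (FOb ?F b)))"
    by (simp add: right_unit_vfun_def Let_def homI restrict_PiE_iff del: restrict_PiE)
qed (use assms in auto)


section \<open>Coherence\<close>

text \<open>The pointwise inverses on objects and hom-objects form an enriched functor: its axioms
  hold after composing with the hom-morphisms of T, and these can be cancelled.\<close>

lemma V_functor_iso:
  assumes T: "V_functor V T" and bij: "bij_betw (FOb T) (VOb (FDom T)) (VOb (FCod T))"
    and iso: "\<And>a b. \<lbrakk>a \<in> VOb (FDom T); b \<in> VOb (FDom T)\<rbrakk> \<Longrightarrow> is_iso V (FHom T a b)"
  shows "is_iso (cat1 VCAT) T"
proof -
  note [simp] = T
  let ?A = "FDom T" and ?B = "FCod T"
  define s where "s = inv_into (VOb ?A) (FOb T)"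
  have s [simp]: "s x \<in> VOb ?A" "FOb T (s x) = x" if "x \<in> VOb ?B" for x
    using that bij by (auto simp: s_def bij_betw_def f_inv_into_f inv_into_into)
  have s' [simp]: "s (FOb T a) = a" if "a \<in> VOb ?A" for a
    using that bij by (simp add: s_def bij_betw_def)
  have "\<exists>g. g \<in> hom V (VHom ?B x y) (VHom ?A (s x) (s y)) \<and>
      g \<cdot> FHom T (s x) (s y) = \<one> (VHom ?A (s x) (s y)) \<and> FHom T (s x) (s y) \<cdot> g = \<one> (VHom ?B x y)"
    if "x \<in> VOb ?B" "y \<in> VOb ?B" for x y
    using iso[of "s x" "s y"] that by (auto simp: is_iso_def)
  then obtain g where g: "\<And>x y. \<lbrakk>x \<in> VOb ?B; y \<in> VOb ?B\<rbrakk> \<Longrightarrow>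
      g x y \<in> hom V (VHom ?B x y) (VHom ?A (s x) (s y)) \<and>
      g x y \<cdot> FHom T (s x) (s y) = \<one> (VHom ?A (s x) (s y)) \<and> FHom T (s x) (s y) \<cdot> g x y = \<one> (VHom ?B x y)"
    by metis
  have g_simps [simp]: "g x y \<in> Mor V" "Src V (g x y) = VHom ?B x y"
    "Trg V (g x y) = VHom ?A (s x) (s y)" "g x y \<cdot> FHom T (s x) (s y) = \<one> (VHom ?A (s x) (s y))"
    "FHom T (s x) (s y) \<cdot> g x y = \<one> (VHom ?B x y)"
    if "x \<in> VOb ?B" "y \<in> VOb ?B" for x y
    using g[OF that] by (simp_all add: hom_def)
  \<comment> \<open>Restricting to the object set makes the inverse extensional, hence a 1-cell and
    not merely pointwise inverse data.\<close>
  define S where "S = \<lparr>FDom = ?B, FCod = ?A, FOb = (\<lambda>x \<in> VOb ?B. s x),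
    FHom = (\<lambda>x \<in> VOb ?B. \<lambda>y \<in> VOb ?B. g x y)\<rparr>"
  have S_sel [simp]: "FDom S = ?B" "FCod S = ?A" "x \<in> VOb ?B \<Longrightarrow> FOb S x = s x"
    "\<lbrakk>x \<in> VOb ?B; y \<in> VOb ?B\<rbrakk> \<Longrightarrow> FHom S x y = g x y" for x y
    by (simp_all add: S_def)
  have [simp]: "V_functor V S"
  proof (rule V_functorI)
    show "FOb S \<in> VOb (FDom S) \<rightarrow>\<^sub>E VOb (FCod S)"
      by (simp add: S_def restrict_PiE_iff del: restrict_PiE)
    show "FHom S \<in> (\<Pi>\<^sub>E a \<in> VOb (FDom S). \<Pi>\<^sub>E b \<in> VOb (FDom S).
        hom V (VHom (FDom S) a b) (VHom (FCod S) (FOb S a) (FOb S b)))"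
      by (simp add: S_def homI restrict_PiE_iff del: restrict_PiE)
  next
    fix x y z
    assume "x \<in> VOb (FDom S)" "y \<in> VOb (FDom S)" "z \<in> VOb (FDom S)"
    then have [simp]: "x \<in> VOb ?B" "y \<in> VOb ?B" "z \<in> VOb ?B"
      by simp_all
    \<comment> \<open>The rule collapsing T after its inverse is suspended during the rebracketing,
      since it would rewrite the right-hand side first.\<close>
    have "FHom T (s x) (s z) \<cdot> g x z \<cdot> VCmp ?B x y z =
        (FHom T (s x) (s z) \<cdot> g x z) \<cdot> VCmp ?B x y z"
      by (simp add: Cmp_assoc' del: g_simps(5))
    also have "\<dots> = FHom T (s x) (s z) \<cdot> elt_comp ?A (s x) (s y) (s z) (g y z) (g x y)"
      using V_functor_elt_comp[of T "s x" "s y" "s z" "g x y" "g y z"] by (simp add: elt_comp_def)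
    finally have "g x z \<cdot> VCmp ?B x y z = elt_comp ?A (s x) (s y) (s z) (g y z) (g x y)"
      by (rule iso_cancel_left[OF iso, rotated -1]) simp_all
    then show "FHom S x z \<cdot> VCmp (FDom S) x y z =
        VCmp (FCod S) (FOb S x) (FOb S y) (FOb S z) \<cdot> (FHom S y z \<odot>\<^bsub>1\<^esub> FHom S x y)"
      by (simp add: elt_comp_def)
  next
    fix x
    assume "x \<in> VOb (FDom S)"
    then have [simp]: "x \<in> VOb ?B"
      by simp
    have "FHom T (s x) (s x) \<cdot> g x x \<cdot> VId ?B x = (FHom T (s x) (s x) \<cdot> g x x) \<cdot> VId ?B x"
      by (simp add: Cmp_assoc' del: g_simps(5))
    also have "\<dots> = FHom T (s x) (s x) \<cdot> VId ?A (s x)"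
      using V_functor_VId[of T "s x"] by simp
    finally have "g x x \<cdot> VId ?B x = VId ?A (s x)"
      by (rule iso_cancel_left[OF iso, rotated -1]) simp_all
    then show "FHom S x x \<cdot> VId (FDom S) x = VId (FCod S) (FOb S x)"
      by simp
  qed simp_all
  have g_FOb: "g (FOb T a) (FOb T b) \<cdot> FHom T a b = \<one> (VHom ?A a b)"
    if "a \<in> VOb ?A" "b \<in> VOb ?A" for a b
    using g_simps(4)[of "FOb T a" "FOb T b"] that by simp
  have "comp_functor V S T = id_functor V ?A"
    by (rule V_functor_eqI) (simp_all add: g_FOb)
  moreover have "comp_functor V T S = id_functor V ?B"
    by (rule V_functor_eqI) simp_all
  ultimately show ?thesis
    by (auto simp: is_iso_def cat1_def VCat_def hom_def intro!: exI[of _ S])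
qed

lemma is_iso_Idt: "a \<in> Ob V \<Longrightarrow> is_iso V (\<one> a)"
  by (auto simp: is_iso_def hom_def intro!: bexI[of _ "\<one> a"])

lemma assoc_vfun_iso:
  assumes "1 \<le> i" "i < n" "V_category V A" "V_category V B" "V_category V C"
  shows "is_iso (cat1 VCAT) (assoc_vfun V i A B C)"
proof (rule V_functor_iso)
  show "bij_betw (FOb (assoc_vfun V i A B C)) (VOb (FDom (assoc_vfun V i A B C)))
      (VOb (FCod (assoc_vfun V i A B C)))"
    by (rule bij_betw_byWitness[where f' = "\<lambda>x. NPair (NPair (nfst x) (nfst (nsnd x))) (nsnd (nsnd x))"])
      auto
qed (use assms in \<open>auto simp: assoc_iso\<close>)

lemma left_unit_vfun_iso:
  assumes "1 \<le> i" "i < n" "V_category V A"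
  shows "is_iso (cat1 VCAT) (left_unit_vfun V i A)"
proof (rule V_functor_iso)
  show "bij_betw (FOb (left_unit_vfun V i A)) (VOb (FDom (left_unit_vfun V i A)))
      (VOb (FCod (left_unit_vfun V i A)))"
    by (rule bij_betw_byWitness[where f' = "NPair Pt"]) auto
qed (use assms in \<open>auto simp: is_iso_Idt\<close>)

lemma right_unit_vfun_iso:
  assumes "1 \<le> i" "i < n" "V_category V A"
  shows "is_iso (cat1 VCAT) (right_unit_vfun V i A)"
proof (rule V_functor_iso)
  show "bij_betw (FOb (right_unit_vfun V i A)) (VOb (FDom (right_unit_vfun V i A)))
      (VOb (FCod (right_unit_vfun V i A)))"
    by (rule bij_betw_byWitness[where f' = "\<lambda>a. NPair a Pt"]) auto
qed (use assms in \<open>auto simp: is_iso_Idt\<close>)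

section \<open>Naturality of the structural functors\<close>

lemma assoc_vfun_natural:
  assumes "1 \<le> i" "i < n" "V_functor V T" "V_functor V S" "V_functor V R"
  shows "comp_functor V (assoc_vfun V i (FCod T) (FCod S) (FCod R)) (tensor_vfun V i (tensor_vfun V i T S) R) =
    comp_functor V (tensor_vfun V i T (tensor_vfun V i S R)) (assoc_vfun V i (FDom T) (FDom S) (FDom R))"
  by (rule V_functor_eqI) (use assms in \<open>auto simp: hom_def intro!: asc_natural\<close>)

text \<open>A component of a transformation starts at \<I>, so naturality of \<alpha> at three
  components leaves only the associator at three units.\<close>

lemma assoc_vfun_two_natural:
  assumes "1 \<le> i" "i < n" "V_trans V \<beta>" "V_trans V \<gamma>" "V_trans V \<delta>"
  shows "horiz_comp V
      (id_trans (assoc_vfun V i (FCod (NSrc \<beta>)) (FCod (NSrc \<gamma>)) (FCod (NSrc \<delta>))))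
      (tensor_vtrans V i (tensor_vtrans V i \<beta> \<gamma>) \<delta>) =
    horiz_comp V (tensor_vtrans V i \<beta> (tensor_vtrans V i \<gamma> \<delta>))
      (id_trans (assoc_vfun V i (FDom (NSrc \<beta>)) (FDom (NSrc \<gamma>)) (FDom (NSrc \<delta>))))"
    (is "horiz_comp V (id_trans ?Q) ?L = horiz_comp V ?R (id_trans ?P)")
proof (rule V_trans_eqI)
  note [simp] = assms(3-5)
  \<comment> \<open>A 2-cell carries its boundary, so naturality on 1-cells enters here, for the
    source functors and for the target functors.\<close>
  show "NSrc (horiz_comp V (id_trans ?Q) ?L) = NSrc (horiz_comp V ?R (id_trans ?P))"
    "NTrg (horiz_comp V (id_trans ?Q) ?L) = NTrg (horiz_comp V ?R (id_trans ?P))"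
    using assms(1,2) assoc_vfun_natural[of i "NSrc \<beta>" "NSrc \<gamma>" "NSrc \<delta>"]
      assoc_vfun_natural[of i "NTrg \<beta>" "NTrg \<gamma>" "NTrg \<delta>"] by simp_all
  fix x
  assume "x \<in> VOb (FDom (NSrc (horiz_comp V ?R (id_trans ?P))))"
  then obtain a b c where x: "x = NPair (NPair a b) c"
    and [simp]: "a \<in> VOb (FDom (NSrc \<beta>))" "b \<in> VOb (FDom (NSrc \<gamma>))" "c \<in> VOb (FDom (NSrc \<delta>))"
    by auto
  have "\<alpha> (i + 1) (Trg V (NAt \<beta> a)) (Trg V (NAt \<gamma> b)) (Trg V (NAt \<delta> c))
        \<cdot> ((NAt \<beta> a \<odot>\<^bsub>i + 1\<^esub> NAt \<gamma> b) \<odot>\<^bsub>i + 1\<^esub> NAt \<delta> c) =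
      (NAt \<beta> a \<odot>\<^bsub>i + 1\<^esub> (NAt \<gamma> b \<odot>\<^bsub>i + 1\<^esub> NAt \<delta> c)) \<cdot> \<alpha> (i + 1) \<I> \<I> \<I>"
    by (rule asc_natural) (use assms(1,2) in \<open>simp_all add: hom_def\<close>)
  then show "NAt (horiz_comp V (id_trans ?Q) ?L) x = NAt (horiz_comp V ?R (id_trans ?P)) x"
    using assms(1,2) by (simp add: x del: horiz_comp_sel(3))
qed (use assms in simp_all)

lemma inter_vfun_natural:
  assumes "1 \<le> i" "i < j" "j < n" "V_functor V T" "V_functor V S" "V_functor V R" "V_functor V Q"
  shows "comp_functor V (inter_vfun V i j (FCod T) (FCod S) (FCod R) (FCod Q))
      (tensor_vfun V i (tensor_vfun V j T S) (tensor_vfun V j R Q)) =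
    comp_functor V (tensor_vfun V j (tensor_vfun V i T R) (tensor_vfun V i S Q))
      (inter_vfun V i j (FDom T) (FDom S) (FDom R) (FDom Q))"
  by (rule V_functor_eqI) (use assms in \<open>auto simp: hom_def intro!: eta_natural\<close>)

text \<open>The same argument with \<eta>: four components starting at \<I> leave the interchanger
  at four units.\<close>

lemma inter_vfun_two_natural:
  assumes "1 \<le> i" "i < j" "j < n" "V_trans V \<beta>" "V_trans V \<gamma>" "V_trans V \<delta>" "V_trans V \<epsilon>"
  shows "horiz_comp V
      (id_trans (inter_vfun V i j (FCod (NSrc \<beta>)) (FCod (NSrc \<gamma>)) (FCod (NSrc \<delta>)) (FCod (NSrc \<epsilon>))))
      (tensor_vtrans V i (tensor_vtrans V j \<beta> \<gamma>) (tensor_vtrans V j \<delta> \<epsilon>)) =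
    horiz_comp V (tensor_vtrans V j (tensor_vtrans V i \<beta> \<delta>) (tensor_vtrans V i \<gamma> \<epsilon>))
      (id_trans (inter_vfun V i j (FDom (NSrc \<beta>)) (FDom (NSrc \<gamma>)) (FDom (NSrc \<delta>)) (FDom (NSrc \<epsilon>))))"
    (is "horiz_comp V (id_trans ?Q) ?L = horiz_comp V ?R (id_trans ?P)")
proof (rule V_trans_eqI)
  note [simp] = assms(4-7)
  have [simp]: "0 < i" "0 < j" "1 \<le> i" "i < j" "j < n" "1 \<le> j" "i < n" "i + 1 \<le> n" "j + 1 \<le> n"
    using assms(1-3) by simp_all
  show "NSrc (horiz_comp V (id_trans ?Q) ?L) = NSrc (horiz_comp V ?R (id_trans ?P))"
    "NTrg (horiz_comp V (id_trans ?Q) ?L) = NTrg (horiz_comp V ?R (id_trans ?P))"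
    using inter_vfun_natural[of i j "NSrc \<beta>" "NSrc \<gamma>" "NSrc \<delta>" "NSrc \<epsilon>"]
      inter_vfun_natural[of i j "NTrg \<beta>" "NTrg \<gamma>" "NTrg \<delta>" "NTrg \<epsilon>"] by simp_all
  show "V_trans V (horiz_comp V (id_trans ?Q) ?L)" "V_trans V (horiz_comp V ?R (id_trans ?P))"
    by simp_all
  fix x
  assume "x \<in> VOb (FDom (NSrc (horiz_comp V ?R (id_trans ?P))))"
  then obtain a b c d where x: "x = NPair (NPair a b) (NPair c d)"
    and [simp]: "a \<in> VOb (FDom (NSrc \<beta>))" "b \<in> VOb (FDom (NSrc \<gamma>))" "c \<in> VOb (FDom (NSrc \<delta>))"
      "d \<in> VOb (FDom (NSrc \<epsilon>))"
    by auto
  have "\<eta> (i + 1) (j + 1) (Trg V (NAt \<beta> a)) (Trg V (NAt \<gamma> b)) (Trg V (NAt \<delta> c)) (Trg V (NAt \<epsilon> d))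
        \<cdot> ((NAt \<beta> a \<odot>\<^bsub>j + 1\<^esub> NAt \<gamma> b) \<odot>\<^bsub>i + 1\<^esub> (NAt \<delta> c \<odot>\<^bsub>j + 1\<^esub> NAt \<epsilon> d)) =
      ((NAt \<beta> a \<odot>\<^bsub>i + 1\<^esub> NAt \<delta> c) \<odot>\<^bsub>j + 1\<^esub> (NAt \<gamma> b \<odot>\<^bsub>i + 1\<^esub> NAt \<epsilon> d)) \<cdot> \<eta> (i + 1) (j + 1) \<I> \<I> \<I> \<I>"
    by (rule eta_natural) (use assms(1-3) in \<open>simp_all add: hom_def\<close>)
  then show "NAt (horiz_comp V (id_trans ?Q) ?L) x = NAt (horiz_comp V ?R (id_trans ?P)) x"
    using assms(1-3) by (simp add: x del: horiz_comp_sel(3))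
qed

text \<open>The identity transformation on the unit category has component
  \<open>\<one> \<I>\<close>, and multiplying a component of \<beta> by it changes nothing.\<close>

lemma left_unit_vfun_two_natural:
  assumes "1 \<le> i" "i < n" "V_trans V \<beta>"
  shows "horiz_comp V (id_trans (left_unit_vfun V i (FCod (NSrc \<beta>))))
      (tensor_vtrans V i (id_trans (id_functor V (unit_vcat V))) \<beta>) =
    horiz_comp V \<beta> (id_trans (left_unit_vfun V i (FDom (NSrc \<beta>))))"
proof -
  have "comp_functor V (left_unit_vfun V i (FCod T)) (tensor_vfun V i (id_functor V (unit_vcat V)) T) =
      comp_functor V T (left_unit_vfun V i (FDom T))" if "V_functor V T" for T
    by (rule V_functor_eqI) (use assms(1,2) that in auto)
  from this[of "NSrc \<beta>"] this[of "NTrg \<beta>"] assms show ?thesis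
    by (intro V_trans_eqI) (auto simp del: horiz_comp_sel(3))
qed

lemma right_unit_vfun_two_natural:
  assumes "1 \<le> i" "i < n" "V_trans V \<beta>"
  shows "horiz_comp V (id_trans (right_unit_vfun V i (FCod (NSrc \<beta>))))
      (tensor_vtrans V i \<beta> (id_trans (id_functor V (unit_vcat V)))) =
    horiz_comp V \<beta> (id_trans (right_unit_vfun V i (FDom (NSrc \<beta>))))"
proof -
  have "comp_functor V (right_unit_vfun V i (FCod T)) (tensor_vfun V i T (id_functor V (unit_vcat V))) =
      comp_functor V T (right_unit_vfun V i (FDom T))" if "V_functor V T" for T
    by (rule V_functor_eqI) (use assms(1,2) that in auto)
  from this[of "NSrc \<beta>"] this[of "NTrg \<beta>"] assms show ?thesis
    by (intro V_trans_eqI) (auto simp del: horiz_comp_sel(3))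
qed

section \<open>Coherence equations of the structural functors\<close>

lemma assoc_vfun_pentagon:
  assumes "1 \<le> i" "i < n" "V_category V A" "V_category V B" "V_category V C" "V_category V D"
  shows "comp_functor V (assoc_vfun V i A B (tensor_vcat V i C D)) (assoc_vfun V i (tensor_vcat V i A B) C D) =
    comp_functor V (tensor_vfun V i (id_functor V A) (assoc_vfun V i B C D))
      (comp_functor V (assoc_vfun V i A (tensor_vcat V i B C) D)
        (tensor_vfun V i (assoc_vfun V i A B C) (id_functor V D)))"
  by (rule V_functor_eqI) (use assms in \<open>auto simp: pentagon\<close>)

text \<open>On objects both sides permute the same six entries; on hom-objects this is the base
  axiom for i + 1 and j + 1. The instances with first index 1 went into the associativity of
  composition in a product.\<close>

lemma inter_vfun_internal_associativity:
  assumes "1 \<le> i" "i < j" "j < n" "V_category V A" "V_category V B" "V_category V C" "V_category V D"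
    and "V_category V E" "V_category V F"
  shows "comp_functor V (inter_vfun V i j A B (tensor_vcat V i C E) (tensor_vcat V i D F))
      (comp_functor V (tensor_vfun V i (id_functor V (tensor_vcat V j A B)) (inter_vfun V i j C D E F))
        (assoc_vfun V i (tensor_vcat V j A B) (tensor_vcat V j C D) (tensor_vcat V j E F))) =
    comp_functor V (tensor_vfun V j (assoc_vfun V i A C E) (assoc_vfun V i B D F))
      (comp_functor V (inter_vfun V i j (tensor_vcat V i A C) (tensor_vcat V i B D) E F)
        (tensor_vfun V i (inter_vfun V i j A B C D) (id_functor V (tensor_vcat V j E F))))"
  by (rule V_functor_eqI) (use assms in \<open>auto simp: internal_associativity\<close>)

lemma inter_vfun_external_associativity:
  assumes "1 \<le> i" "i < j" "j < n" "V_category V A" "V_category V B" "V_category V C" "V_category V D"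
    and "V_category V E" "V_category V F"
  shows "comp_functor V (tensor_vfun V j (id_functor V (tensor_vcat V i A D)) (inter_vfun V i j B C E F))
      (comp_functor V (inter_vfun V i j A (tensor_vcat V j B C) D (tensor_vcat V j E F))
        (tensor_vfun V i (assoc_vfun V j A B C) (assoc_vfun V j D E F))) =
    comp_functor V (assoc_vfun V j (tensor_vcat V i A D) (tensor_vcat V i B E) (tensor_vcat V i C F))
      (comp_functor V (tensor_vfun V j (inter_vfun V i j A B D E) (id_functor V (tensor_vcat V i C F)))
        (inter_vfun V i j (tensor_vcat V j A B) C (tensor_vcat V j D E) F))"
  by (rule V_functor_eqI) (use assms in \<open>auto simp: external_associativity\<close>)

text \<open>The base hexagon for i + 1 < j + 1 < l + 1, whereas its instances with first index 1
  made the interchange transformations functors.\<close>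

lemma inter_vfun_giant_hexagon:
  assumes "1 \<le> i" "i < j" "j < l" "l < n"
    and "V_category V A" "V_category V A'" "V_category V B" "V_category V B'"
    and "V_category V D" "V_category V D'" "V_category V E" "V_category V E'"
  shows "comp_functor V (tensor_vfun V l (inter_vfun V i j A B D E) (inter_vfun V i j A' B' D' E'))
      (comp_functor V (inter_vfun V i l (tensor_vcat V j A B) (tensor_vcat V j A' B')
          (tensor_vcat V j D E) (tensor_vcat V j D' E'))
        (tensor_vfun V i (inter_vfun V j l A A' B B') (inter_vfun V j l D D' E E'))) =
    comp_functor V (inter_vfun V j l (tensor_vcat V i A D) (tensor_vcat V i A' D')
        (tensor_vcat V i B E) (tensor_vcat V i B' E'))
      (comp_functor V (tensor_vfun V j (inter_vfun V i l A A' D D') (inter_vfun V i l B B' E E'))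
        (inter_vfun V i j (tensor_vcat V l A A') (tensor_vcat V l B B')
          (tensor_vcat V l D D') (tensor_vcat V l E E')))"
  by (rule V_functor_eqI) (use assms in \<open>auto simp: giant_hexagon\<close>)

section \<open>Assembly of the iterated monoidal 2-category\<close>

lemma iterated_coherence_VCat: "iterated_coherence (n - 1) (under1 VCAT)"
  by (rule iterated_coherence.intro)
    (simp_all add: under1_def VCat_def assoc_vfun_pentagon inter_vfun_internal_associativity
      inter_vfun_external_associativity inter_vfun_giant_hexagon)

lemma tensor_two_functor_VCat:
  assumes "1 \<le> i" "i < n"
  shows "is_two_functor (prod_twocat VCAT VCAT) VCAT
    \<lparr>on0 = case_prod (ten0 VCAT i), on1 = case_prod (ten1 VCAT i), on2 = case_prod (ten2 VCAT i)\<rparr>"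
  using assms
  by (auto simp: is_two_functor_def is_functor_def prod_twocat_def cat1_def vcat_def hcat_def VCat_def
      hom_def tensor_vfun_comp tensor_vtrans_vert_comp tensor_vtrans_horiz_comp)

lemma assoc_two_nat_VCat:
  assumes "1 \<le> i" "i < n"
  shows "is_two_nat (prod_twocat (prod_twocat VCAT VCAT) VCAT) VCAT
    \<lparr>on0 = paren_left (ten0 VCAT i), on1 = paren_left (ten1 VCAT i), on2 = paren_left (ten2 VCAT i)\<rparr>
    \<lparr>on0 = paren_right (ten0 VCAT i), on1 = paren_right (ten1 VCAT i), on2 = paren_right (ten2 VCAT i)\<rparr>
    (\<lambda>((a, b), c). asc2 VCAT i a b c)"
  using assms
  by (auto simp: is_two_nat_def is_two_functor_def is_functor_def prod_twocat_def cat1_def vcat_def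
      hcat_def VCat_def hom_def paren_left_def paren_right_def tensor_vfun_comp tensor_vtrans_vert_comp
      tensor_vtrans_horiz_comp assoc_vfun_two_natural)

lemma inter_two_nat_VCat:
  assumes "1 \<le> i" "i < j" "j < n"
  shows "is_two_nat (prod_twocat (prod_twocat VCAT VCAT) (prod_twocat VCAT VCAT)) VCAT
    \<lparr>on0 = inter_src (ten0 VCAT i) (ten0 VCAT j), on1 = inter_src (ten1 VCAT i) (ten1 VCAT j),
      on2 = inter_src (ten2 VCAT i) (ten2 VCAT j)\<rparr>
    \<lparr>on0 = inter_trg (ten0 VCAT i) (ten0 VCAT j), on1 = inter_trg (ten1 VCAT i) (ten1 VCAT j),
      on2 = inter_trg (ten2 VCAT i) (ten2 VCAT j)\<rparr>
    (\<lambda>((a, b), (c, d)). eta2 VCAT i j a b c d)"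
  using assms
  by (auto simp: is_two_nat_def is_two_functor_def is_functor_def prod_twocat_def cat1_def vcat_def
      hcat_def VCat_def hom_def inter_src_def inter_trg_def tensor_vfun_comp tensor_vtrans_vert_comp
      tensor_vtrans_horiz_comp inter_vfun_two_natural)

lemma lun_two_nat_VCat:
  assumes "1 \<le> i" "i < n"
  shows "is_two_nat VCAT VCAT
    \<lparr>on0 = ten0 VCAT i (unt2 VCAT), on1 = ten1 VCAT i (id1 VCAT (unt2 VCAT)),
      on2 = ten2 VCAT i (id2 VCAT (id1 VCAT (unt2 VCAT)))\<rparr>
    \<lparr>on0 = (\<lambda>a. a), on1 = (\<lambda>f. f), on2 = (\<lambda>\<sigma>. \<sigma>)\<rparr> (lun VCAT i)"
proof -
  let ?J = "id_functor V (unit_vcat V)"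
  \<comment> \<open>The general laws expect a composite in both slots. The fixed slot is read as the
    identity composed with itself, here and in the vertical and horizontal versions below.\<close>
  have comp: "tensor_vfun V i ?J (comp_functor V Q T) = comp_functor V (tensor_vfun V i ?J Q) (tensor_vfun V i ?J T)"
    if "V_functor V T" "V_functor V Q" "FCod T = FDom Q" for T Q
    using tensor_vfun_comp[of i ?J T ?J Q] that assms by simp
  have vert: "tensor_vtrans V i (id_trans ?J) (vert_comp V \<tau> \<sigma>) =
      vert_comp V (tensor_vtrans V i (id_trans ?J) \<tau>) (tensor_vtrans V i (id_trans ?J) \<sigma>)"
    if "V_trans V \<sigma>" "V_trans V \<tau>" "NTrg \<sigma> = NSrc \<tau>" for \<sigma> \<tau>
    using tensor_vtrans_vert_comp[of i "id_trans ?J" \<sigma> "id_trans ?J" \<tau>] that assms by simp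
  have horiz: "tensor_vtrans V i (id_trans ?J) (horiz_comp V \<tau> \<sigma>) =
      horiz_comp V (tensor_vtrans V i (id_trans ?J) \<tau>) (tensor_vtrans V i (id_trans ?J) \<sigma>)"
    if "V_trans V \<sigma>" "V_trans V \<tau>" "FCod (NSrc \<sigma>) = FDom (NSrc \<tau>)" for \<sigma> \<tau>
    using tensor_vtrans_horiz_comp[of i "id_trans ?J" \<sigma> "id_trans ?J" \<tau>] that assms by simp
  show ?thesis
    using assms
    by (auto simp: is_two_nat_def is_two_functor_def is_functor_def cat1_def vcat_def hcat_def VCat_def
        hom_def comp vert horiz left_unit_vfun_two_natural)
qed

lemma run_two_nat_VCat:
  assumes "1 \<le> i" "i < n"
  shows "is_two_nat VCAT VCAT
    \<lparr>on0 = (\<lambda>a. ten0 VCAT i a (unt2 VCAT)), on1 = (\<lambda>f. ten1 VCAT i f (id1 VCAT (unt2 VCAT))),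
      on2 = (\<lambda>\<sigma>. ten2 VCAT i \<sigma> (id2 VCAT (id1 VCAT (unt2 VCAT))))\<rparr>
    \<lparr>on0 = (\<lambda>a. a), on1 = (\<lambda>f. f), on2 = (\<lambda>\<sigma>. \<sigma>)\<rparr> (run VCAT i)"
proof -
  let ?J = "id_functor V (unit_vcat V)"
  have comp: "tensor_vfun V i (comp_functor V Q T) ?J = comp_functor V (tensor_vfun V i Q ?J) (tensor_vfun V i T ?J)"
    if "V_functor V T" "V_functor V Q" "FCod T = FDom Q" for T Q
    using tensor_vfun_comp[of i T ?J Q ?J] that assms by simp
  have vert: "tensor_vtrans V i (vert_comp V \<tau> \<sigma>) (id_trans ?J) =
      vert_comp V (tensor_vtrans V i \<tau> (id_trans ?J)) (tensor_vtrans V i \<sigma> (id_trans ?J))"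
    if "V_trans V \<sigma>" "V_trans V \<tau>" "NTrg \<sigma> = NSrc \<tau>" for \<sigma> \<tau>
    using tensor_vtrans_vert_comp[of i \<sigma> "id_trans ?J" \<tau> "id_trans ?J"] that assms by simp
  have horiz: "tensor_vtrans V i (horiz_comp V \<tau> \<sigma>) (id_trans ?J) =
      horiz_comp V (tensor_vtrans V i \<tau> (id_trans ?J)) (tensor_vtrans V i \<sigma> (id_trans ?J))"
    if "V_trans V \<sigma>" "V_trans V \<tau>" "FCod (NSrc \<sigma>) = FDom (NSrc \<tau>)" for \<sigma> \<tau>
    using tensor_vtrans_horiz_comp[of i \<sigma> "id_trans ?J" \<tau> "id_trans ?J"] that assms by simp
  show ?thesis
    using assms
    by (auto simp: is_two_nat_def is_two_functor_def is_functor_def cat1_def vcat_def hcat_def VCat_def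
        hom_def comp vert horiz right_unit_vfun_two_natural)
qed

lemma left_right_unit_vfun:
  assumes "1 \<le> i" "i < n"
  shows "left_unit_vfun V i (unit_vcat V) = right_unit_vfun V i (unit_vcat V)"
  by (rule V_functor_eqI) (use assms in auto)

text \<open>The unit functors have identity hom-morphisms, so on hom-objects only the internal unit
  condition for i + 1 and j + 1 remains.\<close>

lemma inter_vfun_internal_unit:
  assumes "1 \<le> i" "i < j" "j < n" "V_category V A" "V_category V B"
  shows "comp_functor V (tensor_vfun V j (right_unit_vfun V i A) (right_unit_vfun V i B))
      (inter_vfun V i j A B (unit_vcat V) (unit_vcat V)) =
    comp_functor V (right_unit_vfun V i (tensor_vcat V j A B))
      (tensor_vfun V i (id_functor V (tensor_vcat V j A B)) (left_unit_vfun V j (unit_vcat V)))"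
    and "comp_functor V (tensor_vfun V j (left_unit_vfun V i A) (left_unit_vfun V i B))
      (inter_vfun V i j (unit_vcat V) (unit_vcat V) A B) =
    comp_functor V (left_unit_vfun V i (tensor_vcat V j A B))
      (tensor_vfun V i (left_unit_vfun V j (unit_vcat V)) (id_functor V (tensor_vcat V j A B)))"
  by (rule V_functor_eqI; use assms in auto)+

text \<open>On hom-objects this is the external unit condition for i + 1 and j + 1, the unit
  functors again contributing identities.\<close>

lemma inter_vfun_external_unit:
  assumes "1 \<le> i" "i < j" "j < n" "V_category V A" "V_category V B"
  shows "comp_functor V (right_unit_vfun V j (tensor_vcat V i A B))
      (comp_functor V (tensor_vfun V j (id_functor V (tensor_vcat V i A B)) (left_unit_vfun V i (unit_vcat V)))
        (inter_vfun V i j A (unit_vcat V) B (unit_vcat V))) =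
    tensor_vfun V i (right_unit_vfun V j A) (right_unit_vfun V j B)"
    and "comp_functor V (left_unit_vfun V j (tensor_vcat V i A B))
      (comp_functor V (tensor_vfun V j (left_unit_vfun V i (unit_vcat V)) (id_functor V (tensor_vcat V i A B)))
        (inter_vfun V i j (unit_vcat V) A (unit_vcat V) B)) =
    tensor_vfun V i (left_unit_vfun V j A) (left_unit_vfun V j B)"
  by (rule V_functor_eqI; use assms in auto)+

lemma iterated_monoidal_two_category_VCat: "iterated_monoidal_two_category (n - 1) VCAT"
proof (intro iterated_monoidal_two_category.intro iterated_monoidal_two_category_axioms.intro
    two_category_VCat iterated_coherence_VCat)
  fix i
  assume "1 \<le> i" "i \<le> n - 1"
  then have i: "1 \<le> i" "i < n"
    by simp_all
  show "is_two_functor (prod_twocat VCAT VCAT) VCAT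
      \<lparr>on0 = case_prod (ten0 VCAT i), on1 = case_prod (ten1 VCAT i), on2 = case_prod (ten2 VCAT i)\<rparr>"
    using i by (rule tensor_two_functor_VCat)
\<comment> \<open>The 2-naturality goals are closed while the structure is still folded; it is
  unfolded only for the isomorphisms and the unit equations.\<close>
qed (simp_all add: assoc_two_nat_VCat inter_two_nat_VCat lun_two_nat_VCat run_two_nat_VCat,
    simp_all add: VCat_def assoc_vfun_iso[unfolded VCat_def] left_unit_vfun_iso[unfolded VCat_def]
      right_unit_vfun_iso[unfolded VCat_def] left_right_unit_vfun[symmetric] inter_vfun_internal_unit
      inter_vfun_external_unit)

end

theorem theorem1:
  fixes k :: nat and V :: "('o, 'm) tcat"
  assumes "k \<ge> 1" and "iterated_monoidal_category k V"
  shows "iterated_monoidal_two_category (k - 1)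
    (VCat V :: (('u nest, 'o, 'm) vcategory, ('u nest, 'o, 'm) vfunctor,
      ('u nest, 'o, 'm) vtrans) mon2cat)"
proof -
  \<comment> \<open>The bound on k supplies the first product, over which everything is
    enriched.\<close>
  interpret enrichment_base k V
    using assms by (simp add: enrichment_base_def enrichment_base_axioms_def)
  show ?thesis
    by (rule iterated_monoidal_two_category_VCat)
qed

end
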